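(* Let $G$ be a non-elementary Gromov-hyperbolic group with Cayley graph $\Gamma$ (with respect to a finite symmetric generating set), and consider first passage percolation on $\Gamma$ with i.i.d. edge lengths of law $\rho$, where $\rho$ has no atoms and $\int_0^\infty e^{ax}\,d\rho(x)<\infty$ for some $a>0$. Fix the base-point $1$. There exists a full measure subset $\Omega_0\subset\Omega$ such that for all $\omega\in\Omega_0$ the inclusion $i_\omega^F:F(1,\omega)\to\Gamma$ is (1) proper and (2) 2-proper. Hence for all $\omega\in\Omega_0$, $i_\omega^F:F(1,\omega)\to\Gamma$ admits a Cannon-Thurston map. Further, given $\xi\in\partial G$ and any $\omega\in\Omega_0\cap\Omega_\xi$, the inclusion $i_\omega^T:T(\xi,\omega)\to\Gamma$ is (1) proper and (2) 2-proper. Hence for all $\xi\in\partial G$ and $\omega\in\Omega_0\cap\Omega_\xi$, $i_\omega^T:T(\xi,\omega)\to\Gamma$ admits a Cannon-Thurston map. Finally (after possibly passing to a further full measure subset), the boundary values of the Cannon-Thurston maps $\partial i_\omega^F:\partial F(1,\omega)\to\partial G$ and $\partial i_\omega^T:\partial T(\xi,\omega)\to\partial G$ are surjective.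
   Context: $\Gamma$ has edge set $E$ and is equipped with the word metric $d$; $1$ is the identity of $G$ (a vertex of $\Gamma$); $\partial G$ is the Gromov boundary. The configuration space is $\Omega=[0,\infty)^E$ with product measure $\mathbb{P}=\rho^{\otimes E}$. For $\omega\in\Omega$, $d_\omega(x,y)=\inf_{\gamma:x\to y}\sum_{e\in\gamma}\omega(e)$ over edge paths from $x$ to $y$. A finite path is an $\omega$-geodesic if it attains $d_\omega$ between its endpoints; for a.e. $\omega$ there is a unique $\omega$-geodesic $[x,y]_\omega$ between every pair of vertices. A semi-infinite path is an $\omega$-geodesic ray if each finite subpath is an $\omega$-geodesic; it has direction $\xi\in\partial G$ if $\xi$ is its only accumulation point in $\partial G$. Forward tree: $F(1,\omega)=\bigcup_{g\in G}[1,g]_\omega$, a tree for a.e. $\omega$. Backward tree: for fixed $\xi\in\partial G$, $\Omega_\xi$ denotes a full measure subset of $\Omega$ such that for $\omega\in\Omega_\xi$ there is for every $g\in G$ a unique $\omega$-geodesic ray $[g,\xi)_\omega$ from $g$ in direction $\xi$, the union $T(\xi,\omega)=\bigcup_{g\in G}[g,\xi)_\omega$ is a tree, and for every $\xi'\ne\xi$ in $\partial G$ the tree $T(\xi,\omega)$ contains a bi-infinite $\omega$-geodesic with ends in directions $\xi'$ and $\xi$. Both trees carry the intrinsic simplicial metric $d^s_\omega$ (minimal number of edges of a path inside the tree) and base-point $1$; $\Gamma$ carries the word metric and base-point $1$. A function $M:\mathbb{N}\to\mathbb{N}$ is proper if $M(n)\to\infty$ as $n\to\infty$. An embedding $i:(Y,y_0,d_Y)\to(X,x_0,d_X)$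 of based metric spaces is proper if there is a proper function $M$ such that $d_Y(y_0,y)\ge n$ implies $d_X(x_0,i(y))\ge M(n)$. For hyperbolic $X,Y$, the embedding is 2-proper if there is a proper function $M'$ such that for all $y_1,y_2\in Y$, $d_Y(y_0,[y_1,y_2]_Y)\ge n$ implies $d_X(x_0,[i(y_1),i(y_2)]_X)\ge M'(n)$, where $[\cdot,\cdot]_Y,[\cdot,\cdot]_X$ denote geodesics in $Y$, $X$. (The functions $M,M'$ may depend on $\omega$.) A proper embedding $i:Y\to X$ of hyperbolic spaces admits a Cannon-Thurston map if $i$ extends continuously to a map $\hat i:\hat Y\to\hat X$ of Gromov compactifications; this extension is the Cannon-Thurston map, and its boundary value is its restriction $\partial i:\partial Y\to\partial X$. *)

theory Defs
  imports "HOL-Probability.Probability" "HOL-Algebra.Generated_Groups"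
begin

section \<open>Based metric spaces, hyperbolicity and the Gromov compactification\<close>

record 'a based_space =
  pts  :: "'a set"
  bpt  :: 'a
  dst  :: "'a \<Rightarrow> 'a \<Rightarrow> real"

abbreviation mtop :: "'a based_space \<Rightarrow> 'a topology" where
  "mtop X \<equiv> Metric_space.mtopology (pts X) (dst X)"

definition gromov_product :: "('a \<Rightarrow> 'a \<Rightarrow> real) \<Rightarrow> 'a \<Rightarrow> 'a \<Rightarrow> 'a \<Rightarrow> real" where
  "gromov_product d w x y = (d w x + d w y - d x y) / 2"

definition hyperbolic_space :: "'a based_space \<Rightarrow> bool" where
  "hyperbolic_space X \<longleftrightarrow>
     Metric_space (pts X) (dst X) \<and> bpt X \<in> pts X \<and>
     (\<exists>\<delta>. \<forall>w\<in>pts X. \<forall>x\<in>pts X. \<forall>y\<in>pts X. \<forall>z\<in>pts X.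
        gromov_product (dst X) w x z
          \<ge> min (gromov_product (dst X) w x y) (gromov_product (dst X) w y z) - \<delta>)"

definition gromov_seqs :: "'a based_space \<Rightarrow> (nat \<Rightarrow> 'a) set" where
  "gromov_seqs X = {s. range s \<subseteq> pts X \<and>
     filterlim (\<lambda>(i, j). gromov_product (dst X) (bpt X) (s i) (s j))
       at_top (sequentially \<times>\<^sub>F sequentially)}"

definition gromov_equiv :: "'a based_space \<Rightarrow> ((nat \<Rightarrow> 'a) \<times> (nat \<Rightarrow> 'a)) set" where
  "gromov_equiv X = {(s, t). s \<in> gromov_seqs X \<and> t \<in> gromov_seqs X \<and>
     filterlim (\<lambda>(i, j). gromov_product (dst X) (bpt X) (s i) (t j))
       at_top (sequentially \<times>\<^sub>F sequentially)}"

definition gromov_boundary :: "'a based_space \<Rightarrow> (nat \<Rightarrow> 'a) set set" where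
  "gromov_boundary X = gromov_seqs X // gromov_equiv X"

text \<open>The Gromov compactification is carried by the disjoint union of the space and its boundary:
  \<open>Inl x\<close> is a point of the space, \<open>Inr \<xi>\<close> a point of the boundary.\<close>

type_synonym 'a gpoint = "'a + (nat \<Rightarrow> 'a) set"

definition compactified_pts :: "'a based_space \<Rightarrow> 'a gpoint set" where
  "compactified_pts X = Inl ` pts X \<union> Inr ` gromov_boundary X"

fun representing_seqs :: "'a gpoint \<Rightarrow> (nat \<Rightarrow> 'a) set" where
  "representing_seqs (Inl x) = {\<lambda>_. x}"
| "representing_seqs (Inr \<xi>) = \<xi>"

definition ext_gromov_product :: "'a based_space \<Rightarrow> 'a gpoint \<Rightarrow> 'a gpoint \<Rightarrow> ereal" where
  "ext_gromov_product X u v =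
     (SUP s\<in>representing_seqs u. SUP t\<in>representing_seqs v.
        Liminf (sequentially \<times>\<^sub>F sequentially)
          (\<lambda>(i, j). ereal (gromov_product (dst X) (bpt X) (s i) (t j))))"

text \<open>A set is open if its trace on the space is open for the metric and, around each of its
  boundary points \<open>\<xi>\<close>, it contains all points whose Gromov product with \<open>\<xi>\<close> is large enough.\<close>

definition gromov_open :: "'a based_space \<Rightarrow> 'a gpoint set \<Rightarrow> bool" where
  "gromov_open X U \<longleftrightarrow>
     U \<subseteq> compactified_pts X \<and> openin (mtop X) (Inl -` U) \<and>
     (\<forall>\<xi>. Inr \<xi> \<in> U \<longrightarrow>
        (\<exists>R::real. {z \<in> compactified_pts X. ereal R < ext_gromov_product X z (Inr \<xi>)} \<subseteq> U))"

definition gromov_compactification :: "'a based_space \<Rightarrow> 'a gpoint topology" where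
  "gromov_compactification X = topology (gromov_open X)"

lemma istopology_gromov_open: "istopology (gromov_open X)"
  unfolding istopology_def
proof (intro conjI allI impI)
  fix U V assume U: "gromov_open X U" and V: "gromov_open X V"
  have "\<exists>R::real. {z \<in> compactified_pts X. ereal R < ext_gromov_product X z (Inr \<xi>)} \<subseteq> U \<inter> V"
    if \<xi>: "Inr \<xi> \<in> U \<inter> V" for \<xi>
  proof -
    obtain R1 R2 :: real where
      1: "{z \<in> compactified_pts X. ereal R1 < ext_gromov_product X z (Inr \<xi>)} \<subseteq> U" and
      2: "{z \<in> compactified_pts X. ereal R2 < ext_gromov_product X z (Inr \<xi>)} \<subseteq> V"
      using U V \<xi> unfolding gromov_open_def by blast
    have "ereal R1 < p \<and> ereal R2 < p" if "ereal (max R1 R2) < p" for p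
      using that by (metis ereal_max max_less_iff_conj)
    then show ?thesis using 1 2 by blast
  qed
  then show "gromov_open X (U \<inter> V)"
    using U V unfolding gromov_open_def by (auto simp: vimage_Int)
next
  fix K :: "'a gpoint set set" assume K: "\<forall>U\<in>K. gromov_open X U"
  have "Inl -` \<Union>K = (\<Union>U\<in>K. Inl -` U)" by blast
  then have "openin (mtop X) (Inl -` \<Union>K)"
    using K unfolding gromov_open_def by auto
  moreover have "\<exists>R::real. {z \<in> compactified_pts X. ereal R < ext_gromov_product X z (Inr \<xi>)} \<subseteq> \<Union>K"
    if "Inr \<xi> \<in> \<Union>K" for \<xi>
    using K that unfolding gromov_open_def by (meson Sup_upper UnionE order_trans)
  moreover have "\<Union>K \<subseteq> compactified_pts X"
    using K unfolding gromov_open_def by blast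
  ultimately show "gromov_open X (\<Union>K)"
    unfolding gromov_open_def by blast
qed

lemma openin_gromov_compactification:
  "openin (gromov_compactification X) U \<longleftrightarrow> gromov_open X U"
  by (simp add: gromov_compactification_def istopology_gromov_open)

section \<open>Proper and 2-proper embeddings, Cannon-Thurston maps\<close>

definition based_embedding :: "'b based_space \<Rightarrow> 'a based_space \<Rightarrow> ('b \<Rightarrow> 'a) \<Rightarrow> bool" where
  "based_embedding Y X i \<longleftrightarrow> embedding_map (mtop Y) (mtop X) i \<and> i (bpt Y) = bpt X"

definition proper_fun :: "(nat \<Rightarrow> nat) \<Rightarrow> bool" where
  "proper_fun M \<longleftrightarrow> filterlim M at_top at_top"

definition proper_embedding :: "'b based_space \<Rightarrow> 'a based_space \<Rightarrow> ('b \<Rightarrow> 'a) \<Rightarrow> bool" where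
  "proper_embedding Y X i \<longleftrightarrow> based_embedding Y X i \<and>
     (\<exists>M. proper_fun M \<and>
        (\<forall>n. \<forall>y\<in>pts Y. dst Y (bpt Y) y \<ge> real n \<longrightarrow> dst X (bpt X) (i y) \<ge> real (M n)))"

text \<open>Graphs are represented by their vertex sets with the path metric, so a geodesic is the
  list of vertices met by a shortest edge path.\<close>

definition geodesic_between :: "'a based_space \<Rightarrow> 'a \<Rightarrow> 'a \<Rightarrow> 'a list \<Rightarrow> bool" where
  "geodesic_between X x y p \<longleftrightarrow>
     p \<noteq> [] \<and> hd p = x \<and> last p = y \<and> set p \<subseteq> pts X \<and>
     (\<forall>i<length p. \<forall>j<length p. dst X (p ! i) (p ! j) = \<bar>real i - real j\<bar>)"

definition dist_to_set :: "'a based_space \<Rightarrow> 'a \<Rightarrow> 'a set \<Rightarrow> real" where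
  "dist_to_set X x A = (INF a\<in>A. dst X x a)"

definition two_proper_embedding :: "'b based_space \<Rightarrow> 'a based_space \<Rightarrow> ('b \<Rightarrow> 'a) \<Rightarrow> bool" where
  "two_proper_embedding Y X i \<longleftrightarrow>
     hyperbolic_space Y \<and> hyperbolic_space X \<and> based_embedding Y X i \<and>
     (\<exists>M. proper_fun M \<and>
        (\<forall>n. \<forall>y1\<in>pts Y. \<forall>y2\<in>pts Y. \<forall>p q.
           geodesic_between Y y1 y2 p \<longrightarrow> geodesic_between X (i y1) (i y2) q \<longrightarrow>
           dist_to_set Y (bpt Y) (set p) \<ge> real n \<longrightarrow>
           dist_to_set X (bpt X) (set q) \<ge> real (M n)))"

definition cannon_thurston_map ::
    "'b based_space \<Rightarrow> 'a based_space \<Rightarrow> ('b \<Rightarrow> 'a) \<Rightarrow> ('b gpoint \<Rightarrow> 'a gpoint) \<Rightarrow> bool" where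
  "cannon_thurston_map Y X i f \<longleftrightarrow>
     hyperbolic_space Y \<and> hyperbolic_space X \<and> proper_embedding Y X i \<and>
     continuous_map (gromov_compactification Y) (gromov_compactification X) f \<and>
     (\<forall>y\<in>pts Y. f (Inl y) = Inl (i y))"

definition admits_cannon_thurston ::
    "'b based_space \<Rightarrow> 'a based_space \<Rightarrow> ('b \<Rightarrow> 'a) \<Rightarrow> bool" where
  "admits_cannon_thurston Y X i \<longleftrightarrow> (\<exists>f. cannon_thurston_map Y X i f)"

text \<open>A Cannon-Thurston map is determined on the compactification but, being a HOL function, not
  outside of it; hence the quantification over all of them. Existence is required separately.\<close>

definition cannon_thurston_boundary_surj ::
    "'b based_space \<Rightarrow> 'a based_space \<Rightarrow> ('b \<Rightarrow> 'a) \<Rightarrow> bool" where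
  "cannon_thurston_boundary_surj Y X i \<longleftrightarrow>
     admits_cannon_thurston Y X i \<and>
     (\<forall>f. cannon_thurston_map Y X i f \<longrightarrow>
        f ` Inr ` gromov_boundary Y = Inr ` gromov_boundary X)"

section \<open>Graphs\<close>

text \<open>A graph is a vertex set with a set of undirected edges, each a two-element set.\<close>

type_synonym 'a graph = "'a set \<times> 'a set set"

fun path_edges :: "'a list \<Rightarrow> 'a set list" where
  "path_edges (x # y # zs) = {x, y} # path_edges (y # zs)"
| "path_edges _ = []"

definition walk_between :: "'a graph \<Rightarrow> 'a \<Rightarrow> 'a \<Rightarrow> 'a list \<Rightarrow> bool" where
  "walk_between \<G> x y p \<longleftrightarrow>
     p \<noteq> [] \<and> hd p = x \<and> last p = y \<and> set p \<subseteq> fst \<G> \<and> set (path_edges p) \<subseteq> snd \<G>"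

definition is_tree :: "'a graph \<Rightarrow> bool" where
  "is_tree \<G> \<longleftrightarrow> fst \<G> \<noteq> {} \<and>
     (\<forall>x\<in>fst \<G>. \<forall>y\<in>fst \<G>. \<exists>!p. walk_between \<G> x y p \<and> distinct p)"

definition simplicial_dist :: "'a graph \<Rightarrow> 'a \<Rightarrow> 'a \<Rightarrow> real" where
  "simplicial_dist \<G> x y =
     real (LEAST n. \<exists>p. walk_between \<G> x y p \<and> length (path_edges p) = n)"

definition simplicial_space :: "'a graph \<Rightarrow> 'a \<Rightarrow> 'a based_space" where
  "simplicial_space \<G> v = \<lparr>pts = fst \<G>, bpt = v, dst = simplicial_dist \<G>\<rparr>"

section \<open>Groups and Cayley graphs\<close>

text \<open>Finite groups are virtually cyclic: take the trivial subgroup.\<close>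

definition virtually_cyclic :: "('a, 'b) monoid_scheme \<Rightarrow> bool" where
  "virtually_cyclic G \<longleftrightarrow> (\<exists>a\<in>carrier G. finite (rcosets\<^bsub>G\<^esub> (generate G {a})))"

text \<open>Loops, which arise if the generating set contains the identity, are dropped: they are
  irrelevant for geodesics.\<close>

definition cayley_edges :: "('a, 'b) monoid_scheme \<Rightarrow> 'a set \<Rightarrow> 'a set set" where
  "cayley_edges G S =
     {{g, g \<otimes>\<^bsub>G\<^esub> s} | g s. g \<in> carrier G \<and> s \<in> S \<and> g \<otimes>\<^bsub>G\<^esub> s \<noteq> g}"

definition cayley_graph :: "('a, 'b) monoid_scheme \<Rightarrow> 'a set \<Rightarrow> 'a graph" where
  "cayley_graph G S = (carrier G, cayley_edges G S)"

definition word_length :: "('a, 'b) monoid_scheme \<Rightarrow> 'a set \<Rightarrow> 'a \<Rightarrow> nat" where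
  "word_length G S g =
     (LEAST n. \<exists>ws. length ws = n \<and> set ws \<subseteq> S \<and> foldr (\<lambda>a b. a \<otimes>\<^bsub>G\<^esub> b) ws \<one>\<^bsub>G\<^esub> = g)"

text \<open>The value outside of the carrier is fixed because \<^locale>\<open>Metric_space\<close> requires symmetry
  and nonnegativity there too.\<close>

definition word_dist :: "('a, 'b) monoid_scheme \<Rightarrow> 'a set \<Rightarrow> 'a \<Rightarrow> 'a \<Rightarrow> real" where
  "word_dist G S g h =
     (if g \<in> carrier G \<and> h \<in> carrier G then real (word_length G S (inv\<^bsub>G\<^esub> g \<otimes>\<^bsub>G\<^esub> h)) else 0)"

definition cayley_space :: "('a, 'b) monoid_scheme \<Rightarrow> 'a set \<Rightarrow> 'a based_space" where
  "cayley_space G S = \<lparr>pts = carrier G, bpt = \<one>\<^bsub>G\<^esub>, dst = word_dist G S\<rparr>"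

section \<open>First passage percolation\<close>

definition fpp_measure ::
    "('a, 'b) monoid_scheme \<Rightarrow> 'a set \<Rightarrow> real measure \<Rightarrow> ('a set \<Rightarrow> real) measure" where
  "fpp_measure G S \<rho> = (\<Pi>\<^sub>M e\<in>cayley_edges G S. \<rho>)"

definition full_measure :: "'c measure \<Rightarrow> 'c set \<Rightarrow> bool" where
  "full_measure M A \<longleftrightarrow> A \<subseteq> space M \<and> (AE \<omega> in M. \<omega> \<in> A)"

definition path_weight :: "('a set \<Rightarrow> real) \<Rightarrow> 'a list \<Rightarrow> real" where
  "path_weight \<omega> p = (\<Sum>e\<leftarrow>path_edges p. \<omega> e)"

definition fpp_dist ::
    "('a, 'b) monoid_scheme \<Rightarrow> 'a set \<Rightarrow> ('a set \<Rightarrow> real) \<Rightarrow> 'a \<Rightarrow> 'a \<Rightarrow> real" where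
  "fpp_dist G S \<omega> x y = (INF p\<in>{p. walk_between (cayley_graph G S) x y p}. path_weight \<omega> p)"

definition fpp_geodesic ::
    "('a, 'b) monoid_scheme \<Rightarrow> 'a set \<Rightarrow> ('a set \<Rightarrow> real) \<Rightarrow> 'a \<Rightarrow> 'a \<Rightarrow> 'a list \<Rightarrow> bool" where
  "fpp_geodesic G S \<omega> x y p \<longleftrightarrow>
     walk_between (cayley_graph G S) x y p \<and> path_weight \<omega> p = fpp_dist G S \<omega> x y"

definition fpp_ray ::
    "('a, 'b) monoid_scheme \<Rightarrow> 'a set \<Rightarrow> ('a set \<Rightarrow> real) \<Rightarrow> (nat \<Rightarrow> 'a) \<Rightarrow> bool" where
  "fpp_ray G S \<omega> r \<longleftrightarrow>
     (\<forall>m n. m \<le> n \<longrightarrow> fpp_geodesic G S \<omega> (r m) (r n) (map r [m..<Suc n]))"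

definition fpp_line ::
    "('a, 'b) monoid_scheme \<Rightarrow> 'a set \<Rightarrow> ('a set \<Rightarrow> real) \<Rightarrow> (int \<Rightarrow> 'a) \<Rightarrow> bool" where
  "fpp_line G S \<omega> l \<longleftrightarrow>
     (\<forall>m n. m \<le> n \<longrightarrow> fpp_geodesic G S \<omega> (l m) (l n) (map l [m..n]))"

definition has_direction ::
    "('a, 'b) monoid_scheme \<Rightarrow> 'a set \<Rightarrow> (nat \<Rightarrow> 'a) \<Rightarrow> (nat \<Rightarrow> 'a) set \<Rightarrow> bool" where
  "has_direction G S r \<xi> \<longleftrightarrow>
     {\<eta> \<in> gromov_boundary (cayley_space G S).
        \<forall>U. openin (gromov_compactification (cayley_space G S)) U \<and> Inr \<eta> \<in> U \<longrightarrow>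
          infinite {n. Inl (r n) \<in> U}} = {\<xi>}"

text \<open>Where the geodesics from the identity are not unique (a null set of \<open>\<omega>\<close>), this is the union
  of all of them.\<close>

definition forward_tree ::
    "('a, 'b) monoid_scheme \<Rightarrow> 'a set \<Rightarrow> ('a set \<Rightarrow> real) \<Rightarrow> 'a graph" where
  "forward_tree G S \<omega> =
     (\<Union>{set p | g p. g \<in> carrier G \<and> fpp_geodesic G S \<omega> \<one>\<^bsub>G\<^esub> g p},
      \<Union>{set (path_edges p) | g p. g \<in> carrier G \<and> fpp_geodesic G S \<omega> \<one>\<^bsub>G\<^esub> g p})"

definition fpp_ray_from_to ::
    "('a, 'b) monoid_scheme \<Rightarrow> 'a set \<Rightarrow> ('a set \<Rightarrow> real) \<Rightarrow> 'a \<Rightarrow> (nat \<Rightarrow> 'a) set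
      \<Rightarrow> (nat \<Rightarrow> 'a) \<Rightarrow> bool" where
  "fpp_ray_from_to G S \<omega> g \<xi> r \<longleftrightarrow> fpp_ray G S \<omega> r \<and> r 0 = g \<and> has_direction G S r \<xi>"

definition backward_tree ::
    "('a, 'b) monoid_scheme \<Rightarrow> 'a set \<Rightarrow> (nat \<Rightarrow> 'a) set \<Rightarrow> ('a set \<Rightarrow> real) \<Rightarrow> 'a graph" where
  "backward_tree G S \<xi> \<omega> =
     (\<Union>{range r | g r. g \<in> carrier G \<and> fpp_ray_from_to G S \<omega> g \<xi> r},
      \<Union>{{{r n, r (Suc n)} | n. True} | g r. g \<in> carrier G \<and> fpp_ray_from_to G S \<omega> g \<xi> r})"

definition backward_admissible ::
    "('a, 'b) monoid_scheme \<Rightarrow> 'a set \<Rightarrow> real measure \<Rightarrow> (nat \<Rightarrow> 'a) set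
      \<Rightarrow> ('a set \<Rightarrow> real) set \<Rightarrow> bool" where
  "backward_admissible G S \<rho> \<xi> \<Omega>\<^sub>\<xi> \<longleftrightarrow>
     full_measure (fpp_measure G S \<rho>) \<Omega>\<^sub>\<xi> \<and>
     (\<forall>\<omega>\<in>\<Omega>\<^sub>\<xi>.
        (\<forall>g\<in>carrier G. \<exists>!r. fpp_ray_from_to G S \<omega> g \<xi> r) \<and>
        is_tree (backward_tree G S \<xi> \<omega>) \<and>
        (\<forall>\<xi>'\<in>gromov_boundary (cayley_space G S). \<xi>' \<noteq> \<xi> \<longrightarrow>
           (\<exists>l. fpp_line G S \<omega> l \<and>
                range l \<subseteq> fst (backward_tree G S \<xi> \<omega>) \<and>
                (\<forall>k. {l k, l (k + 1)} \<in> snd (backward_tree G S \<xi> \<omega>)) \<and>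
                has_direction G S (\<lambda>n. l (- int n)) \<xi>' \<and>
                has_direction G S (\<lambda>n. l (int n)) \<xi>)))"

definition forward_space ::
    "('a, 'b) monoid_scheme \<Rightarrow> 'a set \<Rightarrow> ('a set \<Rightarrow> real) \<Rightarrow> 'a based_space" where
  "forward_space G S \<omega> = simplicial_space (forward_tree G S \<omega>) \<one>\<^bsub>G\<^esub>"

definition backward_space ::
    "('a, 'b) monoid_scheme \<Rightarrow> 'a set \<Rightarrow> (nat \<Rightarrow> 'a) set \<Rightarrow> ('a set \<Rightarrow> real) \<Rightarrow> 'a based_space" where
  "backward_space G S \<xi> \<omega> = simplicial_space (backward_tree G S \<xi> \<omega>) \<one>\<^bsub>G\<^esub>"

end

theory Submission
  imports Defs
begin

text \<open>Almost surely the distance from \<open>\<one>\<close> grows at most linearly, and every self-avoiding path that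
  starts no further from \<open>\<one>\<close> than it is long has weight at least linear in its length; both follow
  from exponential moments and a union bound. Hence the word distance to \<open>\<one>\<close> along an
  \<open>\<omega>\<close>-geodesic grows linearly in both directions away from its vertex nearest to \<open>\<one>\<close>, because
  otherwise the detour through \<open>\<one>\<close> would be lighter. Since \<open>exp (- \<eta> (x|y))\<close> is, up to a factor of 2,
  a metric (Frink), summing a geometric series along the geodesic shows that the Gromov product of
  its ends tends to infinity with the distance of the geodesic to \<open>\<one>\<close>.

  A geodesic of either tree is made of at most two \<open>\<omega>\<close>-geodesics meeting in a common vertex. So Gromov
  products in the tree that tend to infinity force the same in the Cayley graph: this gives 2-properness
  and the continuous extension. The extension is onto since every boundary point is the end of a ray in
  the tree, given by hypothesis for the backward tree and by Koenig's lemma for the forward tree.\<close>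

text \<open>What survives is control as seen from the single point \<open>\<one>\<close>, with
  constants that depend on \<omega>. Gromov products based at \<open>\<one>\<close> ask for no more:
  the chain inequality estimates them along the \<omega>-geodesic itself, without comparing it to a
  word geodesic.

  There may be uncountably many boundary points \<xi>, so the full measure set must not mention
  \<xi>. It is therefore cut out by conditions on finite paths, of which there are countably many:
  positive weights, the two growth bounds, and different weights for different self-avoiding paths
  with the same ends. From there on the argument is deterministic, and what is specific to \<xi>
  enters only through the rays and lines that come with the backward tree.\<close>

section \<open>Gromov products and Cannon-Thurston maps\<close>

text \<open>Cut the chain at the last index whose left part carries at most half of the total
  \<open>T\<close>. By induction both parts have ends at \<open>q\<close>-distance at most
  \<open>T\<close>, and so has the single link between them; joining these three pieces uses the
  quasi-ultrametric inequality twice, at the cost of the factor \<open>K * K\<close>.\<close>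

lemma frink_chain:
  fixes q :: "'a \<Rightarrow> 'a \<Rightarrow> real"
  assumes nonneg: "\<And>x y. x \<in> P \<Longrightarrow> y \<in> P \<Longrightarrow> 0 \<le> q x y"
    and quasi: "\<And>x y z. x \<in> P \<Longrightarrow> y \<in> P \<Longrightarrow> z \<in> P \<Longrightarrow> q x z \<le> K * max (q x y) (q y z)"
    and K: "1 \<le> K" "K * K \<le> 2"
    and "m < n" "p ` {m..n} \<subseteq> P"
  shows "q (p m) (p n) \<le> 2 * (\<Sum>i=m..<n. q (p i) (p (Suc i)))"
  using assms(5,6)
proof (induction "n - m" arbitrary: m n rule: less_induct)
  case less
  define s where "s = (\<lambda>i. q (p i) (p (Suc i)))"
  define T where "T = sum s {m..<n}"
  have inP: "p i \<in> P" if "m \<le> i" "i \<le> n" for i using less.prems that by auto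
  have s0: "0 \<le> s i" if "m \<le> i" "i < n" for i
    unfolding s_def using that by (intro nonneg inP) auto
  have T0: "0 \<le> T" unfolding T_def by (intro sum_nonneg) (auto intro: s0)
  define J where "J = {j. m \<le> j \<and> j < n \<and> sum s {m..<j} \<le> T / 2}"
  have "finite J" unfolding J_def by auto
  moreover have "m \<in> J" unfolding J_def using less.prems T0 by auto
  ultimately have jJ: "Max J \<in> J" and jmax: "\<And>i. i \<in> J \<Longrightarrow> i \<le> Max J"
    using Max_in by auto
  define j where "j = Max J"
  have j: "m \<le> j" "j < n" "sum s {m..<j} \<le> T / 2" using jJ unfolding j_def J_def by auto
  have split: "T = sum s {m..<j} + s j + sum s {Suc j..<n}"
    unfolding T_def using j sum.atLeastLessThan_concat[of m j n s] sum.atLeast_Suc_lessThan[of j n s]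
    by simp
  \<comment> \<open>Maximality of \<open>j\<close> puts more than half of \<open>T\<close> on the
    chain up to \<open>Suc j\<close>, so at most half remains.\<close>
  have right: "sum s {Suc j..<n} \<le> T / 2"
  proof (cases "Suc j < n")
    case True
    have "Suc j \<notin> J" using jmax[of "Suc j"] unfolding j_def by auto
    then have "T / 2 < sum s {m..<Suc j}" using True j unfolding J_def by auto
    then show ?thesis using split j by (simp add: sum.atLeastLessThan_Suc)
  qed (use T0 in auto)
  have sj: "s j \<le> T"
  proof -
    have "0 \<le> sum s {m..<j}" "0 \<le> sum s {Suc j..<n}"
      using j by (auto intro!: sum_nonneg s0)
    then show ?thesis using split by linarith
  qed
  have KT: "T \<le> K * T" using K T0 by (simp add: mult_le_cancel_right1)
  have left: "q (p m) (p (Suc j)) \<le> K * T"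
  proof (cases "m = j")
    case True
    then show ?thesis using sj KT by (simp add: s_def)
  next
    case False
    then have "q (p m) (p j) \<le> 2 * sum s {m..<j}"
      unfolding s_def using less.prems j by (intro less.hyps) auto
    then have "max (q (p m) (p j)) (q (p j) (p (Suc j))) \<le> T"
      using j sj by (simp add: s_def)
    then have "K * max (q (p m) (p j)) (q (p j) (p (Suc j))) \<le> K * T"
      using K by (intro mult_left_mono) auto
    moreover have "q (p m) (p (Suc j)) \<le> K * max (q (p m) (p j)) (q (p j) (p (Suc j)))"
      using j by (intro quasi inP) auto
    ultimately show ?thesis by linarith
  qed
  have "K \<le> K * K" using K by simp
  then have K2: "K \<le> 2" using K by linarith
  have "q (p m) (p n) \<le> 2 * T"
  proof (cases "Suc j = n")
    case True
    have "K * T \<le> 2 * T" using K2 T0 by (intro mult_right_mono) auto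
    then show ?thesis using left True by simp
  next
    case False
    have "q (p (Suc j)) (p n) \<le> 2 * sum s {Suc j..<n}"
      unfolding s_def using less.prems j False by (intro less.hyps) auto
    then have "max (q (p m) (p (Suc j))) (q (p (Suc j)) (p n)) \<le> K * T"
      using right left KT by simp
    then have "K * max (q (p m) (p (Suc j))) (q (p (Suc j)) (p n)) \<le> K * (K * T)"
      using K by (intro mult_left_mono) auto
    moreover have "q (p m) (p n) \<le> K * max (q (p m) (p (Suc j))) (q (p (Suc j)) (p n))"
      using j False by (intro quasi inP) auto
    moreover have "K * (K * T) \<le> 2 * T"
      using K T0 by (simp add: mult.assoc[symmetric] mult_right_mono)
    ultimately show ?thesis by linarith
  qed
  then show ?case by (simp add: T_def s_def)
qed

abbreviation gprod :: "'a based_space \<Rightarrow> 'a \<Rightarrow> 'a \<Rightarrow> real" where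
  "gprod X \<equiv> gromov_product (dst X) (bpt X)"

lemma hyperbolic_space_imp_Metric_space:
  "hyperbolic_space X \<Longrightarrow> Metric_space (pts X) (dst X)"
  by (simp add: hyperbolic_space_def)

lemma hyperbolic_space_imp_bpt: "hyperbolic_space X \<Longrightarrow> bpt X \<in> pts X"
  by (simp add: hyperbolic_space_def)

text \<open>The constant is enlarged to a positive one because \<open>hyperbolic_space_chain\<close>
  divides by it.\<close>

lemma hyperbolic_space_gprod:
  assumes "hyperbolic_space X"
  obtains \<delta> where "0 < \<delta>" "\<And>x y z. x \<in> pts X \<Longrightarrow> y \<in> pts X \<Longrightarrow> z \<in> pts X \<Longrightarrow>
    min (gprod X x y) (gprod X y z) - \<delta> \<le> gprod X x z"
proof -
  obtain d where d: "\<forall>w\<in>pts X. \<forall>x\<in>pts X. \<forall>y\<in>pts X. \<forall>z\<in>pts X.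
        gromov_product (dst X) w x z
          \<ge> min (gromov_product (dst X) w x y) (gromov_product (dst X) w y z) - d"
    and b: "bpt X \<in> pts X"
    using assms unfolding hyperbolic_space_def by blast
  show thesis
  proof (rule that[of "max d 1"])
    fix x y z assume "x \<in> pts X" "y \<in> pts X" "z \<in> pts X"
    then have "min (gprod X x y) (gprod X y z) - d \<le> gprod X x z"
      using d b by blast
    then show "min (gprod X x y) (gprod X y z) - max d 1 \<le> gprod X x z" by linarith
  qed simp
qed

text \<open>\<open>exp (- \<eta> * gprod X x y)\<close> turns the four-point inequality into a
  quasi-ultrametric one with constant \<open>exp (\<eta> * \<delta>)\<close>. It does not vanish on
  the diagonal, which \<open>frink_chain\<close> tolerates.\<close>

lemma hyperbolic_space_chain:
  assumes "hyperbolic_space X"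
  obtains \<eta> where "0 < \<eta>" "\<And>p m n. m < n \<Longrightarrow> p ` {m..n} \<subseteq> pts X \<Longrightarrow>
    exp (- \<eta> * gprod X (p m) (p n)) \<le> 2 * (\<Sum>i=m..<n. exp (- \<eta> * gprod X (p i) (p (Suc i))))"
proof -
  obtain \<delta> where \<delta>: "0 < \<delta>" "\<And>x y z. x \<in> pts X \<Longrightarrow> y \<in> pts X \<Longrightarrow> z \<in> pts X \<Longrightarrow>
    min (gprod X x y) (gprod X y z) - \<delta> \<le> gprod X x z"
    using hyperbolic_space_gprod[OF assms] by blast
  \<comment> \<open>The largest exponent for which the square of
    \<open>exp (\<eta> * \<delta>)\<close> is at most 2.\<close>
  define \<eta> where "\<eta> = ln 2 / (2 * \<delta>)"
  have \<eta>: "0 < \<eta>" using \<delta> by (simp add: \<eta>_def)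
  have "\<eta> * \<delta> + \<eta> * \<delta> = ln 2" using \<delta> by (simp add: \<eta>_def field_simps)
  then have K2: "exp (\<eta> * \<delta>) * exp (\<eta> * \<delta>) \<le> 2" by (simp flip: exp_add)
  show thesis
  proof (rule that[OF \<eta>])
    fix p :: "nat \<Rightarrow> 'a" and m n assume mn: "m < n" "p ` {m..n} \<subseteq> pts X"
    show "exp (- \<eta> * gprod X (p m) (p n)) \<le> 2 * (\<Sum>i=m..<n. exp (- \<eta> * gprod X (p i) (p (Suc i))))"
    proof (rule frink_chain[where P = "pts X" and K = "exp (\<eta> * \<delta>)" and p = p and
          q = "\<lambda>x y. exp (- \<eta> * gprod X x y)", OF _ _ _ K2 mn])
      fix x y z assume xyz: "x \<in> pts X" "y \<in> pts X" "z \<in> pts X"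
      have "max (exp (- \<eta> * gprod X x y)) (exp (- \<eta> * gprod X y z))
          = exp (- \<eta> * min (gprod X x y) (gprod X y z))"
        using \<eta> by (simp add: max_def min_def)
      moreover have "- \<eta> * gprod X x z \<le> \<eta> * \<delta> + - \<eta> * min (gprod X x y) (gprod X y z)"
        using mult_left_mono[OF \<delta>(2)[OF xyz], of \<eta>] \<eta> by (simp add: algebra_simps)
      ultimately show "exp (- \<eta> * gprod X x z)
          \<le> exp (\<eta> * \<delta>) * max (exp (- \<eta> * gprod X x y)) (exp (- \<eta> * gprod X y z))"
        by (simp flip: exp_add)
    qed (use \<eta> \<delta> in auto)
  qed
qed

section \<open>Gromov sequences and the boundary points they represent\<close>

lemma filterlim_at_top_prod_sequentially:
  fixes F :: "nat \<Rightarrow> nat \<Rightarrow> real"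
  shows "filterlim (\<lambda>(i, j). F i j) at_top (sequentially \<times>\<^sub>F sequentially) \<longleftrightarrow>
    (\<forall>R. \<exists>N. \<forall>i\<ge>N. \<forall>j\<ge>N. R \<le> F i j)"
  unfolding filterlim_at_top eventually_prod_sequentially by (simp, meson)

lemma gromov_product_commute:
  assumes "Metric_space M d"
  shows "gromov_product d w x y = gromov_product d w y x"
  using Metric_space.commute[OF assms, of x y] by (simp add: gromov_product_def)

lemma gromov_product_le:
  assumes "Metric_space M d" "w \<in> M" "x \<in> M" "y \<in> M"
  shows "gromov_product d w x y \<le> d w x"
  using Metric_space.triangle[OF assms(1), of w x y] assms by (simp add: gromov_product_def)

lemma gromov_seqs_iff:
  "s \<in> gromov_seqs X \<longleftrightarrow> range s \<subseteq> pts X \<and> (\<forall>R. \<exists>N. \<forall>i\<ge>N. \<forall>j\<ge>N. R \<le> gprod X (s i) (s j))"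
  by (simp add: gromov_seqs_def filterlim_at_top_prod_sequentially)

lemma gromov_equiv_iff:
  "(s, t) \<in> gromov_equiv X \<longleftrightarrow> s \<in> gromov_seqs X \<and> t \<in> gromov_seqs X \<and>
    (\<forall>R. \<exists>N. \<forall>i\<ge>N. \<forall>j\<ge>N. R \<le> gprod X (s i) (t j))"
  by (simp add: gromov_equiv_def filterlim_at_top_prod_sequentially)

lemma equiv_gromov_equiv:
  assumes "hyperbolic_space X"
  shows "equiv (gromov_seqs X) (gromov_equiv X)"
proof -
  obtain \<delta> where \<delta>: "0 < \<delta>" "\<And>x y z. x \<in> pts X \<Longrightarrow> y \<in> pts X \<Longrightarrow> z \<in> pts X \<Longrightarrow>
    min (gprod X x y) (gprod X y z) - \<delta> \<le> gprod X x z"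
    using hyperbolic_space_gprod[OF assms] by blast
  note com = gromov_product_commute[OF hyperbolic_space_imp_Metric_space[OF assms]]
  have "refl_on (gromov_seqs X) (gromov_equiv X)"
    by (auto simp: refl_on_def gromov_equiv_iff gromov_seqs_iff)
  moreover have "gromov_equiv X \<subseteq> gromov_seqs X \<times> gromov_seqs X"
    by (auto simp: gromov_equiv_def)
  moreover have "sym (gromov_equiv X)"
    unfolding sym_def gromov_equiv_iff using com by metis
  moreover have "trans (gromov_equiv X)"
  proof (rule transI)
    fix s t u assume st: "(s, t) \<in> gromov_equiv X" and tu: "(t, u) \<in> gromov_equiv X"
    have "\<exists>N. \<forall>i\<ge>N. \<forall>j\<ge>N. R \<le> gprod X (s i) (u j)" for R
    proof -
      obtain N1 N2 where N1: "\<forall>i\<ge>N1. \<forall>j\<ge>N1. R + \<delta> \<le> gprod X (s i) (t j)"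
        and N2: "\<forall>i\<ge>N2. \<forall>j\<ge>N2. R + \<delta> \<le> gprod X (t i) (u j)"
        using st tu unfolding gromov_equiv_iff by meson
      have "R \<le> gprod X (s i) (u j)" if "i \<ge> max N1 N2" "j \<ge> max N1 N2" for i j
      proof -
        have "R + \<delta> \<le> gprod X (s i) (t (max N1 N2))" "R + \<delta> \<le> gprod X (t (max N1 N2)) (u j)"
          using N1 N2 that by auto
        moreover have "s i \<in> pts X" "t (max N1 N2) \<in> pts X" "u j \<in> pts X"
          using st tu unfolding gromov_equiv_iff gromov_seqs_iff by auto
        ultimately show ?thesis using \<delta>(2)[of "s i" "t (max N1 N2)" "u j"] by linarith
      qed
      then show ?thesis by blast
    qed
    then show "(s, u) \<in> gromov_equiv X" using st tu by (simp add: gromov_equiv_iff)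
  qed
  ultimately show ?thesis by (simp add: equiv_def)
qed

abbreviation endpoint :: "'a based_space \<Rightarrow> (nat \<Rightarrow> 'a) \<Rightarrow> (nat \<Rightarrow> 'a) set" where
  "endpoint X s \<equiv> gromov_equiv X `` {s}"

lemma endpoint_in_boundary: "s \<in> gromov_seqs X \<Longrightarrow> endpoint X s \<in> gromov_boundary X"
  by (auto simp: gromov_boundary_def quotient_def)

lemma self_in_endpoint:
  assumes "hyperbolic_space X" "s \<in> gromov_seqs X" shows "s \<in> endpoint X s"
  using equiv_class_self[OF equiv_gromov_equiv[OF assms(1)] assms(2)] .

lemma boundary_cases:
  assumes "hyperbolic_space X" "\<xi> \<in> gromov_boundary X"
  obtains s where "s \<in> gromov_seqs X" "\<xi> = endpoint X s" "s \<in> \<xi>"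
  using assms self_in_endpoint unfolding gromov_boundary_def quotient_def by auto

lemma in_boundary_imp:
  assumes "hyperbolic_space X" "\<xi> \<in> gromov_boundary X" "s \<in> \<xi>"
  shows "s \<in> gromov_seqs X" "\<xi> = endpoint X s"
proof -
  obtain t where t: "t \<in> gromov_seqs X" "\<xi> = endpoint X t" using boundary_cases assms by blast
  then have ts: "(t, s) \<in> gromov_equiv X" using assms by simp
  then show "s \<in> gromov_seqs X" by (simp add: gromov_equiv_iff)
  show "\<xi> = endpoint X s" using t ts equiv_class_eq[OF equiv_gromov_equiv[OF assms(1)]] by simp
qed

lemma endpoint_eqI:
  assumes "hyperbolic_space X" "(s, t) \<in> gromov_equiv X" shows "endpoint X s = endpoint X t"
  using equiv_class_eq[OF equiv_gromov_equiv[OF assms(1)] assms(2)] .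

text \<open>This rule and the next trade the supremum of lower limits for Gromov products of actual
  points, uniformly beyond one index.\<close>

lemma less_ext_gromov_productE:
  assumes "ereal R < ext_gromov_product X u v"
  obtains s t N where "s \<in> representing_seqs u" "t \<in> representing_seqs v"
    "\<And>i j. i \<ge> N \<Longrightarrow> j \<ge> N \<Longrightarrow> R \<le> gprod X (s i) (t j)"
proof -
  obtain s t where st: "s \<in> representing_seqs u" "t \<in> representing_seqs v"
    and L: "ereal R < Liminf (sequentially \<times>\<^sub>F sequentially) (\<lambda>(i, j). ereal (gprod X (s i) (t j)))"
    using assms unfolding ext_gromov_product_def less_SUP_iff by blast
  have "eventually (\<lambda>(i, j). ereal R < ereal (gprod X (s i) (t j))) (sequentially \<times>\<^sub>F sequentially)"
    using less_LiminfD[OF L] by (simp add: case_prod_unfold)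
  then obtain N where "\<forall>m\<ge>N. \<forall>n\<ge>N. R < gprod X (s n) (t m)"
    unfolding eventually_prod_sequentially by auto
  then show thesis using that[OF st, of N] by (meson less_imp_le)
qed

text \<open>The spare 1 restores strictness, since a lower limit inherits only the weak
  bound.\<close>

lemma less_ext_gromov_productI:
  assumes "s \<in> representing_seqs u" "t \<in> representing_seqs v"
    and "\<And>i j. i \<ge> N \<Longrightarrow> j \<ge> N \<Longrightarrow> R + 1 \<le> gprod X (s i) (t j)"
  shows "ereal R < ext_gromov_product X u v"
proof -
  have "ereal (R + 1) \<le> Liminf (sequentially \<times>\<^sub>F sequentially) (\<lambda>(i, j). ereal (gprod X (s i) (t j)))"
    by (rule Liminf_bounded) (use assms in \<open>auto simp: eventually_prod_sequentially\<close>)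
  also have "\<dots> \<le> ext_gromov_product X u v"
    unfolding ext_gromov_product_def using assms by (meson SUP_upper2 order_refl)
  finally show ?thesis by (metis ereal_less(2) less_add_one less_ereal.simps(1) less_le_trans)
qed

section \<open>Topology of the compactification\<close>

lemma gromov_open_compactified:
  assumes "hyperbolic_space X" shows "gromov_open X (compactified_pts X)"
proof -
  interpret Metric_space "pts X" "dst X" by (rule hyperbolic_space_imp_Metric_space[OF assms])
  have "Inl -` compactified_pts X = pts X" by (auto simp: compactified_pts_def)
  then show ?thesis using openin_topspace[of mtopology] by (auto simp: gromov_open_def)
qed

lemma topspace_gromov_compactification:
  assumes "hyperbolic_space X" shows "topspace (gromov_compactification X) = compactified_pts X"
  unfolding topspace_def openin_gromov_compactification
  using gromov_open_compactified[OF assms] by (auto simp: gromov_open_def)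

text \<open>Convergence of a Gromov sequence to its class: the constant sequence at
  \<open>s n\<close> represents \<open>Inl (s n)\<close>, and its products with the late terms of
  \<open>s\<close> are large once \<open>n\<close> is.\<close>

lemma eventually_in_gromov_open:
  assumes "hyperbolic_space X" "s \<in> gromov_seqs X" "gromov_open X U" "Inr (endpoint X s) \<in> U"
  shows "\<exists>N. \<forall>n\<ge>N. Inl (s n) \<in> U"
proof -
  obtain R where R: "{z \<in> compactified_pts X. ereal R < ext_gromov_product X z (Inr (endpoint X s))} \<subseteq> U"
    using assms unfolding gromov_open_def by blast
  obtain N where N: "\<forall>i\<ge>N. \<forall>j\<ge>N. R + 1 \<le> gprod X (s i) (s j)"
    using assms unfolding gromov_seqs_iff by blast
  have "Inl (s n) \<in> U" if "n \<ge> N" for n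
  proof -
    have "ereal R < ext_gromov_product X (Inl (s n)) (Inr (endpoint X s))"
      by (rule less_ext_gromov_productI[of "\<lambda>_. s n" _ s _ N])
        (use N that self_in_endpoint[OF assms(1,2)] in auto)
    moreover have "Inl (s n) \<in> compactified_pts X"
      using assms unfolding gromov_seqs_iff compactified_pts_def by auto
    ultimately show ?thesis using R by blast
  qed
  then show ?thesis by blast
qed

text \<open>This separation property replaces uniqueness of limits below. If a boundary point \<xi>
  other than the limit had no neighbourhood avoiding the set, points of the set with ever larger
  products with \<xi> would connect \<open>s\<close>, by hyperbolicity, to a sequence representing
  \<xi>, and the two would be equivalent.\<close>

lemma gromov_open_complement_seq:
  assumes hyp: "hyperbolic_space X" and disc: "mtop X = discrete_topology (pts X)"
    and s: "s \<in> gromov_seqs X"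
  shows "gromov_open X (compactified_pts X - insert (Inr (endpoint X s)) (range (\<lambda>n. Inl (s n))))"
    (is "gromov_open X (_ - ?K)")
proof -
  obtain \<delta> where \<delta>: "0 < \<delta>" "\<And>x y z. x \<in> pts X \<Longrightarrow> y \<in> pts X \<Longrightarrow> z \<in> pts X \<Longrightarrow>
    min (gprod X x y) (gprod X y z) - \<delta> \<le> gprod X x z"
    using hyperbolic_space_gprod[OF hyp] by blast
  note M = hyperbolic_space_imp_Metric_space[OF hyp]
  have sp: "s i \<in> pts X" for i using s by (auto simp: gromov_seqs_iff)
  have "\<exists>R::real. {z \<in> compactified_pts X. ereal R < ext_gromov_product X z (Inr \<xi>)} \<subseteq> compactified_pts X - ?K"
    if "Inr \<xi> \<in> compactified_pts X - ?K" for \<xi>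
  proof (rule ccontr)
    assume contra: "\<not> ?thesis"
    from that have \<xi>: "\<xi> \<in> gromov_boundary X" "\<xi> \<noteq> endpoint X s" by (auto simp: compactified_pts_def)
    obtain t where t: "t \<in> gromov_seqs X" "\<xi> = endpoint X t" using boundary_cases[OF hyp \<xi>(1)] by blast
    have tp: "t i \<in> pts X" for i using t by (auto simp: gromov_seqs_iff)
    have "\<exists>N. \<forall>i\<ge>N. \<forall>j\<ge>N. R \<le> gprod X (s i) (t j)" for R
    proof -
      \<comment> \<open>The four-point inequality is applied twice along \<open>s\<close>,
        \<open>s'\<close>, \<open>t'\<close>, \<open>t\<close>, and each application costs
        \<delta>.\<close>
      define R' where "R' = R + 2 * \<delta>"
      obtain N where N: "\<forall>i\<ge>N. \<forall>j\<ge>N. R' \<le> gprod X (s i) (s j)"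
        using s unfolding gromov_seqs_iff by blast
      \<comment> \<open>\<open>B\<close> dominates the distances of the first \<open>N\<close>
        terms, so a term whose product with \<xi> exceeds \<open>B\<close> has index at least
        \<open>N\<close>.\<close>
      define B where "B = Max (insert R' ((\<lambda>n. dst X (bpt X) (s n)) ` {..<N}))"
      have B: "R' \<le> B" "\<And>n. n < N \<Longrightarrow> dst X (bpt X) (s n) \<le> B" unfolding B_def by auto
      from contra obtain z where z: "ereal (B + 1) < ext_gromov_product X z (Inr \<xi>)" "z \<in> ?K"
        by blast
      from z(1) obtain s' t' N' where st': "s' \<in> representing_seqs z" "t' \<in> \<xi>"
        "\<And>i j. i \<ge> N' \<Longrightarrow> j \<ge> N' \<Longrightarrow> B + 1 \<le> gprod X (s' i) (t' j)"
        by (elim less_ext_gromov_productE) auto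
      have tt': "(t', t) \<in> gromov_equiv X"
        using st'(2) t(2) equiv_gromov_equiv[OF hyp] by (metis Image_singleton_iff equivE symD)
      then have t'p: "t' i \<in> pts X" for i by (auto simp: gromov_equiv_iff gromov_seqs_iff)
      obtain N1 where N1: "\<forall>i\<ge>N1. \<forall>j\<ge>N1. R' \<le> gprod X (t' i) (t j)"
        using tt' unfolding gromov_equiv_iff by blast
      have "\<exists>N2. \<forall>i\<ge>N2. \<forall>j\<ge>N2. R' \<le> gprod X (s i) (s' j)" and s'p: "\<And>i. s' i \<in> pts X"
      proof -
        consider "z = Inr (endpoint X s)" | n where "z = Inl (s n)" using z(2) by blast
        then have "(\<exists>N2. \<forall>i\<ge>N2. \<forall>j\<ge>N2. R' \<le> gprod X (s i) (s' j)) \<and> (\<forall>i. s' i \<in> pts X)"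
        proof cases
          case 1
          then have "(s, s') \<in> gromov_equiv X" using st'(1) by simp
          then show ?thesis by (auto simp: gromov_equiv_iff gromov_seqs_iff)
        next
          case 2
          then have s': "s' = (\<lambda>_. s n)" using st' by simp
          have "B + 1 \<le> gprod X (s n) (t' N')" using st'(3)[of N' N'] s' by simp
          then have "B + 1 \<le> dst X (bpt X) (s n)"
            using gromov_product_le[OF M hyperbolic_space_imp_bpt[OF hyp] sp t'p] by (meson order_trans)
          then have "N \<le> n" using B(2)[of n] by (meson less_add_one not_le order.strict_trans2 order_less_irrefl)
          then show ?thesis using N s' sp by auto
        qed
        then show "\<exists>N2. \<forall>i\<ge>N2. \<forall>j\<ge>N2. R' \<le> gprod X (s i) (s' j)" "\<And>i. s' i \<in> pts X" by auto
      qed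
      then obtain N2 where N2: "\<forall>i\<ge>N2. \<forall>j\<ge>N2. R' \<le> gprod X (s i) (s' j)" by blast
      have "R \<le> gprod X (s i) (t j)" if "i \<ge> Max {N', N1, N2}" "j \<ge> Max {N', N1, N2}" for i j
      proof -
        define k where "k = Max {N', N1, N2}"
        have "R' \<le> gprod X (s i) (s' k)" "R' \<le> gprod X (s' k) (t' k)" "R' \<le> gprod X (t' k) (t j)"
          using N2 N1 st'(3)[of k k] B(1) that unfolding k_def by auto
        then show ?thesis
          using \<delta>(2)[OF sp s'p t'p, of i k k] \<delta>(2)[OF sp t'p tp, of i k j] \<delta>(1)
          unfolding R'_def by linarith
      qed
      then show ?thesis by blast
    qed
    then have "(s, t) \<in> gromov_equiv X" using s t by (simp add: gromov_equiv_iff)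
    then show False using endpoint_eqI[OF hyp] t \<xi> by blast
  qed
  moreover have "openin (mtop X) (Inl -` (compactified_pts X - ?K))"
    by (auto simp: disc compactified_pts_def)
  ultimately show ?thesis by (auto simp: gromov_open_def)
qed

text \<open>Two kinds of wrong values are excluded. Another boundary point has a neighbourhood free
  of \<open>s\<close>, by \<open>gromov_open_complement_seq\<close>; a point of the space is
  isolated, so \<open>s\<close> would be eventually constant and its Gromov products bounded. Thus
  continuity alone determines a Cannon-Thurston map at such classes.\<close>

lemma cannon_thurston_map_endpoint:
  assumes f: "cannon_thurston_map Y X (\<lambda>x. x) f" and disc: "mtop X = discrete_topology (pts X)"
    and sY: "s \<in> gromov_seqs Y" and sX: "s \<in> gromov_seqs X"
  shows "f (Inr (endpoint Y s)) = Inr (endpoint X s)"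
proof (rule ccontr)
  assume neq: "f (Inr (endpoint Y s)) \<noteq> Inr (endpoint X s)" 
  have hypY: "hyperbolic_space Y" and hypX: "hyperbolic_space X"
    and cont: "continuous_map (gromov_compactification Y) (gromov_compactification X) f"
    and fI: "\<And>y. y \<in> pts Y \<Longrightarrow> f (Inl y) = Inl y"
    using f by (auto simp: cannon_thurston_map_def)
  note topX = topspace_gromov_compactification[OF hypX]
    and topY = topspace_gromov_compactification[OF hypY]
  have in_Y: "Inr (endpoint Y s) \<in> compactified_pts Y"
    using endpoint_in_boundary[OF sY] by (simp add: compactified_pts_def)
  then have in_X: "f (Inr (endpoint Y s)) \<in> compactified_pts X"
    using cont topX topY unfolding continuous_map_def by auto
  define U where "U = compactified_pts X - insert (Inr (endpoint X s)) (range (\<lambda>n. Inl (s n)))"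
  have escape: "\<exists>N. \<forall>n\<ge>N. Inl (s n) \<in> V" if V: "gromov_open X V" "f (Inr (endpoint Y s)) \<in> V" for V
  proof -
    have "gromov_open Y {z \<in> compactified_pts Y. f z \<in> V}"
      using cont V topY unfolding continuous_map_def openin_gromov_compactification by auto
    then obtain N where "\<forall>n\<ge>N. Inl (s n) \<in> {z \<in> compactified_pts Y. f z \<in> V}"
      using eventually_in_gromov_open[OF hypY sY] in_Y V by blast
    moreover have "s n \<in> pts Y" for n using sY by (auto simp: gromov_seqs_iff)
    ultimately show ?thesis using fI by auto
  qed
  show False
  proof (cases "f (Inr (endpoint Y s))")
    case (Inr \<zeta>)
    then have "f (Inr (endpoint Y s)) \<in> U" using in_X neq by (auto simp: U_def)
    then show False
      using escape[of U] gromov_open_complement_seq[OF hypX disc sX] by (auto simp: U_def)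
  next
    case (Inl x)
    have x: "x \<in> pts X" using in_X Inl by (auto simp: compactified_pts_def)
    have "Inl -` {Inl x} = {x}" by auto
    then have "gromov_open X {Inl x}"
      using x by (auto simp: gromov_open_def disc compactified_pts_def)
    then obtain N where N: "\<forall>n\<ge>N. s n = x" using escape[of "{Inl x}"] Inl by auto
    obtain N' where N': "\<forall>i\<ge>N'. \<forall>j\<ge>N'. dst X (bpt X) x + 1 \<le> gprod X (s i) (s j)"
      using sX unfolding gromov_seqs_iff by blast
    have "dst X (bpt X) x + 1 \<le> gprod X x x"
      using N'[rule_format, of "max N N'" "max N N'"] N by simp
    then show False
      using gromov_product_le[OF hyperbolic_space_imp_Metric_space[OF hypX] hyperbolic_space_imp_bpt[OF hypX] x x]
      by linarith
  qed
qed

text \<open>For discrete spaces, continuity of the extension only has to be checked at the boundary.\<close>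

lemma admits_cannon_thurstonI:
  assumes hypY: "hyperbolic_space Y" and hypX: "hyperbolic_space X"
    and pr: "proper_embedding Y X (\<lambda>x. x)" and sub: "pts Y \<subseteq> pts X"
    and disc: "mtop Y = discrete_topology (pts Y)"
    and gp: "\<And>R. \<exists>R'. \<forall>x\<in>pts Y. \<forall>y\<in>pts Y. R' \<le> gprod Y x y \<longrightarrow> R \<le> gprod X x y"
  shows "admits_cannon_thurston Y X (\<lambda>x. x)"
    and "gromov_seqs Y \<subseteq> gromov_seqs X"
proof -
  have transfer: "\<exists>N. \<forall>i\<ge>N. \<forall>j\<ge>N. R \<le> gprod X (s i) (t j)"
    if st: "range s \<subseteq> pts Y" "range t \<subseteq> pts Y" "\<forall>R. \<exists>N. \<forall>i\<ge>N. \<forall>j\<ge>N. R \<le> gprod Y (s i) (t j)" for R and s t :: "nat \<Rightarrow> 'a"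
  proof -
    obtain R' where R': "\<forall>x\<in>pts Y. \<forall>y\<in>pts Y. R' \<le> gprod Y x y \<longrightarrow> R \<le> gprod X x y" using gp by blast
    obtain N where "\<forall>i\<ge>N. \<forall>j\<ge>N. R' \<le> gprod Y (s i) (t j)" using st by blast
    then have "\<forall>i\<ge>N. \<forall>j\<ge>N. R \<le> gprod X (s i) (t j)" using R' st(1,2) by (simp add: image_subset_iff)
    then show ?thesis by blast
  qed
  show seqs: "gromov_seqs Y \<subseteq> gromov_seqs X"
    using transfer sub unfolding gromov_seqs_iff subset_iff by (metis rangeI)
  have equiv: "(s, t) \<in> gromov_equiv X" if "(s, t) \<in> gromov_equiv Y" for s t
    using that transfer seqs unfolding gromov_equiv_iff by (metis gromov_seqs_iff subsetD)
  \<comment> \<open>The choice of a representative does not matter, because equivalent sequences of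
    \<open>Y\<close> stay equivalent in \<open>X\<close>.\<close>
  define g where "g = (\<lambda>\<eta>. endpoint X (SOME s. s \<in> \<eta>))"
  define f where "f = (\<lambda>z :: 'a gpoint. (case z of Inl y \<Rightarrow> Inl y | Inr \<eta> \<Rightarrow> Inr (g \<eta>)) :: 'a gpoint)"
  have g: "s \<in> gromov_seqs X" "g \<eta> = endpoint X s" if "\<eta> \<in> gromov_boundary Y" "s \<in> \<eta>" for s \<eta>
  proof -
    have s': "(SOME s. s \<in> \<eta>) \<in> \<eta>" using that by (metis someI)
    note 1 = in_boundary_imp[OF hypY that] and 2 = in_boundary_imp[OF hypY that(1) s']
    show "s \<in> gromov_seqs X" using 1 seqs by auto
    have "((SOME s. s \<in> \<eta>), s) \<in> gromov_equiv Y" using 2 that by blast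
    then show "g \<eta> = endpoint X s" unfolding g_def using endpoint_eqI[OF hypX] equiv by blast
  qed
  have gb: "g \<eta> \<in> gromov_boundary X" if "\<eta> \<in> gromov_boundary Y" for \<eta>
    using boundary_cases[OF hypY that] g[OF that] endpoint_in_boundary by metis
  have fpts: "f z \<in> compactified_pts X" if "z \<in> compactified_pts Y" for z
    using that sub gb by (auto simp: compactified_pts_def f_def)
  \<comment> \<open>\<open>f\<close> carries a sequence representing a point to one representing its
    image, so neighbourhoods can be compared product by product.\<close>
  have rep: "s \<in> representing_seqs (f z) \<and> range s \<subseteq> pts Y"
    if "z \<in> compactified_pts Y" "s \<in> representing_seqs z" for s z
  proof (cases z)
    case (Inl a)
    then show ?thesis using that by (auto simp: f_def compactified_pts_def)
  next
    case (Inr \<eta>)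
    then have "\<eta> \<in> gromov_boundary Y" "s \<in> \<eta>" using that by (auto simp: compactified_pts_def)
    then show ?thesis
      using Inr g[of \<eta> s] self_in_endpoint[OF hypX, of s] in_boundary_imp[OF hypY, of \<eta> s]
      by (auto simp: f_def gromov_seqs_iff)
  qed
  have "continuous_map (gromov_compactification Y) (gromov_compactification X) f"
    unfolding continuous_map_def topspace_gromov_compactification[OF hypY]
      topspace_gromov_compactification[OF hypX] openin_gromov_compactification
  proof (intro conjI allI impI)
    show "f \<in> compactified_pts Y \<rightarrow> compactified_pts X" using fpts by blast
    fix U assume U: "gromov_open X U"
    have "\<exists>R::real. {z \<in> compactified_pts Y. ereal R < ext_gromov_product Y z (Inr \<eta>)}
        \<subseteq> {z \<in> compactified_pts Y. f z \<in> U}"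
      if \<eta>: "Inr \<eta> \<in> compactified_pts Y" "f (Inr \<eta>) \<in> U" for \<eta>
    proof -
      obtain R where R: "{z \<in> compactified_pts X. ereal R < ext_gromov_product X z (f (Inr \<eta>))} \<subseteq> U"
        using U \<eta>(2) unfolding gromov_open_def f_def by auto
      obtain R' where R': "\<forall>x\<in>pts Y. \<forall>y\<in>pts Y. R' \<le> gprod Y x y \<longrightarrow> R + 1 \<le> gprod X x y"
        using gp by blast
      have "f z \<in> U" if z: "z \<in> compactified_pts Y" "ereal R' < ext_gromov_product Y z (Inr \<eta>)" for z
      proof -
        obtain s t N where st: "s \<in> representing_seqs z" "t \<in> representing_seqs (Inr \<eta>)"
          "\<And>i j. i \<ge> N \<Longrightarrow> j \<ge> N \<Longrightarrow> R' \<le> gprod Y (s i) (t j)"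
          using less_ext_gromov_productE[OF z(2)] by metis
        note rs = rep[OF z(1) st(1)] and rt = rep[OF \<eta>(1) st(2)]
        have "ereal R < ext_gromov_product X (f z) (f (Inr \<eta>))"
          by (rule less_ext_gromov_productI[of s _ t _ N]) (use rs rt st(3) R' in \<open>auto simp: image_subset_iff\<close>)
        then show ?thesis using R fpts[OF z(1)] by blast
      qed
      then show ?thesis by blast
    qed
    moreover have "openin (mtop Y) (Inl -` {z \<in> compactified_pts Y. f z \<in> U})"
      by (auto simp: disc compactified_pts_def)
    ultimately show "gromov_open Y {z \<in> compactified_pts Y. f z \<in> U}"
      unfolding gromov_open_def by auto
  qed
  then show "admits_cannon_thurston Y X (\<lambda>x. x)"
    unfolding admits_cannon_thurston_def cannon_thurston_map_def
    using hypY hypX pr by (auto intro!: exI[of _ f] simp: f_def)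
qed

text \<open>Since a Cannon-Thurston map sends the class of \<open>s\<close> in \<open>Y\<close> to
  the class of the same \<open>s\<close> in \<open>X\<close>, it hits \<zeta> as soon as \<zeta>
  contains a Gromov sequence of \<open>Y\<close>.\<close>

lemma cannon_thurston_boundary_surjI:
  assumes hypY: "hyperbolic_space Y" and hypX: "hyperbolic_space X"
    and disc: "mtop X = discrete_topology (pts X)"
    and ct: "admits_cannon_thurston Y X (\<lambda>x. x)" and sub: "gromov_seqs Y \<subseteq> gromov_seqs X"
    and ex: "\<And>\<zeta>. \<zeta> \<in> gromov_boundary X \<Longrightarrow> \<exists>s\<in>gromov_seqs Y. s \<in> \<zeta>"
  shows "cannon_thurston_boundary_surj Y X (\<lambda>x. x)"
  unfolding cannon_thurston_boundary_surj_def
proof (intro conjI allI impI ct)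
  fix f assume f: "cannon_thurston_map Y X (\<lambda>x. x) f"
  note val = cannon_thurston_map_endpoint[OF f disc]
  show "f ` Inr ` gromov_boundary Y = Inr ` gromov_boundary X"
  proof
    show "f ` Inr ` gromov_boundary Y \<subseteq> Inr ` gromov_boundary X"
      using boundary_cases[OF hypY] val sub endpoint_in_boundary by (smt (verit) imageE image_eqI image_subsetI subsetD)
    show "Inr ` gromov_boundary X \<subseteq> f ` Inr ` gromov_boundary Y"
    proof clarify
      fix \<zeta> assume \<zeta>: "\<zeta> \<in> gromov_boundary X"
      then obtain s where s: "s \<in> gromov_seqs Y" "s \<in> \<zeta>" using ex by blast
      have "f (Inr (endpoint Y s)) = Inr \<zeta>"
        using val[OF s(1)] in_boundary_imp[OF hypX \<zeta> s(2)] by simp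
      then show "Inr \<zeta> \<in> f ` Inr ` gromov_boundary Y"
        using endpoint_in_boundary[OF s(1)] by (metis imageI)
    qed
  qed
qed

text \<open>\<open>M n\<close> is the largest admissible value not exceeding \<open>n\<close>; the
  cap makes the maximum exist and does not spoil divergence.\<close>

lemma proper_funI:
  assumes "\<And>n. P n 0" and "\<And>k. \<exists>n0. \<forall>n\<ge>n0. P n k"
  shows "\<exists>M. proper_fun M \<and> (\<forall>n. P n (M n))"
proof -
  define M where "M n = Max {k. k \<le> n \<and> P n k}" for n :: nat
  have fin: "finite {k. k \<le> n \<and> P n k}" for n by simp
  have "M n \<in> {k. k \<le> n \<and> P n k}" for n
    unfolding M_def using fin assms(1) by (intro Max_in) auto
  moreover have "proper_fun M"
    unfolding proper_fun_def filterlim_at_top eventually_sequentially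
  proof
    fix k
    obtain n0 where n0: "\<forall>n\<ge>n0. P n k" using assms(2) by blast
    have "k \<le> M n" if "n \<ge> max n0 k" for n
      unfolding M_def using fin n0 that by (intro Max_ge) auto
    then show "\<exists>N. \<forall>n\<ge>N. k \<le> M n" by blast
  qed
  ultimately show ?thesis by blast
qed

lemma discrete_mtop:
  assumes "Metric_space (pts X) (dst X)" "\<And>x y. x \<in> pts X \<Longrightarrow> y \<in> pts X \<Longrightarrow> dst X x y < 1 \<Longrightarrow> x = y"
  shows "mtop X = discrete_topology (pts X)"
proof -
  interpret Metric_space "pts X" "dst X" by fact
  have "openin mtopology {x}" if "x \<in> pts X" for x
  proof -
    have "mball x 1 \<subseteq> {x}" using assms(2)[of x] by fastforce
    then show ?thesis unfolding openin_mtopology using that zero_less_one by blast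
  qed
  then show ?thesis by (metis discrete_topology_unique topspace_mtopology)
qed

lemma based_embedding_discrete:
  assumes "mtop Y = discrete_topology (pts Y)" "mtop X = discrete_topology (pts X)"
    and "pts Y \<subseteq> pts X" "bpt Y = bpt X"
  shows "based_embedding Y X (\<lambda>x. x)"
  using assms by (simp add: based_embedding_def embedding_map_def homeomorphic_map_def
      subtopology_discrete_topology Int_absorb1 quotient_map_def)

text \<open>Properness is a matter of finiteness: only finitely many points of \<open>Y\<close> lie
  within \<open>R\<close> of the base-point of \<open>X\<close>, so their distances from the
  base-point of \<open>Y\<close> are bounded.\<close>

lemma proper_embeddingI:
  assumes "based_embedding Y X (\<lambda>x. x)"
    and fin: "\<And>R. finite {x \<in> pts Y. dst X (bpt X) x < R}"
    and pos: "\<And>x. 0 \<le> dst X (bpt X) x"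
  shows "proper_embedding Y X (\<lambda>x. x)"
    and "\<exists>n. \<forall>y\<in>pts Y. real n \<le> dst Y (bpt Y) y \<longrightarrow> R \<le> dst X (bpt X) y"
proof -
  have far: "\<exists>n. \<forall>y\<in>pts Y. real n \<le> dst Y (bpt Y) y \<longrightarrow> R \<le> dst X (bpt X) y" for R
  proof -
    define D where "D = Max (insert 0 (dst Y (bpt Y) ` {x \<in> pts Y. dst X (bpt X) x < R}))"
    have D: "dst Y (bpt Y) y \<le> D" if "y \<in> pts Y" "dst X (bpt X) y < R" for y
      unfolding D_def using fin that by (intro Max_ge) auto
    obtain n :: nat where "D < real n" using reals_Archimedean2 by blast
    then show ?thesis using D by (meson leD le_less_trans not_le)
  qed
  then show "\<exists>n. \<forall>y\<in>pts Y. real n \<le> dst Y (bpt Y) y \<longrightarrow> R \<le> dst X (bpt X) y" .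
  have "\<forall>y\<in>pts Y. real n \<le> dst Y (bpt Y) y \<longrightarrow> real 0 \<le> dst X (bpt X) y" for n
    using pos by simp
  moreover have "\<exists>n0. \<forall>n\<ge>n0. \<forall>y\<in>pts Y. real n \<le> dst Y (bpt Y) y \<longrightarrow> real k \<le> dst X (bpt X) y" for k
    using far[of "real k"] by (meson of_nat_mono order_trans)
  ultimately have "\<exists>M. proper_fun M \<and>
      (\<forall>n. \<forall>y\<in>pts Y. real n \<le> dst Y (bpt Y) y \<longrightarrow> real (M n) \<le> dst X (bpt X) y)"
    by (rule proper_funI)
  then show "proper_embedding Y X (\<lambda>x. x)" using assms(1) unfolding proper_embedding_def by blast
qed

section \<open>Walks and trees\<close>

lemma path_edges_Cons: "p \<noteq> [] \<Longrightarrow> path_edges (x # p) = {x, hd p} # path_edges p"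
  by (cases p) auto

lemma length_path_edges [simp]: "length (path_edges p) = length p - 1"
  by (induction p rule: path_edges.induct) auto

lemma path_edges_append:
  "p \<noteq> [] \<Longrightarrow> q \<noteq> [] \<Longrightarrow> path_edges (p @ q) = path_edges p @ {last p, hd q} # path_edges q"
  by (induction p) (auto simp: path_edges_Cons)

text \<open>Concatenation of paths is written \<open>p @ tl q\<close> throughout, which drops the
  repeated vertex.\<close>

lemma path_edges_join:
  assumes "p \<noteq> []" "q \<noteq> []" "last p = hd q"
  shows "path_edges (p @ tl q) = path_edges p @ path_edges q"
proof (cases "tl q")
  case Nil
  then show ?thesis using assms by (cases q) auto
next
  case (Cons a r)
  then have "q = hd q # a # r" using assms by (metis list.collapse)
  then have "path_edges q = {hd q, a} # path_edges (a # r)" by (metis path_edges.simps(1))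
  then show ?thesis using assms Cons by (simp add: path_edges_append)
qed

lemma path_edges_rev: "path_edges (rev p) = rev (path_edges p)"
proof (induction p)
  case (Cons a p)
  then show ?case
    by (cases "p = []") (auto simp: path_edges_Cons path_edges_append last_rev)
qed simp

lemma path_edges_drop: "path_edges (drop i p) = drop i (path_edges p)"
proof (induction p arbitrary: i)
  case (Cons a p)
  then show ?case by (cases i; cases p) auto
qed simp

lemma path_edges_take: "path_edges (take (Suc i) p) = take i (path_edges p)"
proof (induction p arbitrary: i)
  case (Cons a p)
  then show ?case by (cases i; cases p) auto
qed simp

lemma nth_path_edges: "Suc i < length p \<Longrightarrow> path_edges p ! i = {p ! i, p ! Suc i}"
proof (induction p arbitrary: i)
  case (Cons a p)
  then show ?case by (cases i; cases p) auto
qed simp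

lemma set_path_edges: "set (path_edges p) = {{p ! i, p ! Suc i} | i. Suc i < length p}"
proof -
  have "set (path_edges p) = {path_edges p ! i | i. i < length p - 1}"
    by (simp add: set_conv_nth)
  also have "\<dots> = {{p ! i, p ! Suc i} | i. Suc i < length p}"
    using nth_path_edges by (metis (no_types, lifting) Suc_lessD less_diff_conv plus_1_eq_Suc add.commute)
  finally show ?thesis .
qed

lemma path_edges_subset: "e \<in> set (path_edges p) \<Longrightarrow> e \<subseteq> set p"
  by (auto simp: set_path_edges)

lemma distinct_path_edges: "distinct p \<Longrightarrow> distinct (path_edges p)"
proof (induction p)
  case (Cons a p)
  then show ?case
    using path_edges_subset[of "{a, hd p}" p] by (cases "p = []") (auto simp: path_edges_Cons)
qed simp

text \<open>A path without repetitions can be recovered from its edges by peeling off, at the start, the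
  only edge containing the initial vertex.\<close>

lemma distinct_path_eq_if_edges_eq:
  assumes "distinct p" "distinct q" "p \<noteq> []" "q \<noteq> []" "hd p = hd q"
    and "set (path_edges p) = set (path_edges q)"
  shows "p = q"
  using assms
proof (induction p arbitrary: q)
  case (Cons x p)
  then obtain q' where q: "q = x # q'" by (cases q) auto
  show ?case
  proof (cases "p = [] \<or> q' = []")
    case True
    then show ?thesis using Cons.prems q by (cases p; cases q') auto
  next
    case False
    have x: "{x, y} \<notin> set (path_edges p)" "{x, y} \<notin> set (path_edges q')" for y
      using Cons.prems q path_edges_subset[of "{x, y}"] by auto
    have "{x, hd p} \<in> set (path_edges q)" using Cons.prems False by (auto simp: path_edges_Cons)
    then have "{x, hd p} = {x, hd q'}" using x q False by (auto simp: path_edges_Cons)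
    then have hd: "hd p = hd q'" by (auto simp: doubleton_eq_iff)
    have "set (path_edges p) = set (path_edges q')"
      using Cons.prems q False hd x[of "hd p"] by (simp add: path_edges_Cons) (metis insert_ident)
    then show ?thesis using Cons.IH[of q'] Cons.prems q False hd by auto
  qed
qed simp

section \<open>Joining, cutting and loop erasure of walks\<close>

lemma walk_between_refl: "x \<in> fst \<G> \<Longrightarrow> walk_between \<G> x x [x]"
  by (simp add: walk_between_def)

lemma walk_between_rev: "walk_between \<G> x y p \<Longrightarrow> walk_between \<G> y x (rev p)"
  by (auto simp: walk_between_def path_edges_rev hd_rev last_rev)

lemma walk_between_join:
  assumes "walk_between \<G> x y p" "walk_between \<G> y z q"
  shows "walk_between \<G> x z (p @ tl q)"
proof -
  have "last (p @ tl q) = z" using assms by (cases q) (auto simp: walk_between_def last_append split: if_splits)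
  then show ?thesis using assms set_subset_Cons[of "tl q" "hd q"]
    by (auto simp: walk_between_def path_edges_join dest: list.set_sel(2))
qed

lemma walk_between_ends:
  assumes "walk_between \<G> x y p"
  shows "p \<noteq> []" "hd p = x" "last p = y" "x \<in> set p" "y \<in> set p" "x \<in> fst \<G>" "y \<in> fst \<G>" "set p \<subseteq> fst \<G>"
    "p ! 0 = x" "p ! (length p - 1) = y"
  using assms unfolding walk_between_def by (auto simp: hd_conv_nth last_conv_nth)

lemma walk_between_Cons:
  assumes "walk_between \<G> y z p" "x \<in> fst \<G>" "{x, y} \<in> snd \<G>"
  shows "walk_between \<G> x z (x # p)"
  using assms by (auto simp: walk_between_def path_edges_Cons)

lemma walk_between_drop:
  assumes "walk_between \<G> x y p" "i < length p"
  shows "walk_between \<G> (p ! i) y (drop i p)"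
  using assms set_drop_subset[of i p] set_drop_subset[of i "path_edges p"]
  by (auto simp: walk_between_def path_edges_drop hd_drop_conv_nth)

lemma walk_between_take:
  assumes "walk_between \<G> x y p" "i < length p"
  shows "walk_between \<G> x (p ! i) (take (Suc i) p)"
proof -
  have "last (take (Suc i) p) = p ! i" using assms by (simp add: take_Suc_conv_app_nth)
  then show ?thesis
    using assms set_take_subset[of "Suc i" p] set_take_subset[of i "path_edges p"]
    by (auto simp: walk_between_def path_edges_take)
qed

lemma take_join_drop: "i < length p \<Longrightarrow> take (Suc i) p @ tl (drop i p) = p"
  by (metis append_take_drop_id drop_Suc tl_drop)

text \<open>Loop erasure. The sublist relation between the edges is recorded because it bounds both
  the length and any nonnegative weight of \<open>q\<close> by those of \<open>p\<close>.\<close>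

lemma walk_between_shorten:
  assumes "walk_between \<G> x y p"
  obtains q where "walk_between \<G> x y q" "distinct q" "set q \<subseteq> set p"
    "subseq (path_edges q) (path_edges p)"
proof -
  have "\<exists>q. walk_between \<G> x y q \<and> distinct q \<and> set q \<subseteq> set p \<and> subseq (path_edges q) (path_edges p)"
    using assms
  proof (induction p arbitrary: x)
    case (Cons a p)
    show ?case
    proof (cases "p = []")
      case True
      then show ?thesis using Cons.prems by (auto intro!: exI[of _ "[a]"] simp: walk_between_def)
    next
      case False
      have ax: "a = x" and wp: "walk_between \<G> (hd p) y p" and e: "{x, hd p} \<in> snd \<G>"
        using Cons.prems False by (auto simp: walk_between_def path_edges_Cons)
      obtain q where q: "walk_between \<G> (hd p) y q" "distinct q" "set q \<subseteq> set p"
        "subseq (path_edges q) (path_edges p)"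
        using Cons.IH[OF wp] by blast
      note q' = walk_between_ends[OF q(1)]
      have x: "x \<in> fst \<G>" using walk_between_ends[OF Cons.prems] by blast
      show ?thesis
      proof (cases "x \<in> set q")
        case False
        then show ?thesis using q ax \<open>p \<noteq> []\<close> q' walk_between_Cons[OF q(1) x e]
          by (intro exI[of _ "x # q"]) (auto simp: path_edges_Cons)
      next
        \<comment> \<open>The new vertex already occurs on \<open>q\<close>: the loop closed there
          is cut off.\<close>
        case True
        then obtain i where i: "i < length q" "q ! i = x" by (metis in_set_conv_nth)
        have "subseq (path_edges (drop i q)) (path_edges q)"
          by (metis path_edges_drop suffix_drop suffix_imp_subseq)
        then have "subseq (path_edges (drop i q)) (path_edges (a # p))"
          using q(4) \<open>p \<noteq> []\<close> by (auto simp: path_edges_Cons intro: subseq_order.trans)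
        then show ?thesis using walk_between_drop[OF q(1) i(1)] i q set_drop_subset[of i q]
          by (intro exI[of _ "drop i q"]) auto
      qed
    qed
  qed (simp add: walk_between_def)
  then show thesis using that by blast
qed

lemma sum_list_subseq_le:
  fixes f :: "'a \<Rightarrow> real"
  assumes "subseq xs ys" "\<And>y. y \<in> set ys \<Longrightarrow> 0 \<le> f y"
  shows "sum_list (map f xs) \<le> sum_list (map f ys)"
  using assms
proof (induction rule: list_emb.induct)
  case (list_emb_Nil ys)
  then show ?case by (auto intro!: sum_list_nonneg)
qed (auto simp: add_increasing)

lemma distinct_join:
  assumes "distinct p" "distinct q" "q \<noteq> []" "set p \<inter> set q \<subseteq> {hd q}"
  shows "distinct (p @ tl q)"
  using assms by (cases q) auto

lemma set_join: "p \<noteq> [] \<Longrightarrow> q \<noteq> [] \<Longrightarrow> last p = hd q \<Longrightarrow> set (p @ tl q) = set p \<union> set q"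
  by (cases q) (auto simp: insert_absorb last_in_set)

text \<open>The splitting happens at the first vertex of \<open>p\<close> on \<open>q\<close>.\<close>

lemma first_meeting_distinct:
  assumes p: "walk_between \<G> x m p" "distinct p" and q: "walk_between \<G> y m q" "distinct q"
  obtains i j where "i < length p" "j < length q" "p ! i = q ! j"
    "set (take i p) \<inter> set q = {}"
    "walk_between \<G> x y (take (Suc i) p @ tl (rev (take (Suc j) q)))"
    "distinct (take (Suc i) p @ tl (rev (take (Suc j) q)))"
    "set (take (Suc i) p) \<union> set (take (Suc j) q) = set (take (Suc i) p @ tl (rev (take (Suc j) q)))"
proof -
  note pe = walk_between_ends[OF p(1)] and qe = walk_between_ends[OF q(1)]
  have "\<exists>i. i < length p \<and> p ! i \<in> set q"
    using pe qe by (metis in_set_conv_nth)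
  from exists_least_iff[THEN iffD1, OF this]
  obtain i where i: "i < length p" "p ! i \<in> set q" and min: "\<And>k. k < i \<Longrightarrow> \<not> (k < length p \<and> p ! k \<in> set q)"
    by blast
  obtain j where j: "j < length q" "q ! j = p ! i" using i by (metis in_set_conv_nth)
  have disj: "set (take i p) \<inter> set q = {}"
    using min i by (auto simp: in_set_conv_nth)
  have wp: "walk_between \<G> x (p ! i) (take (Suc i) p)" by (rule walk_between_take[OF p(1) i(1)])
  have wq: "walk_between \<G> (p ! i) y (rev (take (Suc j) q))"
    using walk_between_rev[OF walk_between_take[OF q(1) j(1)]] j by simp
  note wpe = walk_between_ends[OF wp] and wqe = walk_between_ends[OF wq]
  have "set (take (Suc i) p) \<inter> set (rev (take (Suc j) q)) \<subseteq> {hd (rev (take (Suc j) q))}"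
    using disj i wqe set_take_subset[of "Suc j" q] by (auto simp: take_Suc_conv_app_nth)
  then have "distinct (take (Suc i) p @ tl (rev (take (Suc j) q)))"
    using p q wqe by (intro distinct_join) auto
  moreover have "set (take (Suc i) p) \<union> set (take (Suc j) q)
      = set (take (Suc i) p @ tl (rev (take (Suc j) q)))"
    using set_join[OF wpe(1) wqe(1)] wpe(3) wqe(2) by simp
  ultimately show thesis
    using that[OF i(1) j(1) j(2)[symmetric] disj walk_between_join[OF wp wq]] by blast
qed

section \<open>The simplicial metric\<close>

lemma simplicial_dist_le:
  assumes "walk_between \<G> x y p" shows "simplicial_dist \<G> x y \<le> real (length p - 1)"
  unfolding simplicial_dist_def using assms by (intro of_nat_mono Least_le exI[of _ p]) simp

lemma simplicial_dist_attained:
  assumes "walk_between \<G> x y p"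
  obtains q where "walk_between \<G> x y q" "distinct q" "simplicial_dist \<G> x y = real (length q - 1)"
proof -
  define n where "n = (LEAST n. \<exists>p. walk_between \<G> x y p \<and> length (path_edges p) = n)"
  have "\<exists>q. walk_between \<G> x y q \<and> length (path_edges q) = n"
    unfolding n_def by (rule LeastI_ex) (use assms in blast)
  then obtain q where q: "walk_between \<G> x y q" "length q - 1 = n" by auto
  obtain r where r: "walk_between \<G> x y r" "distinct r" "subseq (path_edges r) (path_edges q)"
    using walk_between_shorten[OF q(1)] by metis
  have "simplicial_dist \<G> x y = real (length q - 1)" using q by (simp add: simplicial_dist_def n_def)
  moreover have "length r - 1 \<le> length q - 1" using list_emb_length[OF r(3)] by simp
  ultimately have "simplicial_dist \<G> x y = real (length r - 1)" using simplicial_dist_le[OF r(1)] by simp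
  then show thesis using that r by blast
qed

lemma Metric_space_simplicial_dist:
  assumes con: "\<And>x y. x \<in> fst \<G> \<Longrightarrow> y \<in> fst \<G> \<Longrightarrow> \<exists>p. walk_between \<G> x y p"
  shows "Metric_space (fst \<G>) (simplicial_dist \<G>)"
proof
  fix x y show "0 \<le> simplicial_dist \<G> x y" by (simp add: simplicial_dist_def)
  \<comment> \<open>\<open>Metric_space\<close> demands symmetry for points outside of the graph as
    well, where \<open>LEAST\<close> ranges over an empty set of lengths; hence the predicates
    themselves are compared.\<close>
  have "(\<exists>p. walk_between \<G> x y p \<and> length (path_edges p) = n) \<longleftrightarrow>
      (\<exists>p. walk_between \<G> y x p \<and> length (path_edges p) = n)" for n
    by (metis walk_between_rev length_rev length_path_edges)
  then show "simplicial_dist \<G> x y = simplicial_dist \<G> y x" by (simp add: simplicial_dist_def)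
next
  fix x y assume xy: "x \<in> fst \<G>" "y \<in> fst \<G>"
  show "(simplicial_dist \<G> x y = 0) = (x = y)"
  proof
    assume 0: "simplicial_dist \<G> x y = 0"
    obtain q where q: "walk_between \<G> x y q" "simplicial_dist \<G> x y = real (length q - 1)"
      using con[OF xy] simplicial_dist_attained by metis
    then have "length q \<le> 1" using 0 by simp
    then show "x = y" using walk_between_ends[OF q(1)] by (metis One_nat_def diff_is_0_eq)
  next
    assume "x = y"
    moreover have "simplicial_dist \<G> x x \<le> 0"
      using simplicial_dist_le[OF walk_between_refl[OF xy(1)]] by simp
    moreover have "0 \<le> simplicial_dist \<G> x y" by (simp add: simplicial_dist_def)
    ultimately show "simplicial_dist \<G> x y = 0" by simp
  qed
next
  fix x y z assume xyz: "x \<in> fst \<G>" "y \<in> fst \<G>" "z \<in> fst \<G>"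
  obtain p where p: "walk_between \<G> x y p" "simplicial_dist \<G> x y = real (length p - 1)"
    using con[OF xyz(1,2)] simplicial_dist_attained by metis
  obtain q where q: "walk_between \<G> y z q" "simplicial_dist \<G> y z = real (length q - 1)"
    using con[OF xyz(2,3)] simplicial_dist_attained by metis
  have "simplicial_dist \<G> x z \<le> real (length (p @ tl q) - 1)"
    by (rule simplicial_dist_le[OF walk_between_join[OF p(1) q(1)]])
  also have "length (p @ tl q) - 1 = (length p - 1) + (length q - 1)"
    using walk_between_ends(1)[OF p(1)] by (cases p) auto
  finally show "simplicial_dist \<G> x z \<le> simplicial_dist \<G> x y + simplicial_dist \<G> y z"
    using p q by simp
qed

section \<open>Distances and Gromov products in trees\<close>

lemma is_tree_ex_path:
  assumes "is_tree \<G>" "x \<in> fst \<G>" "y \<in> fst \<G>"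
  obtains p where "walk_between \<G> x y p" "distinct p"
  using assms unfolding is_tree_def by blast

lemma is_tree_unique:
  assumes "is_tree \<G>" "walk_between \<G> x y p" "distinct p" "walk_between \<G> x y q" "distinct q"
  shows "p = q"
  using assms walk_between_ends(6,7)[OF assms(2)] unfolding is_tree_def by blast

lemma is_tree_simplicial_dist:
  assumes "is_tree \<G>" "walk_between \<G> x y p" "distinct p"
  shows "simplicial_dist \<G> x y = real (length p - 1)"
  using simplicial_dist_attained[OF assms(2)] is_tree_unique[OF assms] by metis

lemma Metric_space_tree:
  assumes "is_tree \<G>" shows "Metric_space (fst \<G>) (simplicial_dist \<G>)"
  using is_tree_ex_path[OF assms] by (intro Metric_space_simplicial_dist) metis

lemma is_tree_between:
  assumes "is_tree \<G>" "walk_between \<G> x y p" "distinct p" "v \<in> set p"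
  shows "simplicial_dist \<G> x v + simplicial_dist \<G> v y = simplicial_dist \<G> x y"
proof -
  obtain i where i: "i < length p" "p ! i = v" using assms by (metis in_set_conv_nth)
  have "simplicial_dist \<G> x v = real i"
    using is_tree_simplicial_dist[OF assms(1) walk_between_take[OF assms(2) i(1)]] assms i by simp
  moreover have "simplicial_dist \<G> v y = real (length p - i - 1)"
    using is_tree_simplicial_dist[OF assms(1) walk_between_drop[OF assms(2) i(1)]] assms i by simp
  ultimately show ?thesis using is_tree_simplicial_dist[OF assms(1-3)] i by simp
qed

lemma gromov_product_le_between:
  assumes "Metric_space M d" "w \<in> M" "x \<in> M" "y \<in> M" "v \<in> M" "d x v + d v y \<le> d x y"
  shows "gromov_product d w x y \<le> d w v"
  using assms Metric_space.triangle[OF assms(1), of w v x] Metric_space.triangle[OF assms(1), of w v y]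
    Metric_space.commute[OF assms(1), of v x]
  by (simp add: gromov_product_def)

text \<open>The path from \<open>w\<close> to \<open>x\<close> enters \<open>p\<close> at a first
  vertex, from which \<open>p\<close> runs to either end without meeting that path again. By
  uniqueness of paths both distances from \<open>w\<close> split at this vertex, and the Gromov
  product is its distance from \<open>w\<close>.\<close>

lemma is_tree_gromov_product_attained:
  assumes T: "is_tree \<G>" and w: "w \<in> fst \<G>" and p: "walk_between \<G> x y p" "distinct p"
  shows "\<exists>v\<in>set p. simplicial_dist \<G> w v = gromov_product (simplicial_dist \<G>) w x y"
proof -
  note pe = walk_between_ends[OF p(1)]
  obtain q where q: "walk_between \<G> w x q" "distinct q" using is_tree_ex_path[OF T w pe(6)] .
  note qe = walk_between_ends[OF q(1)]
  have "\<exists>i. i < length q \<and> q ! i \<in> set p" using pe qe by (metis in_set_conv_nth)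
  from exists_least_iff[THEN iffD1, OF this]
  obtain i where i: "i < length q" "q ! i \<in> set p"
    and min: "\<And>k. k < i \<Longrightarrow> \<not> (k < length q \<and> q ! k \<in> set p)"
    by blast
  obtain j where j: "j < length p" "p ! j = q ! i" using i by (metis in_set_conv_nth)
  have disj: "set (take i q) \<inter> set p = {}" using min i by (auto simp: in_set_conv_nth)
  have wq: "walk_between \<G> w (q ! i) (take (Suc i) q)" by (rule walk_between_take[OF q(1) i(1)])
  have dq: "simplicial_dist \<G> w (q ! i) = real i"
    using is_tree_simplicial_dist[OF T wq] q i by simp
  have step: "simplicial_dist \<G> w z = real i + real (length r - 1)"
    if r: "walk_between \<G> (q ! i) z r" "distinct r" "set r \<subseteq> set p" for r z
  proof -
    note re = walk_between_ends[OF r(1)]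
    have "set (take (Suc i) q) \<inter> set r \<subseteq> {hd r}"
      using disj i re r by (auto simp: take_Suc_conv_app_nth)
    then have "distinct (take (Suc i) q @ tl r)" using q r re by (intro distinct_join) auto
    then have "simplicial_dist \<G> w z = real (length (take (Suc i) q @ tl r) - 1)"
      using is_tree_simplicial_dist[OF T walk_between_join[OF wq r(1)]] by blast
    then show ?thesis using i re by simp
  qed
  have "simplicial_dist \<G> w x = real i + real j"
    using step[of x "rev (take (Suc j) p)"] walk_between_rev[OF walk_between_take[OF p(1) j(1)]] j p
      set_take_subset[of "Suc j" p] by simp
  moreover have "simplicial_dist \<G> w y = real i + real (length p - j - 1)"
    using step[of y "drop j p"] walk_between_drop[OF p(1) j(1)] j p set_drop_subset[of j p] by simp
  ultimately have "gromov_product (simplicial_dist \<G>) w x y = real i"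
    using is_tree_simplicial_dist[OF T p] j by (simp add: gromov_product_def)
  then show ?thesis using dq i by metis
qed

text \<open>The point of \<open>[x,z]\<close> that is nearest to \<open>w\<close> lies on \<open>[x,y]\<close> or on
  \<open>[y,z]\<close>.\<close>

lemma hyperbolic_space_tree:
  assumes T: "is_tree \<G>" and v0: "v0 \<in> fst \<G>"
  shows "hyperbolic_space (simplicial_space \<G> v0)"
proof -
  note M = Metric_space_tree[OF T]
  have "min (gromov_product (simplicial_dist \<G>) w x y) (gromov_product (simplicial_dist \<G>) w y z) - 0
      \<le> gromov_product (simplicial_dist \<G>) w x z"
    if wxyz: "w \<in> fst \<G>" "x \<in> fst \<G>" "y \<in> fst \<G>" "z \<in> fst \<G>" for w x y z
  proof -
    obtain p where p: "walk_between \<G> x y p" "distinct p" using is_tree_ex_path[OF T wxyz(2,3)] .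
    obtain q where q: "walk_between \<G> y z q" "distinct q" using is_tree_ex_path[OF T wxyz(3,4)] .
    obtain r where r: "walk_between \<G> x z r" "distinct r" "set r \<subseteq> set (p @ tl q)"
      using walk_between_shorten[OF walk_between_join[OF p(1) q(1)]] by metis
    have sub: "set r \<subseteq> set p \<union> set q" using r(3) walk_between_ends(1)[OF q(1)] by (auto dest: list.set_sel(2))
    obtain v where v: "v \<in> set r" "simplicial_dist \<G> w v = gromov_product (simplicial_dist \<G>) w x z"
      using is_tree_gromov_product_attained[OF T wxyz(1) r(1,2)] by blast
    have vV: "v \<in> fst \<G>" using v walk_between_ends(8)[OF r(1)] by blast
    consider "v \<in> set p" | "v \<in> set q" using v sub by blast
    then show ?thesis
    proof cases
      case 1
      then show ?thesis using gromov_product_le_between[OF M wxyz(1-3) vV] is_tree_between[OF T p 1] v by simp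
    next
      case 2
      then show ?thesis using gromov_product_le_between[OF M wxyz(1,3,4) vV] is_tree_between[OF T q 2] v by simp
    qed
  qed
  then show ?thesis using M v0 unfolding hyperbolic_space_def simplicial_space_def by (simp, blast)
qed

lemma simplicial_space_simps [simp]:
  "pts (simplicial_space \<G> v) = fst \<G>" "bpt (simplicial_space \<G> v) = v"
  "dst (simplicial_space \<G> v) = simplicial_dist \<G>"
  by (simp_all add: simplicial_space_def)

lemma simplicial_dist_one_imp_edge:
  assumes "walk_between \<G> x y r" "simplicial_dist \<G> x y = 1" shows "{x, y} \<in> snd \<G>"
proof -
  obtain q where q: "walk_between \<G> x y q" "simplicial_dist \<G> x y = real (length q - 1)"
    using simplicial_dist_attained[OF assms(1)] by metis
  then have "length q = 2" using assms by simp
  then obtain a b where "q = [a, b]" by (auto simp: length_Suc_conv numeral_2_eq_2)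
  then show ?thesis using q(1) by (auto simp: walk_between_def)
qed

lemma geodesic_between_tree:
  assumes T: "is_tree \<G>" and g: "geodesic_between (simplicial_space \<G> v) x y p"
  shows "walk_between \<G> x y p" "distinct p"
proof -
  have p: "p \<noteq> []" "hd p = x" "last p = y" "set p \<subseteq> fst \<G>"
    and d: "\<And>i j. i < length p \<Longrightarrow> j < length p \<Longrightarrow> simplicial_dist \<G> (p ! i) (p ! j) = \<bar>real i - real j\<bar>"
    using g by (auto simp: geodesic_between_def)
  interpret Metric_space "fst \<G>" "simplicial_dist \<G>" by (rule Metric_space_tree[OF T])
  show "distinct p"
    unfolding distinct_conv_nth using d p(4)
    by (metis mdist_zero nth_mem subsetD abs_eq_0 eq_iff_diff_eq_0 of_nat_eq_iff)
  have "{p ! i, p ! Suc i} \<in> snd \<G>" if "Suc i < length p" for i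
  proof -
    have "p ! i \<in> fst \<G>" "p ! Suc i \<in> fst \<G>" using that p(4) by (auto simp: subset_iff)
    then obtain r where "walk_between \<G> (p ! i) (p ! Suc i) r" using is_tree_ex_path[OF T] by metis
    then show ?thesis using simplicial_dist_one_imp_edge d[of i "Suc i"] that by simp
  qed
  then show "walk_between \<G> x y p" using p by (auto simp: walk_between_def set_path_edges)
qed

text \<open>Vertices of a geodesic lie between its ends, so the triangle inequality suffices. A
  large Gromov product thus keeps the whole geodesic away from the base-point, which is how
  2-properness is obtained.\<close>

lemma geodesic_between_gprod_le:
  assumes "Metric_space (pts X) (dst X)" "bpt X \<in> pts X" "geodesic_between X x y p" "v \<in> set p"
  shows "gprod X x y \<le> dst X (bpt X) v"
proof -
  have p: "p \<noteq> []" "hd p = x" "last p = y" "set p \<subseteq> pts X"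
    and d: "\<And>i j. i < length p \<Longrightarrow> j < length p \<Longrightarrow> dst X (p ! i) (p ! j) = \<bar>real i - real j\<bar>"
    using assms(3) by (auto simp: geodesic_between_def)
  obtain i where i: "i < length p" "p ! i = v" using assms(4) by (metis in_set_conv_nth)
  have "x = p ! 0" "y = p ! (length p - 1)" using p by (auto simp: hd_conv_nth last_conv_nth)
  then have "dst X x v + dst X v y \<le> dst X x y"
    using d[of 0 i] d[of i "length p - 1"] d[of 0 "length p - 1"] i p by simp
  moreover have "x \<in> pts X" "y \<in> pts X" "v \<in> pts X" using p assms(4) by auto
  ultimately show ?thesis using gromov_product_le_between[OF assms(1,2)] by blast
qed

lemma le_dist_to_set_iff:
  assumes "p \<noteq> []" shows "r \<le> dist_to_set X x (set p) \<longleftrightarrow> (\<forall>v\<in>set p. r \<le> dst X x v)"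
  unfolding dist_to_set_def using assms by (subst le_cINF_iff) (auto intro: bdd_below_finite)

section \<open>Cayley graphs of hyperbolic groups\<close>

lemma path_weight_join:
  "p \<noteq> [] \<Longrightarrow> q \<noteq> [] \<Longrightarrow> last p = hd q \<Longrightarrow> path_weight \<omega> (p @ tl q) = path_weight \<omega> p + path_weight \<omega> q"
  by (simp add: path_weight_def path_edges_join)

lemma path_weight_rev: "path_weight \<omega> (rev p) = path_weight \<omega> p"
  by (simp add: path_weight_def path_edges_rev rev_map[symmetric])

lemma sum_list_subseq_less:
  fixes f :: "'a \<Rightarrow> real"
  assumes "subseq xs ys" "\<And>y. y \<in> set ys \<Longrightarrow> 0 < f y" "length xs < length ys"
  shows "sum_list (map f xs) < sum_list (map f ys)"
  using assms
proof (induction rule: list_emb.induct)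
  case (list_emb_Nil ys)
  then obtain a zs where ys: "ys = a # zs" by (cases ys) auto
  have "0 \<le> sum_list (map f zs)"
    using list_emb_Nil ys by (intro sum_list_nonneg) (fastforce intro: less_imp_le)
  then show ?case using list_emb_Nil ys by (auto intro: add_pos_nonneg)
next
  case (list_emb_Cons xs ys y)
  have "0 \<le> f z" if "z \<in> set ys" for z using list_emb_Cons.prems(1)[of z] that by simp
  then have "sum_list (map f xs) \<le> sum_list (map f ys)"
    using list_emb_Cons.hyps by (intro sum_list_subseq_le) auto
  then show ?case using list_emb_Cons.prems(1)[of y] by simp
qed auto

lemma foldr_mult_in_carrier:
  assumes "group G" "set ws \<subseteq> carrier G" shows "foldr (\<lambda>a b. a \<otimes>\<^bsub>G\<^esub> b) ws \<one>\<^bsub>G\<^esub> \<in> carrier G"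
  using assms(2) by (induction ws) (auto intro!: monoid.m_closed group.is_monoid[OF assms(1)] monoid.one_closed)

locale hyperbolic_cayley = group G for G :: "('a, 'b) monoid_scheme" (structure) +
  fixes S :: "'a set"
  assumes finite_S: "finite S" and S_carrier: "S \<subseteq> carrier G"
    and S_inv: "\<And>s. s \<in> S \<Longrightarrow> inv s \<in> S" and S_generate: "generate G S = carrier G"
    and hyperbolic: "hyperbolic_space (cayley_space G S)"
begin

abbreviation "\<Gamma> \<equiv> cayley_graph G S"
abbreviation "X \<equiv> cayley_space G S"
abbreviation wd :: "'a \<Rightarrow> 'a \<Rightarrow> real" where "wd \<equiv> word_dist G S"
abbreviation wlen :: "'a \<Rightarrow> real" where "wlen \<equiv> word_dist G S \<one>"
abbreviation word_prod :: "'a list \<Rightarrow> 'a" where "word_prod ws \<equiv> foldr (\<lambda>a b. a \<otimes> b) ws \<one>"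

lemma cayley_space_simps [simp]: "pts X = carrier G" "bpt X = \<one>" "dst X = wd"
  by (simp_all add: cayley_space_def)

lemma cayley_graph_simps [simp]: "fst \<Gamma> = carrier G" "snd \<Gamma> = cayley_edges G S"
  by (simp_all add: cayley_graph_def)

sublocale Metric_space "carrier G" wd
  using hyperbolic_space_imp_Metric_space[OF hyperbolic] by simp

lemma word_prod_closed: "set ws \<subseteq> S \<Longrightarrow> word_prod ws \<in> carrier G"
  using S_carrier foldr_mult_in_carrier[OF group_axioms] by blast

section \<open>Words, balls and walks in the Cayley graph\<close>

lemma word_prod_append:
  "set us \<subseteq> S \<Longrightarrow> set vs \<subseteq> S \<Longrightarrow> word_prod (us @ vs) = word_prod us \<otimes> word_prod vs"
proof (induction us)
  case Nil
  then show ?case using word_prod_closed by simp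
next
  case (Cons a us)
  then show ?case using S_carrier word_prod_closed by (auto simp: m_assoc)
qed

lemma word_prod_surj:
  assumes "g \<in> carrier G" shows "\<exists>ws. set ws \<subseteq> S \<and> word_prod ws = g"
proof -
  have "g \<in> generate G S" using assms S_generate by simp
  then show ?thesis
  proof (induction rule: generate.induct)
    case one
    show ?case by (intro exI[of _ "[]"]) simp
  next
    case (incl h)
    then show ?case using S_carrier by (intro exI[of _ "[h]"]) auto
  next
    case (inv h)
    then show ?case using S_carrier S_inv by (intro exI[of _ "[inv h]"]) auto
  next
    case (eng h1 h2)
    then obtain us vs where "set us \<subseteq> S" "word_prod us = h1" "set vs \<subseteq> S" "word_prod vs = h2" by blast
    then show ?case by (intro exI[of _ "us @ vs"]) (simp add: word_prod_append del: foldr_append)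
  qed
qed

lemma wlen_word:
  assumes "g \<in> carrier G"
  obtains ws where "set ws \<subseteq> S" "word_prod ws = g" "wlen g = real (length ws)"
proof -
  obtain vs where "set vs \<subseteq> S" "word_prod vs = g" using word_prod_surj[OF assms] by blast
  then have "\<exists>n ws. length ws = n \<and> set ws \<subseteq> S \<and> word_prod ws = g" by blast
  from LeastI_ex[OF this] have "\<exists>ws. length ws = word_length G S g \<and> set ws \<subseteq> S \<and> word_prod ws = g"
    by (simp only: word_length_def)
  then show thesis using that assms by (auto simp: word_dist_def)
qed

lemma wd_nat: "\<exists>n::nat. wd x y = real n"
  by (simp add: word_dist_def)

lemma wd_less_one:
  assumes "x \<in> carrier G" "y \<in> carrier G" "wd x y < 1" shows "x = y"
proof -
  obtain n :: nat where "wd x y = real n" using wd_nat by blast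
  then have "wd x y = 0" using assms by simp
  then show ?thesis using assms by simp
qed

lemma mtop_cayley: "mtop X = discrete_topology (carrier G)"
  using discrete_mtop[OF hyperbolic_space_imp_Metric_space[OF hyperbolic]] wd_less_one by simp

lemma wd_generator:
  assumes "g \<in> carrier G" "s \<in> S" shows "wd g (g \<otimes> s) \<le> 1"
proof -
  have s: "s \<in> carrier G" using assms S_carrier by blast
  have "inv g \<otimes> (g \<otimes> s) = s" using assms s by (simp add: m_assoc[symmetric])
  moreover have "word_length G S s \<le> 1"
    unfolding word_length_def by (rule Least_le, rule exI[of _ "[s]"]) (use assms s in auto)
  ultimately show ?thesis using assms s by (simp add: word_dist_def)
qed

lemma cayley_edgeE:
  assumes "{x, y} \<in> cayley_edges G S"
  obtains s where "s \<in> S" "y = x \<otimes> s" "x \<in> carrier G" "y \<in> carrier G" "x \<noteq> y" "wd x y \<le> 1"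
proof -
  obtain g s where gs: "{x, y} = {g, g \<otimes> s}" "g \<in> carrier G" "s \<in> S" "g \<otimes> s \<noteq> g"
    using assms unfolding cayley_edges_def by blast
  have s: "s \<in> carrier G" using gs S_carrier by blast
  consider "x = g" "y = g \<otimes> s" | "x = g \<otimes> s" "y = g" using gs(1) by (auto simp: doubleton_eq_iff)
  then show thesis
  proof cases
    case 1
    then show thesis using gs s wd_generator by (intro that[of s]) auto
  next
    case 2
    have "y = x \<otimes> inv s" using 2 gs s by (simp add: m_assoc)
    then show thesis using 2 gs s S_inv wd_generator[of x "inv s"] by (intro that[of "inv s"]) auto
  qed
qed

lemma wlen_edge: "{x, y} \<in> cayley_edges G S \<Longrightarrow> wlen x \<le> wlen y + 1"
  by (elim cayley_edgeE) (use triangle[of \<one> y x] commute[of x y] in auto)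

text \<open>Shorter words are padded with \<open>\<one>\<close> to length exactly \<open>n\<close>,
  so that a single power of \<open>card S + 1\<close> bounds the size of the ball.\<close>

lemma ball_eq_words:
  "{g \<in> carrier G. wlen g \<le> real n} \<subseteq> word_prod ` {ws. set ws \<subseteq> insert \<one> S \<and> length ws = n}"
proof
  fix g assume "g \<in> {g \<in> carrier G. wlen g \<le> real n}"
  then obtain ws where ws: "set ws \<subseteq> S" "word_prod ws = g" "length ws \<le> n"
    by (auto elim!: wlen_word)
  define vs where "vs = ws @ replicate (n - length ws) \<one>"
  have "foldr (\<lambda>a b. a \<otimes> b) (replicate k \<one>) \<one> = \<one>" for k by (induction k) auto
  then have "word_prod vs = g" using ws by (simp add: vs_def)
  moreover have "set vs \<subseteq> insert \<one> S" "length vs = n" using ws by (auto simp: vs_def)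
  ultimately show "g \<in> word_prod ` {ws. set ws \<subseteq> insert \<one> S \<and> length ws = n}" by blast
qed

lemma finite_ball: "finite {g \<in> carrier G. wlen g \<le> real n}"
  and card_ball: "card {g \<in> carrier G. wlen g \<le> real n} \<le> (card S + 1) ^ n"
proof -
  have fin: "finite {ws. set ws \<subseteq> insert \<one> S \<and> length ws = n}"
    using finite_S by (intro finite_lists_length_eq) auto
  then show "finite {g \<in> carrier G. wlen g \<le> real n}"
    using finite_subset[OF ball_eq_words] by blast
  have "card {g \<in> carrier G. wlen g \<le> real n} \<le> card {ws. set ws \<subseteq> insert \<one> S \<and> length ws = n}"
    using surj_card_le[OF fin ball_eq_words] .
  also have "\<dots> = card (insert \<one> S) ^ n" using finite_S by (simp add: card_lists_length_eq)
  also have "\<dots> \<le> (card S + 1) ^ n" using finite_S by (intro power_mono) (auto simp: card_insert_if)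
  finally show "card {g \<in> carrier G. wlen g \<le> real n} \<le> (card S + 1) ^ n" .
qed

lemma finite_wlen_less: "finite {g \<in> carrier G. wlen g < R}"
proof -
  obtain n :: nat where "R \<le> real n" using real_arch_simple by blast
  then show ?thesis by (auto intro: finite_subset[OF _ finite_ball[of n]])
qed

lemma walk_along_word:
  assumes "set ws \<subseteq> S" "x \<in> carrier G"
  shows "\<exists>p. walk_between \<Gamma> x (x \<otimes> word_prod ws) p \<and> length p \<le> Suc (length ws)"
  using assms
proof (induction ws arbitrary: x)
  case Nil
  then show ?case by (intro exI[of _ "[x]"]) (simp add: walk_between_refl)
next
  case (Cons s ws)
  have s: "s \<in> S" "s \<in> carrier G" using Cons.prems S_carrier by auto
  then obtain p where p: "walk_between \<Gamma> (x \<otimes> s) (x \<otimes> s \<otimes> word_prod ws) p" "length p \<le> Suc (length ws)"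
    using Cons.IH[of "x \<otimes> s"] Cons.prems by auto
  have eq: "x \<otimes> s \<otimes> word_prod ws = x \<otimes> word_prod (s # ws)"
    using Cons.prems s word_prod_closed[of ws] by (simp add: m_assoc)
  show ?case
  proof (cases "x \<otimes> s = x")
    \<comment> \<open>A generator equal to \<open>\<one>\<close> gives a loop, which is not an edge,
      and is skipped; hence only an upper bound on the length of \<open>p\<close> is
      claimed.\<close>
    case True
    then show ?thesis using p eq by (intro exI[of _ p]) auto
  next
    case False
    then have "{x, x \<otimes> s} \<in> cayley_edges G S" using Cons.prems s unfolding cayley_edges_def by blast
    then show ?thesis using p eq walk_between_Cons[OF p(1), of x] Cons.prems
      by (intro exI[of _ "x # p"]) auto
  qed
qed

lemma walk_from_one:
  assumes "g \<in> carrier G"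
  obtains p where "walk_between \<Gamma> \<one> g p" "distinct p" "real (length p - 1) \<le> wlen g"
proof -
  obtain ws where ws: "set ws \<subseteq> S" "word_prod ws = g" "wlen g = real (length ws)"
    using wlen_word[OF assms] .
  obtain p where p: "walk_between \<Gamma> \<one> (\<one> \<otimes> word_prod ws) p" "length p \<le> Suc (length ws)"
    using walk_along_word[OF ws(1) one_closed] by blast
  obtain q where q: "walk_between \<Gamma> \<one> (\<one> \<otimes> word_prod ws) q" "distinct q" "subseq (path_edges q) (path_edges p)"
    using walk_between_shorten[OF p(1)] by metis
  have "length q - 1 \<le> length p - 1" using list_emb_length[OF q(3)] by simp
  then show thesis using that[of q] p q ws assms by auto
qed

lemma connected:
  assumes "x \<in> carrier G" "y \<in> carrier G" shows "\<exists>p. walk_between \<Gamma> x y p"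
  using walk_from_one[OF assms(1)] walk_from_one[OF assms(2)] walk_between_join walk_between_rev by metis

section \<open>Counting walks and self-avoiding paths\<close>

definition walks_from :: "'a \<Rightarrow> nat \<Rightarrow> 'a list set" where
  "walks_from x n = {p. walk_between \<Gamma> x (last p) p \<and> length p = Suc n}"

lemma walks_from_Suc: "walks_from x (Suc n) \<subseteq> (\<Union>s\<in>S. (#) x ` walks_from (x \<otimes> s) n)"
proof
  fix p assume p: "p \<in> walks_from x (Suc n)"
  then obtain y q where pq: "p = x # y # q" "length q = n"
    by (auto simp: walks_from_def walk_between_def length_Suc_conv)
  then have "{x, y} \<in> cayley_edges G S" and w: "y # q \<in> walks_from y n"
    using p by (auto simp: walks_from_def walk_between_def)
  then obtain s where "s \<in> S" "y = x \<otimes> s" by (elim cayley_edgeE)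
  then show "p \<in> (\<Union>s\<in>S. (#) x ` walks_from (x \<otimes> s) n)" using w pq by auto
qed

lemma finite_walks_from: "finite (walks_from x n)"
  and card_walks_from: "card (walks_from x n) \<le> card S ^ n"
proof (induction n arbitrary: x)
  case 0
  have sub: "walks_from x 0 \<subseteq> {[x]}" for x
    by (auto simp: walks_from_def walk_between_def length_Suc_conv)
  { case 1 show ?case using finite_subset[OF sub finite.insertI[OF finite.emptyI]] . }
  { case 2 show ?case using card_mono[OF _ sub] by simp }
next
  case (Suc n)
  have fin: "finite (\<Union>s\<in>S. (#) x ` walks_from (x \<otimes> s) n)" for x using finite_S Suc by simp
  { case 1 show ?case using finite_subset[OF walks_from_Suc fin] . }
  { case 2
    have "card (walks_from x (Suc n)) \<le> card (\<Union>s\<in>S. (#) x ` walks_from (x \<otimes> s) n)"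
      by (rule card_mono[OF fin walks_from_Suc])
    also have "\<dots> \<le> (\<Sum>s\<in>S. card ((#) x ` walks_from (x \<otimes> s) n))"
      by (rule card_UN_le[OF finite_S])
    also have "\<dots> \<le> (\<Sum>s\<in>S. card S ^ n)"
      using Suc by (intro sum_mono) (meson card_image_le order_trans)
    finally show ?case by simp }
qed

lemma finite_walks_upto: "finite {p. walk_between \<Gamma> x (last p) p \<and> length p \<le> n}"
proof -
  have "{p. walk_between \<Gamma> x (last p) p \<and> length p \<le> n} \<subseteq> (\<Union>k\<in>{..<n}. walks_from x k)"
  proof
    fix p assume "p \<in> {p. walk_between \<Gamma> x (last p) p \<and> length p \<le> n}"
    then have p: "walk_between \<Gamma> x (last p) p" "length p \<le> n" "p \<noteq> []" by (auto simp: walk_between_def)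
    then have "p \<in> walks_from x (length p - 1)" "length p - 1 < n" by (cases p; auto simp: walks_from_def)+
    then show "p \<in> (\<Union>k\<in>{..<n}. walks_from x k)" by blast
  qed
  then show ?thesis using finite_walks_from by (meson finite_UN_I finite_lessThan finite_subset)
qed

definition paths_near :: "nat \<Rightarrow> 'a list set" where
  "paths_near n = {p. distinct p \<and> walk_between \<Gamma> (hd p) (last p) p \<and> length p = Suc n \<and> wlen (hd p) \<le> real n}"

lemma finite_paths_near: "finite (paths_near n)"
  and card_paths_near: "card (paths_near n) \<le> ((card S + 1) * card S) ^ n"
proof -
  have sub: "paths_near n \<subseteq> (\<Union>x\<in>{g \<in> carrier G. wlen g \<le> real n}. walks_from x n)"
  proof
    fix p assume p: "p \<in> paths_near n"
    then have "hd p \<in> carrier G" using walk_between_ends(6)[of \<Gamma> "hd p"] by (auto simp: paths_near_def)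
    then show "p \<in> (\<Union>x\<in>{g \<in> carrier G. wlen g \<le> real n}. walks_from x n)"
      using p unfolding paths_near_def walks_from_def by blast
  qed
  have fin: "finite (\<Union>x\<in>{g \<in> carrier G. wlen g \<le> real n}. walks_from x n)"
    using finite_ball finite_walks_from by blast
  show "finite (paths_near n)" using finite_subset[OF sub fin] .
  have "card (paths_near n) \<le> card (\<Union>x\<in>{g \<in> carrier G. wlen g \<le> real n}. walks_from x n)"
    by (rule card_mono[OF fin sub])
  also have "\<dots> \<le> (\<Sum>x\<in>{g \<in> carrier G. wlen g \<le> real n}. card (walks_from x n))"
    by (rule card_UN_le[OF finite_ball])
  also have "\<dots> \<le> (\<Sum>x\<in>{g \<in> carrier G. wlen g \<le> real n}. card S ^ n)"
    by (intro sum_mono card_walks_from)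
  also have "\<dots> = card {g \<in> carrier G. wlen g \<le> real n} * card S ^ n" by simp
  also have "\<dots> \<le> (card S + 1) ^ n * card S ^ n" using card_ball by (intro mult_right_mono) auto
  finally show "card (paths_near n) \<le> ((card S + 1) * card S) ^ n" by (simp only: power_mult_distrib)
qed

lemma countable_carrier: "countable (carrier G)"
proof -
  have "carrier G \<subseteq> (\<Union>n::nat. {g \<in> carrier G. wlen g \<le> real n})"
    using real_arch_simple by blast
  moreover have "countable (\<Union>n::nat. {g \<in> carrier G. wlen g \<le> real n})"
    by (rule countable_UN[OF countableI_type countable_finite[OF finite_ball]])
  ultimately show ?thesis by (rule countable_subset)
qed

lemma countable_cayley_edges: "countable (cayley_edges G S)"
proof -
  have "cayley_edges G S \<subseteq> (\<lambda>(g, s). {g, g \<otimes> s}) ` (carrier G \<times> S)"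
  proof
    fix e assume "e \<in> cayley_edges G S"
    then obtain g s where "e = {g, g \<otimes> s}" "g \<in> carrier G" "s \<in> S" unfolding cayley_edges_def by blast
    then show "e \<in> (\<lambda>(g, s). {g, g \<otimes> s}) ` (carrier G \<times> S)" by (intro image_eqI[of _ _ "(g, s)"]) auto
  qed
  moreover have "countable ((\<lambda>(g, s). {g, g \<otimes> s}) ` (carrier G \<times> S))"
    by (intro countable_image countable_SIGMA countable_carrier countable_finite finite_S)
  ultimately show ?thesis by (rule countable_subset)
qed

end

section \<open>Geodesics in a typical environment\<close>

text \<open>The two truncated differences add up to the distance of \<open>i\<close> and
  \<open>k\<close>. The bound, twice a full geometric series, is uniform in \<open>n\<close> and
  \<open>k\<close>.\<close>

lemma sum_two_sided_geometric:
  fixes r :: real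
  assumes "0 < r" "r < 1"
  shows "(\<Sum>i<n. r ^ ((i - k) + (k - i))) \<le> 2 / (1 - r)"
proof -
  have geo: "(\<Sum>i<m. r ^ i) \<le> 1 / (1 - r)" for m
    using assms by (simp add: geometric_sum divide_simps) (simp add: field_simps)
  \<comment> \<open>The range is extended so that it can be split at \<open>k\<close> even if
    \<open>k\<close> exceeds \<open>n\<close>.\<close>
  have "(\<Sum>i<n. r ^ ((i - k) + (k - i))) \<le> (\<Sum>i<k + n. r ^ ((i - k) + (k - i)))"
    using assms by (intro sum_mono2) auto
  also have "\<dots> = (\<Sum>i<k. r ^ ((i - k) + (k - i))) + (\<Sum>i=k..<k + n. r ^ ((i - k) + (k - i)))"
    unfolding lessThan_atLeast0 by (rule sum.atLeastLessThan_concat[symmetric]) auto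
  also have "(\<Sum>i<k. r ^ ((i - k) + (k - i))) = (\<Sum>i<k. r ^ (Suc i))"
    by (subst sum.nat_diff_reindex[symmetric]) (intro sum.cong, auto)
  also have "\<dots> \<le> (\<Sum>i<k. r ^ i)" using assms by (intro sum_mono) (simp add: mult_left_le_one_le)
  also have "(\<Sum>i=k..<k + n. r ^ ((i - k) + (k - i))) = (\<Sum>i<n. r ^ i)"
    by (subst sum.atLeastLessThan_shift_0) (simp add: lessThan_atLeast0)
  finally show ?thesis using geo[of k] geo[of n] by simp
qed

context hyperbolic_cayley
begin

section \<open>Geodesics for nonnegative weights\<close>

abbreviation weight_nonneg :: "('a set \<Rightarrow> real) \<Rightarrow> bool" where
  "weight_nonneg \<omega> \<equiv> \<forall>e\<in>cayley_edges G S. 0 \<le> \<omega> e"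

text \<open>Nonnegative weights make the weights of walks bounded below; otherwise the infimum in
  \<open>fpp_dist\<close> would be unspecified.\<close>

lemma fpp_geodesic_iff:
  assumes "weight_nonneg \<omega>"
  shows "fpp_geodesic G S \<omega> x y p \<longleftrightarrow>
    walk_between \<Gamma> x y p \<and> (\<forall>q. walk_between \<Gamma> x y q \<longrightarrow> path_weight \<omega> p \<le> path_weight \<omega> q)"
proof -
  have bdd: "bdd_below (path_weight \<omega> ` {p. walk_between \<Gamma> x y p})"
    unfolding path_weight_def using assms
    by (intro bdd_belowI2[of _ 0] sum_list_nonneg) (auto simp: walk_between_def)
  show ?thesis
  proof
    assume "fpp_geodesic G S \<omega> x y p"
    then show "walk_between \<Gamma> x y p \<and> (\<forall>q. walk_between \<Gamma> x y q \<longrightarrow> path_weight \<omega> p \<le> path_weight \<omega> q)"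
      unfolding fpp_geodesic_def fpp_dist_def using cINF_lower[OF bdd] by auto
  next
    assume p: "walk_between \<Gamma> x y p \<and> (\<forall>q. walk_between \<Gamma> x y q \<longrightarrow> path_weight \<omega> p \<le> path_weight \<omega> q)"
    then have "fpp_dist G S \<omega> x y = path_weight \<omega> p"
      unfolding fpp_dist_def by (intro antisym cINF_lower[OF bdd] cINF_greatest) auto
    then show "fpp_geodesic G S \<omega> x y p" using p by (simp add: fpp_geodesic_def)
  qed
qed

lemma fpp_geodesic_walk: "fpp_geodesic G S \<omega> x y p \<Longrightarrow> walk_between \<Gamma> x y p"
  by (simp add: fpp_geodesic_def)

lemma fpp_geodesic_rev:
  assumes "weight_nonneg \<omega>" "fpp_geodesic G S \<omega> x y p" shows "fpp_geodesic G S \<omega> y x (rev p)"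
  using assms walk_between_rev[of \<Gamma>] unfolding fpp_geodesic_iff[OF assms(1)]
  by (metis path_weight_rev)

lemma walk_split_weight:
  assumes "i < length p"
  shows "path_weight \<omega> p = path_weight \<omega> (take (Suc i) p) + path_weight \<omega> (drop i p)"
proof -
  have "last (take (Suc i) p) = hd (drop i p)" using assms by (simp add: take_Suc_conv_app_nth hd_drop_conv_nth)
  then show ?thesis using path_weight_join[of "take (Suc i) p" "drop i p" \<omega>] take_join_drop[OF assms] assms
    by (cases p) auto
qed

lemma fpp_geodesic_take:
  assumes "weight_nonneg \<omega>" "fpp_geodesic G S \<omega> x y p" "i < length p"
  shows "fpp_geodesic G S \<omega> x (p ! i) (take (Suc i) p)"
  unfolding fpp_geodesic_iff[OF assms(1)]
proof (intro conjI allI impI)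
  have p: "walk_between \<Gamma> x y p" "\<And>q. walk_between \<Gamma> x y q \<Longrightarrow> path_weight \<omega> p \<le> path_weight \<omega> q"
    using assms fpp_geodesic_iff by auto
  show "walk_between \<Gamma> x (p ! i) (take (Suc i) p)" by (rule walk_between_take[OF p(1) assms(3)])
  fix q assume q: "walk_between \<Gamma> x (p ! i) q"
  note d = walk_between_drop[OF p(1) assms(3)]
  have "path_weight \<omega> p \<le> path_weight \<omega> q + path_weight \<omega> (drop i p)"
    using p(2)[OF walk_between_join[OF q d]] path_weight_join[of q "drop i p" \<omega>]
      walk_between_ends[OF q] walk_between_ends[OF d] by simp
  then show "path_weight \<omega> (take (Suc i) p) \<le> path_weight \<omega> q"
    using walk_split_weight[OF assms(3), of \<omega>] by simp
qed

lemma fpp_geodesic_drop: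
  assumes "weight_nonneg \<omega>" "fpp_geodesic G S \<omega> x y p" "i < length p"
  shows "fpp_geodesic G S \<omega> (p ! i) y (drop i p)"
proof -
  define j where "j = length p - 1 - i"
  have j: "j < length (rev p)" "rev p ! j = p ! i" "rev (take (Suc j) (rev p)) = drop i p"
    using assms(3) by (auto simp: j_def rev_nth take_rev)
  show ?thesis
    using fpp_geodesic_rev[OF assms(1) fpp_geodesic_take[OF assms(1) fpp_geodesic_rev[OF assms(1,2)] j(1)]] j
    by simp
qed

text \<open>When all weights are positive, loop erasure strictly lowers the weight of a path as soon
  as it removes an edge.\<close>

lemma fpp_geodesic_distinct:
  assumes "\<forall>e\<in>cayley_edges G S. 0 < \<omega> e" "fpp_geodesic G S \<omega> x y p"
  shows "distinct p"
proof -
  have nn: "weight_nonneg \<omega>" using assms(1) less_imp_le by blast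
  have p: "walk_between \<Gamma> x y p" "\<And>q. walk_between \<Gamma> x y q \<Longrightarrow> path_weight \<omega> p \<le> path_weight \<omega> q"
    using assms fpp_geodesic_iff[OF nn] by auto
  obtain q where q: "walk_between \<Gamma> x y q" "distinct q" "set q \<subseteq> set p" "subseq (path_edges q) (path_edges p)"
    using walk_between_shorten[OF p(1)] by metis
  have "\<not> length (path_edges q) < length (path_edges p)"
    using sum_list_subseq_less[OF q(4), of \<omega>] p(2)[OF q(1)] assms(1) p(1)
    by (auto simp: path_weight_def walk_between_def)
  then have "length p \<le> length q" using walk_between_ends(1)[OF p(1)] walk_between_ends(1)[OF q(1)]
    by (cases p; cases q) auto
  \<comment> \<open>\<open>q\<close> is at least as long as \<open>p\<close>, its entries are all
    different and all taken from \<open>p\<close>, so \<open>p\<close> cannot repeat any.\<close>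
  moreover have "card (set q) = length q" "card (set q) \<le> card (set p)" "card (set p) \<le> length p"
    using distinct_card[OF q(2)] card_mono[OF finite_set q(3)] card_length[of p] by simp_all
  ultimately show ?thesis by (simp add: card_distinct)
qed

text \<open>Self-avoiding paths are controlled only if they start no further from \<open>\<one>\<close> than they are long,
  since the number of these is exponential in the length, as the union bound needs.\<close>

definition typical :: "('a set \<Rightarrow> real) \<Rightarrow> bool" where
  "typical \<omega> \<longleftrightarrow> (\<forall>e\<in>cayley_edges G S. 0 < \<omega> e) \<and>
    (\<exists>A B. \<forall>u\<in>carrier G. \<exists>p. walk_between \<Gamma> \<one> u p \<and> path_weight \<omega> p \<le> A * wlen u + B) \<and>
    (\<exists>\<epsilon>>0. \<exists>B. \<forall>n. \<forall>p\<in>paths_near n. \<epsilon> * real n - B \<le> path_weight \<omega> p) \<and>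
    (\<forall>x y p q. walk_between \<Gamma> x y p \<and> distinct p \<and> walk_between \<Gamma> x y q \<and> distinct q \<and> p \<noteq> q \<longrightarrow>
      path_weight \<omega> p \<noteq> path_weight \<omega> q)"

lemma typical_pos: "typical \<omega> \<Longrightarrow> \<forall>e\<in>cayley_edges G S. 0 < \<omega> e"
  by (simp add: typical_def)

lemma typical_nonneg: "typical \<omega> \<Longrightarrow> weight_nonneg \<omega>"
  using typical_pos less_imp_le by blast

text \<open>A long subpath is heavy, while the detour through \<open>\<one>\<close> is light if its ends are close to \<open>\<one>\<close>.\<close>

lemma typical_linear_escape:
  assumes "typical \<omega>"
  obtains c B where "0 < c" "\<And>x y p i k. fpp_geodesic G S \<omega> x y p \<Longrightarrow> i < length p \<Longrightarrow> k < length p \<Longrightarrow>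
      wlen (p ! k) \<le> wlen (p ! i) \<Longrightarrow> c * real ((i - k) + (k - i)) - B \<le> wlen (p ! i)"
proof -
  note nn = typical_nonneg[OF assms]
  obtain A B where "\<forall>u\<in>carrier G. \<exists>p. walk_between \<Gamma> \<one> u p \<and> path_weight \<omega> p \<le> A * wlen u + B"
    using assms unfolding typical_def by metis
  \<comment> \<open>\<open>A\<close> is raised to at least 1 so that inequalities may be multiplied
    and divided by it.\<close>
  then have "\<exists>p. walk_between \<Gamma> \<one> u p \<and> path_weight \<omega> p \<le> max A 1 * wlen u + B" if "u \<in> carrier G" for u
    using that mult_right_mono[OF max.cobounded1[of A 1] nonneg[of \<one> u]] by fastforce
  then obtain A where A: "1 \<le> A"
    "\<And>u. u \<in> carrier G \<Longrightarrow> \<exists>p. walk_between \<Gamma> \<one> u p \<and> path_weight \<omega> p \<le> A * wlen u + B"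
    by (metis max.cobounded2)
  obtain \<epsilon> B' where \<epsilon>: "0 < \<epsilon>" "\<And>n p. p \<in> paths_near n \<Longrightarrow> \<epsilon> * real n - B' \<le> path_weight \<omega> p"
    using assms unfolding typical_def by metis
  \<comment> \<open>A geodesic subpath of length \<open>L\<close> with both ends within
    \<open>f\<close> of \<open>\<one>\<close> satisfies
    \<open>\<epsilon> * L - B' \<le> 2 * A * f + 2 * B\<close> by comparison with the detour,
    provided it falls under the lower bound; solving for \<open>f\<close> gives both constants. The
    minimum with 1 makes the claim trivial for \<open>L \<le> f\<close>.\<close>
  define c where "c = min 1 (\<epsilon> / (2 * A))"
  define D where "D = max 0 ((B' + 2 * B) / (2 * A))"
  have c: "0 < c" "c \<le> 1" "c * (2 * A) \<le> \<epsilon>" using A \<epsilon> by (auto simp: c_def min_def field_simps)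
  have D: "0 \<le> D" "B' + 2 * B \<le> D * (2 * A)" using A by (auto simp: D_def max_def field_simps)
  have forw: "c * real (j - i) - D \<le> max (wlen (p ! i)) (wlen (p ! j))"
    if p: "fpp_geodesic G S \<omega> x y p" and ij: "i \<le> j" "j < length p" for x y p i j
  proof -
    define f where "f = max (wlen (p ! i)) (wlen (p ! j))"
    define q where "q = take (Suc (j - i)) (drop i p)"
    have "fpp_geodesic G S \<omega> (p ! i) (drop i p ! (j - i)) q"
      unfolding q_def using ij by (intro fpp_geodesic_take[OF nn fpp_geodesic_drop[OF nn p]]) auto
    then have q: "fpp_geodesic G S \<omega> (p ! i) (p ! j) q" using ij by simp
    have len: "length q = Suc (j - i)" using ij by (simp add: q_def)
    note w = fpp_geodesic_walk[OF q] and dq = fpp_geodesic_distinct[OF typical_pos[OF assms] q]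
    note we = walk_between_ends[OF w]
    show ?thesis
    proof (cases "real (j - i) \<le> f")
      case True
      have "c * real (j - i) \<le> 1 * real (j - i)" using c by (intro mult_right_mono) auto
      then show ?thesis using True D by (simp add: f_def)
    next
      \<comment> \<open>Now both ends are nearer to \<open>\<one>\<close> than the subpath is long,
        which puts it into \<open>paths_near\<close>.\<close>
      case False
      have "\<exists>q'\<in>{q, rev q}. q' \<in> paths_near (j - i)"
      proof (cases "wlen (p ! i) \<le> real (j - i)")
        case True
        then show ?thesis using w we dq len by (auto simp: paths_near_def)
      next
        case False
        then show ?thesis using \<open>\<not> real (j - i) \<le> f\<close> by (simp add: f_def)
      qed
      then have lower: "\<epsilon> * real (j - i) - B' \<le> path_weight \<omega> q" using \<epsilon>(2) path_weight_rev[of \<omega> q] by (metis insertE singletonD)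
      obtain r s where r: "walk_between \<Gamma> \<one> (p ! i) r" "path_weight \<omega> r \<le> A * wlen (p ! i) + B"
        and s: "walk_between \<Gamma> \<one> (p ! j) s" "path_weight \<omega> s \<le> A * wlen (p ! j) + B"
        using A(2) we(6,7) by (metis cayley_graph_simps(1))
      note rr = walk_between_rev[OF r(1)]
      have "path_weight \<omega> q \<le> path_weight \<omega> (rev r @ tl s)"
        using q walk_between_join[OF rr s(1)] fpp_geodesic_iff[OF nn] by blast
      also have "\<dots> = path_weight \<omega> r + path_weight \<omega> s"
        using walk_between_ends[OF rr] walk_between_ends[OF s(1)]
        by (subst path_weight_join) (auto simp: path_weight_rev)
      also have "\<dots> \<le> A * wlen (p ! i) + A * wlen (p ! j) + 2 * B" using r s by linarith
      also have "\<dots> \<le> A * f + A * f + 2 * B"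
        using A(1) by (intro add_mono mult_left_mono) (auto simp: f_def)
      finally have "\<epsilon> * real (j - i) \<le> f * (2 * A) + D * (2 * A)" using lower D by (simp add: algebra_simps)
      moreover have "c * (2 * A) * real (j - i) \<le> \<epsilon> * real (j - i)" using c by (intro mult_right_mono) auto
      ultimately have "(c * real (j - i)) * (2 * A) \<le> (f + D) * (2 * A)" by (simp add: algebra_simps)
      then show ?thesis using A(1) by (simp add: f_def)
    qed
  qed
  show thesis
  proof (rule that[OF c(1)])
    fix x y p i k
    assume p: "fpp_geodesic G S \<omega> x y p" "i < length p" "k < length p" "wlen (p ! k) \<le> wlen (p ! i)"
    show "c * real ((i - k) + (k - i)) - D \<le> wlen (p ! i)"
      using forw[OF p(1), of i k] forw[OF p(1), of k i] p by (cases "i \<le> k") auto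
  qed
qed

text \<open>The sum in the chain inequality runs over edges, and the ends of an edge have Gromov
  product at least their distance from \<open>\<one>\<close> minus 1. The resulting \<open>N\<close>
  depends on \<open>R\<close> and \<omega>, but not on the geodesic.\<close>

lemma typical_gprod:
  assumes "typical \<omega>"
  obtains N where "\<And>x y p. fpp_geodesic G S \<omega> x y p \<Longrightarrow> (\<And>v. v \<in> set p \<Longrightarrow> N \<le> wlen v) \<Longrightarrow>
    R \<le> gprod X x y"
proof -
  obtain \<eta> where \<eta>: "0 < \<eta>" "\<And>p m n. m < n \<Longrightarrow> p ` {m..n} \<subseteq> carrier G \<Longrightarrow>
    exp (- \<eta> * gprod X (p m) (p n)) \<le> 2 * (\<Sum>i=m..<n. exp (- \<eta> * gprod X (p i) (p (Suc i))))"
    using hyperbolic_space_chain[OF hyperbolic] by (auto simp del: cayley_space_simps(2,3))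
  obtain c B where c: "0 < c" and esc: "\<And>x y p i k. fpp_geodesic G S \<omega> x y p \<Longrightarrow> i < length p \<Longrightarrow> k < length p \<Longrightarrow>
      wlen (p ! k) \<le> wlen (p ! i) \<Longrightarrow> c * real ((i - k) + (k - i)) - B \<le> wlen (p ! i)"
    using typical_linear_escape[OF assms] by metis
  \<comment> \<open>\<open>r\<close> is the ratio of decay that linear escape yields;
    \<open>K\<close> collects the two-sided geometric series, the additive constants and the factor
    2 of the chain inequality.\<close>
  define r where "r = exp (- \<eta> * c / 2)"
  have r: "0 < r" "r < 1" using \<eta> c by (auto simp: r_def)
  define K where "K = 2 * (exp (\<eta> * (1 + B / 2)) * (2 / (1 - r)))"
  have K: "0 < K" using r by (simp add: K_def)
  \<comment> \<open>The first bound serves paths with a single vertex; the second solves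
    \<open>K * exp (- \<eta> * m / 2) \<le> exp (- \<eta> * R)\<close> for \<open>m\<close>.\<close>
  define N where "N = max R (2 * (R + ln K / \<eta>))"
  show thesis
  proof (rule that)
    fix x y p assume p: "fpp_geodesic G S \<omega> x y p" and far: "\<And>v. v \<in> set p \<Longrightarrow> N \<le> wlen v"
    note we = walk_between_ends[OF fpp_geodesic_walk[OF p]]
    define n where "n = length p - 1"
    have n: "length p = Suc n" using we(1) by (cases p) (auto simp: n_def)
    show "R \<le> gprod X x y"
    proof (cases "n = 0")
      case True
      then have "x = y" using we(9,10) by (simp add: n_def)
      then have "gprod X x y = wlen x" using we by (simp add: gromov_product_def)
      then show ?thesis using far[OF we(4)] by (simp add: N_def)
    next
      case False
      define k where "k = arg_min_on (\<lambda>i. wlen (p ! i)) {..n}"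
      have k: "k \<le> n" and kmin: "\<And>i. i \<le> n \<Longrightarrow> wlen (p ! k) \<le> wlen (p ! i)"
        using arg_min_if_finite(1)[of "{..n}" "\<lambda>i. wlen (p ! i)"] arg_min_least[of "{..n}" _ "\<lambda>i. wlen (p ! i)"]
        by (auto simp: k_def)
      define m where "m = wlen (p ! k)"
      have m: "N \<le> m" unfolding m_def using k n by (intro far) simp
      have vert: "p ! i \<in> carrier G" if "i \<le> n" for i using that n we(8) by (auto simp: subset_iff)
      have step: "exp (- \<eta> * gprod X (p ! i) (p ! Suc i))
          \<le> exp (\<eta> * (1 + B / 2)) * exp (- \<eta> * m / 2) * r ^ ((i - k) + (k - i))" if i: "i < n" for i
      proof -
        define L where "L = real ((i - k) + (k - i))"
        have e: "{p ! i, p ! Suc i} \<in> cayley_edges G S"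
          using fpp_geodesic_walk[OF p] i n by (auto simp: walk_between_def set_path_edges)
        have "wlen (p ! i) \<le> wlen (p ! Suc i) + 1" "wd (p ! i) (p ! Suc i) \<le> 1"
          using wlen_edge[OF e] e by (auto elim: cayley_edgeE)
        then have "wlen (p ! i) - 1 \<le> gprod X (p ! i) (p ! Suc i)" by (simp add: gromov_product_def)
        moreover have "m \<le> wlen (p ! i)" unfolding m_def using i by (intro kmin) simp
        moreover have "c * L - B \<le> wlen (p ! i)" unfolding L_def using p i k n kmin by (intro esc) auto
        \<comment> \<open>Averaging the bound by \<open>m\<close> with the linear bound keeps half
          of each: the first makes the sum small, the second bounds it independently of the number
          of edges.\<close>
        ultimately have "m + c * L - B \<le> 2 * gprod X (p ! i) (p ! Suc i) + 2" by linarith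
        then have "(m + c * L - B) / 2 - 1 \<le> gprod X (p ! i) (p ! Suc i)" by (simp add: field_simps)
        then have "- \<eta> * gprod X (p ! i) (p ! Suc i) \<le> - \<eta> * ((m + c * L - B) / 2 - 1)"
          using \<eta>(1) by simp
        also have "\<dots> = \<eta> * (1 + B / 2) + - \<eta> * m / 2 + L * (- \<eta> * c / 2)" by (simp add: field_simps)
        finally show ?thesis
          unfolding r_def exp_of_nat_mult[symmetric] L_def[symmetric] by (simp flip: exp_add)
      qed
      have "exp (- \<eta> * gprod X (p ! 0) (p ! n)) \<le> 2 * (\<Sum>i=0..<n. exp (- \<eta> * gprod X (p ! i) (p ! Suc i)))"
        using False vert by (intro \<eta>(2)) auto
      also have "\<dots> \<le> 2 * (\<Sum>i=0..<n. exp (\<eta> * (1 + B / 2)) * exp (- \<eta> * m / 2) * r ^ ((i - k) + (k - i)))"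
        using step by (intro mult_left_mono sum_mono) auto
      also have "\<dots> = 2 * (exp (\<eta> * (1 + B / 2)) * exp (- \<eta> * m / 2) * (\<Sum>i<n. r ^ ((i - k) + (k - i))))"
        by (simp add: sum_distrib_left lessThan_atLeast0)
      also have "\<dots> \<le> 2 * (exp (\<eta> * (1 + B / 2)) * exp (- \<eta> * m / 2) * (2 / (1 - r)))"
        using sum_two_sided_geometric[OF r] by (intro mult_left_mono) auto
      also have "\<dots> = K * exp (- \<eta> * m / 2)" by (simp add: K_def)
      also have "\<dots> = exp (ln K + - \<eta> * m / 2)" by (simp only: exp_add exp_ln[OF K])
      finally have "\<eta> * m / 2 - ln K \<le> \<eta> * gprod X x y" using we(9,10) by (simp add: n_def)
      moreover have "\<eta> * R + ln K \<le> \<eta> * m / 2"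
        using m \<eta>(1) by (simp add: N_def field_simps)
      ultimately have "\<eta> * R \<le> \<eta> * gprod X x y" by linarith
      then show ?thesis using \<eta>(1) by simp
    qed
  qed
qed

text \<open>The infimum is attained because only finitely many self-avoiding walks compete with a
  given walk \<open>p0\<close>: a sufficiently long one starts near \<open>\<one>\<close> relative
  to its length, hence is heavy.\<close>

lemma typical_geodesic_exists:
  assumes "typical \<omega>" "x \<in> carrier G" "y \<in> carrier G"
  obtains p where "fpp_geodesic G S \<omega> x y p"
proof -
  note nn = typical_nonneg[OF assms(1)]
  obtain \<epsilon> B where \<epsilon>: "0 < \<epsilon>" "\<And>n p. p \<in> paths_near n \<Longrightarrow> \<epsilon> * real n - B \<le> path_weight \<omega> p"
    using assms unfolding typical_def by metis
  obtain p0 where p0: "walk_between \<Gamma> x y p0" using connected[OF assms(2,3)] by blast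
  define P where "P = {p. walk_between \<Gamma> x y p \<and> distinct p \<and> path_weight \<omega> p \<le> path_weight \<omega> p0}"
  \<comment> \<open>A path of more than \<open>M\<close> edges from \<open>x\<close> belongs to
    \<open>paths_near\<close>, and its lower bound exceeds the weight of \<open>p0\<close>.\<close>
  obtain M :: nat where M: "max (wlen x) ((path_weight \<omega> p0 + B) / \<epsilon>) \<le> real M" using real_arch_simple by blast
  have "length p \<le> M + 1" if "p \<in> P" for p
  proof (rule ccontr)
    assume len: "\<not> length p \<le> M + 1"
    define n where "n = length p - 1"
    have n: "length p = Suc n" "M < n" using len by (auto simp: n_def)
    have w: "walk_between \<Gamma> x y p" "distinct p" "path_weight \<omega> p \<le> path_weight \<omega> p0" using that by (auto simp: P_def)
    then have "p \<in> paths_near n" using n M walk_between_ends[OF w(1)] by (auto simp: paths_near_def)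
    then have "\<epsilon> * real n - B \<le> path_weight \<omega> p0" using \<epsilon>(2) w(3) by force
    then have "real n \<le> (path_weight \<omega> p0 + B) / \<epsilon>" using \<epsilon>(1) by (simp add: field_simps)
    then show False using M n by simp
  qed
  then have "P \<subseteq> {p. walk_between \<Gamma> x (last p) p \<and> length p \<le> M + 1}"
    by (auto simp: P_def walk_between_def)
  then have fin: "finite P" using finite_walks_upto finite_subset by blast
  have short: "\<exists>q\<in>P. path_weight \<omega> q \<le> path_weight \<omega> p"
    if p: "walk_between \<Gamma> x y p" "path_weight \<omega> p \<le> path_weight \<omega> p0" for p
  proof -
    obtain q where q: "walk_between \<Gamma> x y q" "distinct q" "subseq (path_edges q) (path_edges p)"
      using walk_between_shorten[OF p(1)] by metis
    have "path_weight \<omega> q \<le> path_weight \<omega> p"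
      unfolding path_weight_def using p(1) nn by (intro sum_list_subseq_le[OF q(3)]) (auto simp: walk_between_def)
    then show ?thesis using q p(2) by (auto simp: P_def)
  qed
  have ne: "P \<noteq> {}" using short[OF p0] by auto
  define p where "p = arg_min_on (path_weight \<omega>) P"
  have p: "p \<in> P" "\<And>q. q \<in> P \<Longrightarrow> path_weight \<omega> p \<le> path_weight \<omega> q"
    using arg_min_if_finite(1)[OF fin ne] arg_min_least[OF fin ne] by (auto simp: p_def)
  have "path_weight \<omega> p \<le> path_weight \<omega> q" if q: "walk_between \<Gamma> x y q" for q
  proof (cases "path_weight \<omega> q \<le> path_weight \<omega> p0")
    case True
    then show ?thesis using short[OF q] p(2) by force
  next
    case False
    then show ?thesis using p(1) by (simp add: P_def)
  qed
  then have "fpp_geodesic G S \<omega> x y p" using p(1) by (simp add: fpp_geodesic_iff[OF nn] P_def)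
  then show thesis using that by blast
qed

lemma typical_geodesic_unique:
  assumes "typical \<omega>" "fpp_geodesic G S \<omega> x y p" "fpp_geodesic G S \<omega> x y q" shows "p = q"
proof (rule ccontr)
  assume "p \<noteq> q"
  then have "path_weight \<omega> p \<noteq> path_weight \<omega> q"
    using assms fpp_geodesic_distinct[OF typical_pos[OF assms(1)]] fpp_geodesic_walk unfolding typical_def by metis
  then show False using assms by (simp add: fpp_geodesic_def)
qed

end

section \<open>Almost every environment is typical\<close>

lemma indep_vars_PiM_coordinates:
  assumes "\<And>i. i \<in> I \<Longrightarrow> prob_space (M i)"
  shows "prob_space.indep_vars (PiM I M) M (\<lambda>i \<omega>. \<omega> i) I"
proof -
  interpret prob_space "PiM I M" by (intro prob_space_PiM assms)
  show ?thesis
  proof (cases "I = {}")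
    case False
    have "distr (PiM I M) (PiM I M) (\<lambda>x. \<lambda>i\<in>I. x i) = distr (PiM I M) (PiM I M) (\<lambda>x. x)"
      by (intro distr_cong) (auto simp: space_PiM PiE_def extensional_def restrict_def fun_eq_iff)
    also have "\<dots> = (\<Pi>\<^sub>M i\<in>I. distr (PiM I M) (M i) (\<lambda>\<omega>. \<omega> i))"
      by (simp add: distr_PiM_component assms cong: PiM_cong)
    finally show ?thesis using False by (subst indep_vars_iff_distr_eq_PiM') auto
  qed (unfold indep_vars_def2 indep_sets_def, simp)
qed

text \<open>A substitute for the Borel-Cantelli lemma that directly yields a uniform random constant: the
  sum of all the variables has finite expectation.\<close>

lemma AE_bounded_family:
  fixes Y :: "nat \<Rightarrow> 'i \<Rightarrow> 'a \<Rightarrow> real"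
  assumes fin: "\<And>n. finite (F n)" and card: "\<And>n. card (F n) \<le> k ^ n"
    and [measurable]: "\<And>n p. p \<in> F n \<Longrightarrow> Y n p \<in> borel_measurable M"
    and int: "\<And>n p. p \<in> F n \<Longrightarrow> (\<integral>\<^sup>+x. ennreal (Y n p x) \<partial>M) \<le> ennreal (q ^ n)"
    and q: "0 \<le> q" "real k * q < 1"
  shows "AE x in M. \<exists>Z. \<forall>n. \<forall>p\<in>F n. Y n p x \<le> Z"
proof -
  have "(\<integral>\<^sup>+x. (\<Sum>n. \<Sum>p\<in>F n. ennreal (Y n p x)) \<partial>M) = (\<Sum>n. \<Sum>p\<in>F n. \<integral>\<^sup>+x. ennreal (Y n p x) \<partial>M)"
    by (subst nn_integral_suminf) (auto intro!: suminf_cong nn_integral_sum)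
  also have "\<dots> \<le> (\<Sum>n. ennreal ((real k * q) ^ n))"
  proof (intro suminf_le)
    fix n
    have "(\<Sum>p\<in>F n. \<integral>\<^sup>+x. ennreal (Y n p x) \<partial>M) \<le> (\<Sum>p\<in>F n. ennreal (q ^ n))"
      by (intro sum_mono int)
    also have "\<dots> = ennreal (real (card (F n)) * q ^ n)"
      using q by (simp add: ennreal_mult ennreal_of_nat_eq_real_of_nat)
    also have "\<dots> \<le> ennreal (real (k ^ n) * q ^ n)"
      using q card by (intro ennreal_leI mult_right_mono of_nat_mono) auto
    finally show "(\<Sum>p\<in>F n. \<integral>\<^sup>+x. ennreal (Y n p x) \<partial>M) \<le> ennreal ((real k * q) ^ n)"
      by (simp add: power_mult_distrib)
  qed auto
  also have "\<dots> = ennreal (\<Sum>n. (real k * q) ^ n)"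
    using q by (intro suminf_ennreal2) (auto intro: summable_geometric)
  also have "\<dots> < \<infinity>" by simp
  finally have "(\<integral>\<^sup>+x. (\<Sum>n. \<Sum>p\<in>F n. ennreal (Y n p x)) \<partial>M) \<noteq> \<infinity>" by simp
  then have "AE x in M. (\<Sum>n. \<Sum>p\<in>F n. ennreal (Y n p x)) \<noteq> \<infinity>"
    by (intro nn_integral_PInf_AE) measurable
  then show ?thesis
  proof eventually_elim
    case (elim x)
    define Z where "Z = (\<Sum>n. \<Sum>p\<in>F n. ennreal (Y n p x))"
    have "Y n p x \<le> enn2real Z" if p: "p \<in> F n" for n p
    proof -
      have "ennreal (Y n p x) \<le> (\<Sum>p\<in>F n. ennreal (Y n p x))"
        using fin p by (intro member_le_sum) auto
      also have "\<dots> = (\<Sum>n\<in>{n}. \<Sum>p\<in>F n. ennreal (Y n p x))" by simp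
      also have "\<dots> \<le> Z" unfolding Z_def by (intro sum_le_suminf) auto
      finally have "ennreal (Y n p x) \<le> ennreal (enn2real Z)" using elim by (simp add: Z_def less_top)
      then show ?thesis using ennreal_le_iff[OF enn2real_nonneg] by blast
    qed
    then show ?case by blast
  qed
qed

locale iid_weights = prob_space \<rho> for \<rho> :: "real measure" +
  fixes E :: "'e set"
  assumes sets_\<rho>: "sets \<rho> = sets (restrict_space borel {0..})"
    and no_atoms: "\<And>x. 0 \<le> x \<Longrightarrow> emeasure \<rho> {x} = 0"
begin

abbreviation "\<P> \<equiv> PiM E (\<lambda>_. \<rho>)"

lemma space_\<rho>: "space \<rho> = {0..}"
  using sets_eq_imp_space_eq[OF sets_\<rho>] by (simp add: space_restrict_space)

lemma measurable_\<rho> [measurable]: "(\<lambda>x. x) \<in> borel_measurable \<rho>"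
  unfolding measurable_cong_sets[OF sets_\<rho> refl] by (intro measurable_restrict_space1) simp

lemma borel_measurable_\<rho> [measurable (raw)]: "f \<in> borel_measurable borel \<Longrightarrow> f \<in> borel_measurable \<rho>"
  using measurable_compose[OF measurable_\<rho>] by simp

lemma measurable_coordinate [measurable]: "e \<in> E \<Longrightarrow> (\<lambda>\<omega>. \<omega> e) \<in> borel_measurable \<P>"
  using measurable_compose[OF measurable_component_singleton[of e E "\<lambda>_. \<rho>"] measurable_\<rho>] by simp

lemma AE_\<rho>_neq: "AE x in \<rho>. x \<noteq> c"
proof (cases "0 \<le> c")
  case True
  have "{c} \<in> sets \<rho>" using True by (auto simp: sets_\<rho> sets_restrict_space intro!: image_eqI[of _ _ "{c}"])
  then have "{c} \<in> null_sets \<rho>" using no_atoms[OF True] by auto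
  then show ?thesis by (auto dest: AE_not_in)
next
  case False
  then show ?thesis by (intro AE_I2) (auto simp: space_\<rho>)
qed

lemma AE_coordinate_pos: "e \<in> E \<Longrightarrow> AE \<omega> in \<P>. 0 < \<omega> e"
proof (rule AE_PiM_component)
  have "AE x in \<rho>. 0 \<le> x" by (intro AE_I2) (simp add: space_\<rho>)
  then show "AE x in \<rho>. 0 < x" using AE_\<rho>_neq[of 0] by eventually_elim auto
qed (auto intro: prob_space_axioms)

lemma prob_space_\<P>: "prob_space \<P>"
  by (intro prob_space_PiM prob_space_axioms)

lemma nn_integral_exp_sum:
  assumes "finite J" "J \<subseteq> E"
  shows "(\<integral>\<^sup>+\<omega>. ennreal (exp (t * (\<Sum>e\<in>J. \<omega> e))) \<partial>\<P>) = (\<integral>\<^sup>+x. ennreal (exp (t * x)) \<partial>\<rho>) ^ card J"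
proof -
  interpret \<P>: prob_space \<P> by (rule prob_space_\<P>)
  have "\<P>.indep_vars (\<lambda>_. \<rho>) (\<lambda>i \<omega>. \<omega> i) J"
    by (rule \<P>.indep_vars_subset[OF indep_vars_PiM_coordinates assms(2)]) (rule prob_space_axioms)
  then have ind: "\<P>.indep_vars (\<lambda>_. borel) (\<lambda>i \<omega>. ennreal (exp (t * \<omega> i))) J"
    by (rule \<P>.indep_vars_compose2) measurable
  have "(\<integral>\<^sup>+\<omega>. ennreal (exp (t * (\<Sum>e\<in>J. \<omega> e))) \<partial>\<P>) = (\<integral>\<^sup>+\<omega>. (\<Prod>e\<in>J. ennreal (exp (t * \<omega> e))) \<partial>\<P>)"
    using assms(1) by (simp add: sum_distrib_left exp_sum prod_ennreal)
  also have "\<dots> = (\<Prod>e\<in>J. \<integral>\<^sup>+\<omega>. ennreal (exp (t * \<omega> e)) \<partial>\<P>)"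
    by (rule \<P>.indep_vars_nn_integral[OF assms(1) ind]) simp
  also have "\<dots> = (\<Prod>e\<in>J. \<integral>\<^sup>+x. ennreal (exp (t * x)) \<partial>\<rho>)"
  proof (rule prod.cong[OF refl])
    fix e assume "e \<in> J"
    then have e: "e \<in> E" using assms(2) by blast
    have "(\<integral>\<^sup>+x. ennreal (exp (t * x)) \<partial>\<rho>) = (\<integral>\<^sup>+x. ennreal (exp (t * x)) \<partial>distr \<P> \<rho> (\<lambda>\<omega>. \<omega> e))"
      using distr_PiM_component[of E "\<lambda>_. \<rho>" e] e prob_space_axioms by simp
    also have "\<dots> = (\<integral>\<^sup>+\<omega>. ennreal (exp (t * \<omega> e)) \<partial>\<P>)"
      by (rule nn_integral_distr) (use e in measurable)
    finally show "(\<integral>\<^sup>+\<omega>. ennreal (exp (t * \<omega> e)) \<partial>\<P>) = (\<integral>\<^sup>+x. ennreal (exp (t * x)) \<partial>\<rho>)" by simp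
  qed
  finally show ?thesis by simp
qed

text \<open>With all coordinates but \<open>e\<close> fixed, equality forces the weight of
  \<open>e\<close> to be one particular number, which has probability 0 as \<rho> has no atoms.
  Since this coordinate is independent of the others, Fubini's theorem for the joint law
  concludes.\<close>

lemma AE_sum_neq_aux:
  assumes "finite J" "finite K" "J \<subseteq> E" "K \<subseteq> E" and e: "e \<in> J" "e \<notin> K"
  shows "AE \<omega> in \<P>. (\<Sum>i\<in>J. \<omega> i) \<noteq> (\<Sum>i\<in>K. \<omega> i)"
proof -
  interpret \<P>: prob_space \<P> by (rule prob_space_\<P>)
  \<comment> \<open>The coefficient of a coordinate is 1, 0 or -1 if it belongs to \<open>J\<close>
    only, to both sets, or to \<open>K\<close> only; for \<open>e\<close> it is 1.\<close>
  define Y where "Y = (\<lambda>i x. (if i \<in> J then x else 0) - (if i \<in> K then x else (0::real)))"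
  define L where "L = J \<union> K - {e}"
  define R where "R = (\<lambda>\<omega>. \<Sum>i\<in>L. Y i (\<omega> i))"
  have "\<P>.indep_vars (\<lambda>_. \<rho>) (\<lambda>i \<omega>. \<omega> i) (insert e L)"
    by (rule \<P>.indep_vars_subset[OF indep_vars_PiM_coordinates])
      (use assms prob_space_axioms in \<open>auto simp: L_def\<close>)
  then have "\<P>.indep_vars (\<lambda>_. borel) (\<lambda>i \<omega>. Y i (\<omega> i)) (insert e L)"
    by (rule \<P>.indep_vars_compose2) (auto simp: Y_def)
  then have "\<P>.indep_var borel (\<lambda>\<omega>. Y e (\<omega> e)) borel R"
    unfolding R_def using assms by (intro \<P>.indep_vars_sum) (auto simp: L_def)
  moreover have Ye: "(\<lambda>\<omega>. Y e (\<omega> e)) = (\<lambda>\<omega>. \<omega> e)" using e by (simp add: Y_def)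
  ultimately have ind: "\<P>.indep_var borel (\<lambda>\<omega>. \<omega> e) borel R" by simp
  then have [measurable]: "(\<lambda>\<omega>. \<omega> e) \<in> borel_measurable \<P>" "R \<in> borel_measurable \<P>"
    and pair: "distr \<P> borel (\<lambda>\<omega>. \<omega> e) \<Otimes>\<^sub>M distr \<P> borel R = distr \<P> (borel \<Otimes>\<^sub>M borel) (\<lambda>\<omega>. (\<omega> e, R \<omega>))"
    unfolding \<P>.indep_var_distribution_eq by auto
  interpret D1: prob_space "distr \<P> borel (\<lambda>\<omega>. \<omega> e)" by (rule \<P>.prob_space_distr) measurable
  interpret D2: prob_space "distr \<P> borel R" by (rule \<P>.prob_space_distr) measurable
  interpret D: pair_sigma_finite "distr \<P> borel (\<lambda>\<omega>. \<omega> e)" "distr \<P> borel R" ..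
  have "AE x in distr \<P> borel (\<lambda>\<omega>. \<omega> e). x + y \<noteq> 0" for y
  proof -
    have "AE \<omega> in \<P>. \<omega> e \<noteq> - y"
      by (rule AE_PiM_component) (use assms prob_space_axioms AE_\<rho>_neq in auto)
    then have "AE \<omega> in \<P>. \<omega> e + y \<noteq> 0" by eventually_elim auto
    then show ?thesis by (subst AE_distr_iff) auto
  qed
  moreover have "Measurable.pred (borel \<Otimes>\<^sub>M borel) (\<lambda>z :: real \<times> real. fst z + snd z \<noteq> 0)" by measurable
  then have ms: "{z \<in> space (distr \<P> borel (\<lambda>\<omega>. \<omega> e) \<Otimes>\<^sub>M distr \<P> borel R). fst z + snd z \<noteq> 0}
      \<in> sets (distr \<P> borel (\<lambda>\<omega>. \<omega> e) \<Otimes>\<^sub>M distr \<P> borel R)"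
    by (simp add: pred_def space_pair_measure cong: sets_pair_measure_cong)
  ultimately have "AE y in distr \<P> borel R. AE x in distr \<P> borel (\<lambda>\<omega>. \<omega> e). x + y \<noteq> 0" by simp
  then have "AE x in distr \<P> borel (\<lambda>\<omega>. \<omega> e). AE y in distr \<P> borel R. x + y \<noteq> 0"
    by (subst D.AE_commute[OF ms])
  then have "AE z in distr \<P> borel (\<lambda>\<omega>. \<omega> e) \<Otimes>\<^sub>M distr \<P> borel R. fst z + snd z \<noteq> 0"
    by (intro D.AE_pair_measure ms) simp
  then have "AE \<omega> in \<P>. \<omega> e + R \<omega> \<noteq> 0"
    unfolding pair by (subst (asm) AE_distr_iff) auto
  moreover have "\<omega> e + R \<omega> = (\<Sum>i\<in>J. \<omega> i) - (\<Sum>i\<in>K. \<omega> i)" for \<omega>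
  proof -
    have fin: "finite (J \<union> K)" using assms by simp
    have "\<omega> e + R \<omega> = (\<Sum>i\<in>J \<union> K. Y i (\<omega> i))"
      unfolding R_def L_def using sum.remove[OF fin, of e "\<lambda>i. Y i (\<omega> i)"] e by (simp add: Y_def)
    also have "\<dots> = (\<Sum>i\<in>J \<union> K. if i \<in> J then \<omega> i else 0) - (\<Sum>i\<in>J \<union> K. if i \<in> K then \<omega> i else 0)"
      by (simp add: Y_def sum_subtractf)
    also have "\<dots> = (\<Sum>i\<in>(J \<union> K) \<inter> J. \<omega> i) - (\<Sum>i\<in>(J \<union> K) \<inter> K. \<omega> i)"
      by (simp only: sum.inter_restrict[OF fin])
    also have "\<dots> = (\<Sum>i\<in>J. \<omega> i) - (\<Sum>i\<in>K. \<omega> i)" by (simp add: Int_absorb1)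
    finally show ?thesis .
  qed
  ultimately show ?thesis by simp
qed

lemma AE_sum_neq:
  assumes "finite J" "finite K" "J \<subseteq> E" "K \<subseteq> E" "J \<noteq> K"
  shows "AE \<omega> in \<P>. (\<Sum>i\<in>J. \<omega> i) \<noteq> (\<Sum>i\<in>K. \<omega> i)"
proof -
  consider e where "e \<in> J" "e \<notin> K" | e where "e \<in> K" "e \<notin> J" using assms(5) by blast
  then show ?thesis
  proof cases
    case 1
    then show ?thesis using AE_sum_neq_aux assms by blast
  next
    case 2
    then have "AE \<omega> in \<P>. (\<Sum>i\<in>K. \<omega> i) \<noteq> (\<Sum>i\<in>J. \<omega> i)" using AE_sum_neq_aux assms by blast
    then show ?thesis by eventually_elim auto
  qed
qed

text \<open>By dominated convergence the Laplace transform tends to the mass of 0, which vanishes.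
  It has to outweigh an exponential number of paths, so it must get below every positive
  level.\<close>

lemma small_laplace_transform:
  assumes "0 < c"
  obtains s q where "0 < s" "0 \<le> q" "q < c" "(\<integral>\<^sup>+x. ennreal (exp (- s * x)) \<partial>\<rho>) = ennreal q"
proof -
  have pos: "AE x in \<rho>. 0 < x"
    using AE_\<rho>_neq[of 0] AE_space by eventually_elim (auto simp: space_\<rho>)
  have "(\<lambda>i. \<integral>\<^sup>+x. ennreal (exp (- real i * x)) \<partial>\<rho>) \<longlonglongrightarrow> (\<integral>\<^sup>+x. 0 \<partial>\<rho>)"
  proof (rule nn_integral_dominated_convergence[where w = "\<lambda>_. 1"])
    show "AE x in \<rho>. ennreal (exp (- real i * x)) \<le> 1" for i
      using pos by eventually_elim (simp add: ennreal_le_1)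
    show "AE x in \<rho>. (\<lambda>i. ennreal (exp (- real i * x))) \<longlonglongrightarrow> 0"
      using pos
    proof eventually_elim
      case (elim x)
      have "(\<lambda>i. exp (- x) ^ i) \<longlonglongrightarrow> 0" using elim by (intro LIMSEQ_power_zero) simp
      moreover have "exp (- x) ^ i = exp (- real i * x)" for i by (simp add: exp_of_nat_mult[symmetric])
      ultimately have "(\<lambda>i. exp (- real i * x)) \<longlonglongrightarrow> 0" by simp
      then show ?case using tendsto_ennrealI by fastforce
    qed
    show "(\<integral>\<^sup>+ x. 1 \<partial>\<rho>) < \<infinity>" by (simp add: emeasure_space_1)
  qed auto
  then have "eventually (\<lambda>i. (\<integral>\<^sup>+x. ennreal (exp (- real i * x)) \<partial>\<rho>) < ennreal c) sequentially"
    by (rule order_tendstoD) (use assms in simp)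
  then have "eventually (\<lambda>i. 0 < i \<and> (\<integral>\<^sup>+x. ennreal (exp (- real i * x)) \<partial>\<rho>) < ennreal c) sequentially"
    using eventually_gt_at_top[of 0] by eventually_elim auto
  then obtain i where i: "0 < i" "(\<integral>\<^sup>+x. ennreal (exp (- real i * x)) \<partial>\<rho>) < ennreal c"
    using eventually_happens'[OF sequentially_bot] by blast
  define q where "q = enn2real (\<integral>\<^sup>+x. ennreal (exp (- real i * x)) \<partial>\<rho>)"
  have q: "(\<integral>\<^sup>+x. ennreal (exp (- real i * x)) \<partial>\<rho>) = ennreal q"
    using i(2) unfolding q_def by (metis ennreal_enn2real ennreal_less_top order_less_trans)
  have "0 \<le> q" by (simp add: q_def)
  moreover have "q < c" using i(2) \<open>0 \<le> q\<close> unfolding q by (simp add: ennreal_less_iff)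
  ultimately show thesis using that[of "real i" q] i(1) q by simp
qed

end

section \<open>Growth bounds and distinct path weights hold almost surely\<close>

locale fpp_environment = hyperbolic_cayley G S
  for G :: "('a, 'b) monoid_scheme" (structure) and S :: "'a set" +
  fixes \<rho> :: "real measure"
  assumes iid: "iid_weights \<rho>"
    and exp_moment: "\<exists>a>0. (\<integral>\<^sup>+ x. ennreal (exp (a * x)) \<partial>\<rho>) < \<infinity>"
begin

sublocale iid_weights \<rho> "cayley_edges G S" by (rule iid)

lemma path_weight_distinct: "distinct p \<Longrightarrow> path_weight \<omega> p = (\<Sum>e\<in>set (path_edges p). \<omega> e)"
  by (simp add: path_weight_def sum_list_distinct_conv_sum_set distinct_path_edges)

lemma walk_edges: "walk_between \<Gamma> x y p \<Longrightarrow> set (path_edges p) \<subseteq> cayley_edges G S"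
  by (simp add: walk_between_def)

lemma path_weight_measurable:
  assumes "walk_between \<Gamma> x y p" shows "(\<lambda>\<omega>. path_weight \<omega> p) \<in> borel_measurable \<P>"
proof -
  have "(\<lambda>\<omega>. sum_list (map \<omega> es)) \<in> borel_measurable \<P>" if "set es \<subseteq> cayley_edges G S" for es
    using that by (induction es) (auto intro!: borel_measurable_add measurable_coordinate)
  then show ?thesis using walk_edges[OF assms] by (simp add: path_weight_def)
qed

text \<open>A path without repetitions uses every edge at most once, so the weights along it are
  independent.\<close>

lemma nn_integral_exp_path_weight:
  assumes "walk_between \<Gamma> x y p" "distinct p"
  shows "(\<integral>\<^sup>+\<omega>. ennreal (exp (t * path_weight \<omega> p)) \<partial>\<P>) = (\<integral>\<^sup>+x. ennreal (exp (t * x)) \<partial>\<rho>) ^ (length p - 1)"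
  using nn_integral_exp_sum[OF finite_set walk_edges[OF assms(1)], of t] assms(2)
  by (simp add: path_weight_distinct distinct_card distinct_path_edges)

text \<open>One short path \<open>\<pi> u\<close> per vertex is enough for an upper bound, so the
  union bound runs over the vertices of the spheres \<open>F n\<close>.\<close>

lemma AE_upper_bound:
  "AE \<omega> in \<P>. \<exists>A B. \<forall>u\<in>carrier G. \<exists>p. walk_between \<Gamma> \<one> u p \<and> path_weight \<omega> p \<le> A * wlen u + B"
proof -
  obtain a where a: "0 < a" "(\<integral>\<^sup>+ x. ennreal (exp (a * x)) \<partial>\<rho>) < \<infinity>" using exp_moment by blast
  \<comment> \<open>At least 1, so that a path with at most \<open>n\<close> edges is also
    controlled by the \<open>n\<close>-th power.\<close>
  define m where "m = max 1 (enn2real (\<integral>\<^sup>+ x. ennreal (exp (a * x)) \<partial>\<rho>))"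
  have m: "1 \<le> m" "(\<integral>\<^sup>+ x. ennreal (exp (a * x)) \<partial>\<rho>) \<le> ennreal m"
  proof -
    have "(\<integral>\<^sup>+ x. ennreal (exp (a * x)) \<partial>\<rho>) = ennreal (enn2real (\<integral>\<^sup>+ x. ennreal (exp (a * x)) \<partial>\<rho>))"
      using a(2) by simp
    also have "\<dots> \<le> ennreal m" by (intro ennreal_leI) (simp add: m_def)
    finally show "(\<integral>\<^sup>+ x. ennreal (exp (a * x)) \<partial>\<rho>) \<le> ennreal m" .
  qed (simp add: m_def)
  define k where "k = card S + 1"
  \<comment> \<open>Chosen so that the growth \<open>k\<close>, the moment \<open>m\<close> and the
    discount \<open>exp (- (a * A))\<close> multiply to \<open>exp (- 1)\<close>, which makes the
    union bound summable.\<close>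
  define A where "A = (ln (real k * m) + 1) / a"
  define \<pi> where "\<pi> = (\<lambda>u. SOME p. walk_between \<Gamma> \<one> u p \<and> distinct p \<and> real (length p - 1) \<le> wlen u)"
  have \<pi>: "walk_between \<Gamma> \<one> u (\<pi> u)" "distinct (\<pi> u)" "real (length (\<pi> u) - 1) \<le> wlen u"
    if "u \<in> carrier G" for u
  proof -
    have "\<exists>p. walk_between \<Gamma> \<one> u p \<and> distinct p \<and> real (length p - 1) \<le> wlen u"
      using walk_from_one[OF that] by metis
    then have "walk_between \<Gamma> \<one> u (\<pi> u) \<and> distinct (\<pi> u) \<and> real (length (\<pi> u) - 1) \<le> wlen u"
      unfolding \<pi>_def by (rule someI_ex)
    then show "walk_between \<Gamma> \<one> u (\<pi> u)" "distinct (\<pi> u)" "real (length (\<pi> u) - 1) \<le> wlen u" by auto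
  qed
  define F where "F = (\<lambda>n. {u \<in> carrier G. wlen u = real n})"
  have sub: "F n \<subseteq> {g \<in> carrier G. wlen g \<le> real n}" for n by (auto simp: F_def)
  \<comment> \<open>The exponential of \<open>a\<close> times the excess of the weight over
    \<open>A * n\<close>; after taking logarithms, a common bound becomes the constant term of the
    claim.\<close>
  define Y where "Y = (\<lambda>n u (\<omega> :: 'a set \<Rightarrow> real). exp (a * path_weight \<omega> (\<pi> u)) * exp (- (a * A)) ^ n)"
  have km: "1 \<le> real k * m" using m(1) by (simp add: k_def mult_ge1_I)
  have "AE \<omega> in \<P>. \<exists>Z. \<forall>n. \<forall>u\<in>F n. Y n u \<omega> \<le> Z"
  proof (rule AE_bounded_family[where k = k and q = "m * exp (- (a * A))"])
    show "finite (F n)" for n using finite_subset[OF sub finite_ball] .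
    show "card (F n) \<le> k ^ n" for n
      using card_mono[OF finite_ball sub] card_ball[of n] unfolding k_def by (rule order_trans)
    show "Y n u \<in> borel_measurable \<P>" if "u \<in> F n" for n u
      unfolding Y_def using path_weight_measurable[OF \<pi>(1)[of u]] that by (auto simp: F_def)
    show "0 \<le> m * exp (- (a * A))" using m(1) by simp
    have aA: "a * A = ln (real k * m) + 1" using a(1) by (simp add: A_def)
    have "exp (- (a * A)) = exp (- ln (real k * m)) * exp (- 1)" unfolding aA by (simp flip: exp_add)
    also have "exp (- ln (real k * m)) = inverse (real k * m)"
      by (subst exp_minus, subst exp_ln) (use km in linarith)+
    finally have "real k * m * exp (- (a * A)) = real k * m * inverse (real k * m) * exp (- 1)" by simp
    also have "real k * m * inverse (real k * m) = 1" using km by (intro right_inverse) linarith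
    finally have "real k * (m * exp (- (a * A))) = exp (- 1)" by (simp only: mult.assoc mult_1)
    then show "real k * (m * exp (- (a * A))) < 1" by simp
    fix n u assume "u \<in> F n"
    then have u: "u \<in> carrier G" "wlen u = real n" by (auto simp: F_def)
    have len: "length (\<pi> u) - 1 \<le> n" using \<pi>(3)[OF u(1)] u(2) by simp
    have [measurable]: "(\<lambda>\<omega>. path_weight \<omega> (\<pi> u)) \<in> borel_measurable \<P>"
      using path_weight_measurable[OF \<pi>(1)[OF u(1)]] .
    have "(\<integral>\<^sup>+\<omega>. ennreal (Y n u \<omega>) \<partial>\<P>)
        = (\<integral>\<^sup>+\<omega>. ennreal (exp (a * path_weight \<omega> (\<pi> u))) \<partial>\<P>) * ennreal (exp (- (a * A)) ^ n)"
      unfolding Y_def by (simp add: ennreal_mult nn_integral_multc)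
    also have "(\<integral>\<^sup>+\<omega>. ennreal (exp (a * path_weight \<omega> (\<pi> u))) \<partial>\<P>)
        = (\<integral>\<^sup>+ x. ennreal (exp (a * x)) \<partial>\<rho>) ^ (length (\<pi> u) - 1)"
      by (rule nn_integral_exp_path_weight[OF \<pi>(1,2)[OF u(1)]])
    also have "\<dots> \<le> ennreal m ^ (length (\<pi> u) - 1)" by (intro power_mono m(2)) simp
    also have "\<dots> = ennreal (m ^ (length (\<pi> u) - 1))" using m(1) by (simp add: ennreal_power)
    also have "\<dots> \<le> ennreal (m ^ n)" using m(1) len by (intro ennreal_leI power_increasing)
    finally have "(\<integral>\<^sup>+\<omega>. ennreal (Y n u \<omega>) \<partial>\<P>) \<le> ennreal (m ^ n) * ennreal (exp (- (a * A)) ^ n)"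
      by (simp add: mult_right_mono)
    then show "(\<integral>\<^sup>+\<omega>. ennreal (Y n u \<omega>) \<partial>\<P>) \<le> ennreal ((m * exp (- (a * A))) ^ n)"
      using m(1) by (simp add: power_mult_distrib ennreal_mult)
  qed
  then show ?thesis
  proof eventually_elim
    case (elim \<omega>)
    then obtain Z where Z: "\<And>n u. u \<in> F n \<Longrightarrow> Y n u \<omega> \<le> Z" by blast
    have "path_weight \<omega> (\<pi> u) \<le> A * wlen u + ln (max 1 Z) / a" if u: "u \<in> carrier G" for u
    proof -
      obtain n :: nat where n: "wlen u = real n" using wd_nat by blast
      have "exp (a * path_weight \<omega> (\<pi> u) - a * A * real n) = Y n u \<omega>"
        by (simp add: Y_def exp_diff exp_minus exp_of_nat_mult[symmetric] power_inverse[symmetric] field_simps)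
      also have "\<dots> \<le> max 1 Z" using Z[of u n] u n by (auto simp: F_def)
      finally have "a * path_weight \<omega> (\<pi> u) - a * A * real n \<le> ln (max 1 Z)"
        by (simp add: ln_ge_iff)
      then show ?thesis using a(1) n by (simp add: field_simps)
    qed
    then show ?case using \<pi>(1) by blast
  qed
qed

text \<open>Here all paths in \<open>paths_near n\<close> have to be controlled at once, so the
  exponential moment is taken at a negative parameter that outweighs their number.\<close>

lemma AE_lower_bound:
  "AE \<omega> in \<P>. \<exists>\<epsilon>>0. \<exists>B. \<forall>n. \<forall>p\<in>paths_near n. \<epsilon> * real n - B \<le> path_weight \<omega> p"
proof -
  define k where "k = (card S + 1) * card S"
  \<comment> \<open>This level absorbs the number of paths and the factor \<open>exp 1 ^ n\<close>
    in \<open>Y\<close>; \<open>k + 1\<close> avoids division by 0 when \<open>S\<close> is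
    empty.\<close>
  obtain s q where s: "0 < s" and q: "0 \<le> q" "q < 1 / (real (k + 1) * exp 1)"
    "(\<integral>\<^sup>+x. ennreal (exp (- s * x)) \<partial>\<rho>) = ennreal q"
    using small_laplace_transform[of "1 / (real (k + 1) * exp 1)"] by auto
  define Y where "Y = (\<lambda>n p (\<omega> :: 'a set \<Rightarrow> real). exp (- s * path_weight \<omega> p) * exp 1 ^ n)"
  have "AE \<omega> in \<P>. \<exists>Z. \<forall>n. \<forall>p\<in>paths_near n. Y n p \<omega> \<le> Z"
  proof (rule AE_bounded_family[where k = k and q = "q * exp 1"])
    show "finite (paths_near n)" for n by (rule finite_paths_near)
    show "card (paths_near n) \<le> k ^ n" for n unfolding k_def by (rule card_paths_near)
    show "Y n p \<in> borel_measurable \<P>" if "p \<in> paths_near n" for n p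
      unfolding Y_def using path_weight_measurable[of "hd p" "last p" p] that by (auto simp: paths_near_def)
    show "0 \<le> q * exp 1" using q(1) by simp
    have "real k * (q * exp 1) \<le> real (k + 1) * (q * exp 1)" using q(1) by (intro mult_right_mono) auto
    also have "\<dots> = q * (real (k + 1) * exp 1)" by (simp only: mult.left_commute)
    also have "\<dots> < 1" using q(2) by (subst (asm) pos_less_divide_eq) auto
    finally show "real k * (q * exp 1) < 1" .
    fix n p assume "p \<in> paths_near n"
    then have p: "walk_between \<Gamma> (hd p) (last p) p" "distinct p" "length p - 1 = n"
      by (auto simp: paths_near_def)
    have [measurable]: "(\<lambda>\<omega>. path_weight \<omega> p) \<in> borel_measurable \<P>" using path_weight_measurable[OF p(1)] .
    have "(\<integral>\<^sup>+\<omega>. ennreal (Y n p \<omega>) \<partial>\<P>)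
        = (\<integral>\<^sup>+\<omega>. ennreal (exp (- s * path_weight \<omega> p)) \<partial>\<P>) * ennreal (exp 1 ^ n)"
      unfolding Y_def by (simp add: ennreal_mult nn_integral_multc)
    also have "\<dots> = ennreal q ^ n * ennreal (exp 1 ^ n)"
      using nn_integral_exp_path_weight[OF p(1,2), of "- s"] q(3) p(3) by simp
    also have "\<dots> = ennreal ((q * exp 1) ^ n)"
      using q(1) by (simp add: ennreal_power ennreal_mult power_mult_distrib)
    finally show "(\<integral>\<^sup>+\<omega>. ennreal (Y n p \<omega>) \<partial>\<P>) \<le> ennreal ((q * exp 1) ^ n)" by simp
  qed
  then show ?thesis
  proof eventually_elim
    case (elim \<omega>)
    then obtain Z where Z: "\<And>n p. p \<in> paths_near n \<Longrightarrow> Y n p \<omega> \<le> Z" by blast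
    have "1 / s * real n - ln (max 1 Z) / s \<le> path_weight \<omega> p" if p: "p \<in> paths_near n" for n p
    proof -
      have "exp (real n - s * path_weight \<omega> p) = Y n p \<omega>"
        by (simp add: Y_def exp_diff exp_minus exp_of_nat_mult[symmetric] field_simps)
      also have "\<dots> \<le> max 1 Z" using Z[OF p] by simp
      finally have "real n - s * path_weight \<omega> p \<le> ln (max 1 Z)" by (simp add: ln_ge_iff)
      then show ?thesis using s by (simp add: field_simps)
    qed
    then show ?case using s by (intro exI[of _ "1 / s"] conjI exI[of _ "ln (max 1 Z) / s"]) auto
  qed
qed

text \<open>Only countably many pairs of paths occur, and distinct self-avoiding paths with a common
  start differ in their edge sets, so each coincidence has probability 0 by
  \<open>AE_sum_neq\<close>.\<close>

lemma AE_weights_differ: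
  "AE \<omega> in \<P>. \<forall>x y p q. walk_between \<Gamma> x y p \<and> distinct p \<and> walk_between \<Gamma> x y q \<and> distinct q \<and> p \<noteq> q \<longrightarrow>
      path_weight \<omega> p \<noteq> path_weight \<omega> q"
proof -
  define W where "W = {(p, q). \<exists>x y. walk_between \<Gamma> x y p \<and> distinct p \<and> walk_between \<Gamma> x y q \<and> distinct q \<and> p \<noteq> q}"
  have "W \<subseteq> lists (carrier G) \<times> lists (carrier G)" by (auto simp: W_def walk_between_def)
  then have "countable W" using countable_carrier by (meson countable_SIGMA countable_lists countable_subset)
  moreover have "AE \<omega> in \<P>. path_weight \<omega> (fst z) \<noteq> path_weight \<omega> (snd z)" if zW: "z \<in> W" for z
  proof -
    obtain x y p q where z: "z = (p, q)" and w: "walk_between \<Gamma> x y p" "distinct p" "walk_between \<Gamma> x y q" "distinct q" "p \<noteq> q"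
      using zW unfolding W_def by blast
    have "set (path_edges p) \<noteq> set (path_edges q)"
      using distinct_path_eq_if_edges_eq[OF w(2,4)] w walk_between_ends(1,2) by metis
    then have "AE \<omega> in \<P>. (\<Sum>e\<in>set (path_edges p). \<omega> e) \<noteq> (\<Sum>e\<in>set (path_edges q). \<omega> e)"
      using walk_edges w by (intro AE_sum_neq) auto
    then show ?thesis using w by (simp add: z path_weight_distinct)
  qed
  ultimately have "AE \<omega> in \<P>. \<forall>z\<in>W. path_weight \<omega> (fst z) \<noteq> path_weight \<omega> (snd z)"
    by (simp add: AE_ball_countable)
  then show ?thesis by eventually_elim (auto simp: W_def)
qed

lemma AE_typical: "AE \<omega> in \<P>. typical \<omega>"
proof -
  have "AE \<omega> in \<P>. \<forall>e\<in>cayley_edges G S. 0 < \<omega> e"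
    using AE_coordinate_pos countable_cayley_edges by (simp add: AE_ball_countable)
  then show ?thesis
    using AE_upper_bound AE_lower_bound AE_weights_differ
    by eventually_elim (simp only: typical_def)
qed

end

section \<open>Trees of geodesics\<close>

lemma walk_between_map_upt:
  assumes "\<And>n. s n \<in> fst \<G>" "\<And>n. {s n, s (Suc n)} \<in> snd \<G>" "m \<le> n"
  shows "walk_between \<G> (s m) (s n) (map s [m..<Suc n])"
  using assms by (auto simp: walk_between_def set_path_edges hd_map last_map nth_append simp del: upt_Suc)

text \<open>In a tree an injective walk is a geodesic ray, so \<open>s n\<close> has distance
  \<open>n\<close> from \<open>s 0\<close>; moving the base-point to \<open>v\<close> costs at most
  the distance of \<open>v\<close> from \<open>s 0\<close>.\<close>

lemma tree_ray_gromov_seq: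
  fixes s :: "nat \<Rightarrow> 'a"
  assumes T: "is_tree \<G>" and v: "v \<in> fst \<G>" and s: "\<And>n. s n \<in> fst \<G>" "\<And>n. {s n, s (Suc n)} \<in> snd \<G>"
    and inj: "inj s"
  shows "s \<in> gromov_seqs (simplicial_space \<G> v)"
proof -
  interpret Metric_space "fst \<G>" "simplicial_dist \<G>" by (rule Metric_space_tree[OF T])
  define d where "d = simplicial_dist \<G>"
  have le: "d (s m) (s n) = real n - real m" if "m \<le> n" for m n
  proof -
    have "distinct (map s [m..<Suc n])" using inj by (simp add: distinct_map inj_on_def)
    then show ?thesis
      using is_tree_simplicial_dist[OF T walk_between_map_upt[of s, OF s that]] that by (simp add: d_def of_nat_diff)
  qed
  have low: "real n - d v (s 0) \<le> d v (s n)" for n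
    using triangle[of "s 0" v "s n"] commute[of "s 0" v] le[of 0 n] v s by (simp add: d_def)
  have "real (min i j) - d v (s 0) \<le> gromov_product d v (s i) (s j)" for i j
  proof (cases "i \<le> j")
    case True
    then show ?thesis using low[of i] low[of j] le[of i j] by (simp add: gromov_product_def)
  next
    case False
    then show ?thesis using low[of i] low[of j] le[of j i] commute[of "s i" "s j"]
      by (simp add: gromov_product_def d_def)
  qed
  note low = this
  have "\<exists>N. \<forall>i\<ge>N. \<forall>j\<ge>N. R \<le> gromov_product d v (s i) (s j)" for R
  proof -
    obtain N :: nat where N: "R + d v (s 0) \<le> real N" using real_arch_simple by blast
    have "R \<le> gromov_product d v (s i) (s j)" if "N \<le> i" "N \<le> j" for i j
      using N low[of i j] that by linarith
    then show ?thesis by blast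
  qed
  then show ?thesis using s by (auto simp: gromov_seqs_iff d_def)
qed

text \<open>Heights strictly decrease towards the parent, so a path without repetitions has no interior
  local maximum of the height: there both neighbours would be the parent. Hence its higher end is
  followed by the parent of that end.\<close>

lemma parent_next:
  fixes h :: "'a \<Rightarrow> nat"
  assumes E: "\<And>a b. {a, b} \<in> snd \<G> \<Longrightarrow> (par b = a \<and> h a < h b) \<or> (par a = b \<and> h b < h a)"
    and p: "walk_between \<G> x y p" "distinct p" and xy: "x \<noteq> y" "h y \<le> h x"
  shows "\<exists>q. p = x # q \<and> walk_between \<G> (par x) y q \<and> distinct q"
proof -
  note pe = walk_between_ends[OF p(1)]
  have edge: "{p ! i, p ! Suc i} \<in> snd \<G>" if "Suc i < length p" for i
    using p(1) that by (auto simp: walk_between_def set_path_edges)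
  obtain u q where pq: "p = x # u # q"
    using pe xy by (metis hd_conv_nth last_ConsL list.collapse list.exhaust_sel)
  have w: "walk_between \<G> u y (u # q)" using p(1) pq by (auto simp: walk_between_def)
  have "u = par x"
  proof (rule ccontr)
    assume "u \<noteq> par x"
    then have up: "h x < h u" using E[of x u] edge[of 0] pq by auto
    define A where "A = (\<lambda>i. h (p ! i)) ` {..<length p}"
    have "finite A" "A \<noteq> {}" using pq by (auto simp: A_def)
    then have "Max A \<in> A" and ge: "\<And>a. a \<in> A \<Longrightarrow> a \<le> Max A" by auto
    then obtain k where k: "k < length p" "h (p ! k) = Max A" by (auto simp: A_def)
    then have max: "h (p ! i) \<le> h (p ! k)" if "i < length p" for i
      using ge that by (simp add: A_def)
    have hk: "h x < h (p ! k)" using up max[of 1] pq by simp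
    have "k \<noteq> 0" using hk pe(9) by (metis less_irrefl)
    then obtain i where i: "k = Suc i" by (cases k) auto
    have "k \<noteq> length p - 1" using hk pe(10) xy(2) by (metis not_less)
    then have k2: "Suc k < length p" using k by simp
    have "par (p ! k) = p ! i" using E[OF edge[of i]] max[of i] i k by auto
    moreover have "par (p ! k) = p ! Suc k" using E[OF edge[OF k2]] max[OF k2] by auto
    ultimately show False using p(2) i k2 by (simp add: nth_eq_iff_index_eq)
  qed
  then show ?thesis using pq w p(2) by auto
qed

text \<open>For uniqueness, two paths with the same ends proceed from their higher end to its parent
  by \<open>parent_next\<close>, and induction on the length removes that vertex. If the higher end
  comes last, both paths are reversed.\<close>

lemma is_tree_parent:
  fixes h :: "'a \<Rightarrow> nat"
  assumes "fst \<G> \<noteq> {}" and con: "\<And>x y. x \<in> fst \<G> \<Longrightarrow> y \<in> fst \<G> \<Longrightarrow> \<exists>p. walk_between \<G> x y p"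
    and E: "\<And>a b. {a, b} \<in> snd \<G> \<Longrightarrow> (par b = a \<and> h a < h b) \<or> (par a = b \<and> h b < h a)"
  shows "is_tree \<G>"
proof -
  have unique: "p = q" if "walk_between \<G> x y p" "distinct p" "walk_between \<G> x y q" "distinct q" for x y p q
    using that
  proof (induction "length p" arbitrary: x y p q rule: less_induct)
    case less
    note pe = walk_between_ends[OF less.prems(1)] and qe = walk_between_ends[OF less.prems(3)]
    consider "x = y" | "x \<noteq> y" "h y \<le> h x" | "x \<noteq> y" "h x \<le> h y" by linarith
    then show ?case
    proof cases
      case 1
      have "r = [x]" if "walk_between \<G> x x r" "distinct r" for r
        using that by (cases r) (auto simp: walk_between_def split: if_splits)
      then show ?thesis using 1 less.prems by metis
    next
      case 2
      obtain p' q' where p': "p = x # p'" "walk_between \<G> (par x) y p'" "distinct p'"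
        and q': "q = x # q'" "walk_between \<G> (par x) y q'" "distinct q'"
        using parent_next[OF E less.prems(1,2) 2] parent_next[OF E less.prems(3,4) 2] by metis
      then show ?thesis using less.hyps[of p' "par x" y q'] by simp
    next
      case 3
      have hyx: "y \<noteq> x" "h x \<le> h y" using 3 by auto
      have d: "distinct (rev p)" "distinct (rev q)" using less.prems by auto
      obtain p' q' where p': "rev p = y # p'" "walk_between \<G> (par y) x p'" "distinct p'"
        and q': "rev q = y # q'" "walk_between \<G> (par y) x q'" "distinct q'"
        using parent_next[OF E walk_between_rev[OF less.prems(1)] d(1) hyx]
          parent_next[OF E walk_between_rev[OF less.prems(3)] d(2) hyx] by metis
      have "length p' < length p" using p'(1) by (metis length_Cons length_rev lessI)
      then have "p' = q'" using less.hyps[of p' "par y" x q'] p' q' by simp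
      then show ?thesis using p'(1) q'(1) by (metis rev_rev_ident)
    qed
  qed
  have "\<exists>p. walk_between \<G> x y p \<and> distinct p" if "x \<in> fst \<G>" "y \<in> fst \<G>" for x y
    using con[OF that] walk_between_shorten by metis
  then show ?thesis using unique assms(1) unfolding is_tree_def by blast
qed

context hyperbolic_cayley
begin

text \<open>A Gromov sequence accumulates at its own class, and its direction is its only
  accumulation point in the boundary.\<close>

lemma direction_endpoint:
  assumes "has_direction G S s \<zeta>" "s \<in> gromov_seqs X" shows "s \<in> \<zeta>"
proof -
  have "infinite {n. Inl (s n) \<in> U}"
    if U: "openin (gromov_compactification X) U" "Inr (endpoint X s) \<in> U" for U
  proof -
    obtain N where "\<forall>n\<ge>N. Inl (s n) \<in> U"
      using eventually_in_gromov_open[OF hyperbolic assms(2)] U unfolding openin_gromov_compactification by blast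
    then have "{N..} \<subseteq> {n. Inl (s n) \<in> U}" by auto
    then show ?thesis using infinite_super infinite_Ici by blast
  qed
  then have "endpoint X s \<in> {\<eta> \<in> gromov_boundary X.
      \<forall>U. openin (gromov_compactification X) U \<and> Inr \<eta> \<in> U \<longrightarrow> infinite {n. Inl (s n) \<in> U}}"
    using endpoint_in_boundary[OF assms(2)] by simp
  then have "endpoint X s \<in> {\<zeta>}" using assms(1) by (simp only: has_direction_def)
  then show ?thesis using self_in_endpoint[OF hyperbolic assms(2)] by blast
qed

text \<open>Two tree points joined by \<open>\<omega>\<close>-geodesics inside the tree to a common point have a tree geodesic
  that is made of two \<open>\<omega>\<close>-geodesics; this is all that is used about the two trees.\<close>

definition geodesic_tree :: "('a set \<Rightarrow> real) \<Rightarrow> 'a graph \<Rightarrow> bool" where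
  "geodesic_tree \<omega> \<T> \<longleftrightarrow> is_tree \<T> \<and> fst \<T> = carrier G \<and>
    (\<forall>x\<in>carrier G. \<forall>y\<in>carrier G. \<exists>m p q. fpp_geodesic G S \<omega> x m p \<and> walk_between \<T> x m p \<and>
      fpp_geodesic G S \<omega> y m q \<and> walk_between \<T> y m q)"

text \<open>The common vertex \<open>m\<close> may lie off the tree path and close to
  \<open>\<one>\<close>. Cutting both geodesics where they first meet leaves pieces that make up the
  tree path, and these do stay far from \<open>\<one>\<close>.\<close>

lemma geodesic_tree_far_path:
  assumes ty: "typical \<omega>" and T: "geodesic_tree \<omega> \<T>"
  obtains N where "\<And>x y r. walk_between \<T> x y r \<Longrightarrow> distinct r \<Longrightarrow> (\<And>v. v \<in> set r \<Longrightarrow> N \<le> wlen v) \<Longrightarrow>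
    R \<le> gprod X x y"
proof -
  have tree: "is_tree \<T>" and verts: "fst \<T> = carrier G" using T by (auto simp: geodesic_tree_def)
  obtain \<delta> where \<delta>: "0 < \<delta>" "\<And>x y z. x \<in> carrier G \<Longrightarrow> y \<in> carrier G \<Longrightarrow> z \<in> carrier G \<Longrightarrow>
    min (gprod X x y) (gprod X y z) - \<delta> \<le> gprod X x z"
    using hyperbolic_space_gprod[OF hyperbolic] by (metis cayley_space_simps(1))
  \<comment> \<open>The spare \<delta> pays for joining the two products at the meeting
    vertex.\<close>
  obtain N where N: "\<And>x y p. fpp_geodesic G S \<omega> x y p \<Longrightarrow> (\<And>v. v \<in> set p \<Longrightarrow> N \<le> wlen v) \<Longrightarrow> R + \<delta> \<le> gprod X x y"
    using typical_gprod[OF ty] by metis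
  show thesis
  proof (rule that)
    fix x y r assume r: "walk_between \<T> x y r" "distinct r" and far: "\<And>v. v \<in> set r \<Longrightarrow> N \<le> wlen v"
    have xy: "x \<in> carrier G" "y \<in> carrier G" using walk_between_ends(6,7)[OF r(1)] verts by auto
    then obtain m p q where p: "fpp_geodesic G S \<omega> x m p" "walk_between \<T> x m p"
      and q: "fpp_geodesic G S \<omega> y m q" "walk_between \<T> y m q"
      using T unfolding geodesic_tree_def by blast
    note dist = fpp_geodesic_distinct[OF typical_pos[OF ty]]
    obtain i j where ij: "i < length p" "j < length q" "p ! i = q ! j"
      and w: "walk_between \<T> x y (take (Suc i) p @ tl (rev (take (Suc j) q)))"
        "distinct (take (Suc i) p @ tl (rev (take (Suc j) q)))"
      and sub: "set (take (Suc i) p) \<union> set (take (Suc j) q) = set (take (Suc i) p @ tl (rev (take (Suc j) q)))"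
      using first_meeting_distinct[OF p(2) dist[OF p(1)] q(2) dist[OF q(1)]] by metis
    have sub: "set (take (Suc i) p) \<subseteq> set r" "set (take (Suc j) q) \<subseteq> set r"
      using sub is_tree_unique[OF tree w r] by auto
    have gp: "fpp_geodesic G S \<omega> x (p ! i) (take (Suc i) p)" "fpp_geodesic G S \<omega> y (p ! i) (take (Suc j) q)"
      using fpp_geodesic_take[OF typical_nonneg[OF ty] p(1) ij(1)]
        fpp_geodesic_take[OF typical_nonneg[OF ty] q(1) ij(2)] ij(3) by auto
    have "R + \<delta> \<le> gprod X x (p ! i)" "R + \<delta> \<le> gprod X y (p ! i)"
      using N[OF gp(1)] N[OF gp(2)] sub far by blast+
    moreover have "p ! i \<in> carrier G" using walk_between_ends(7)[OF fpp_geodesic_walk[OF gp(1)]] by simp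
    moreover have "gprod X y (p ! i) = gprod X (p ! i) y"
      by (rule gromov_product_commute[OF hyperbolic_space_imp_Metric_space[OF hyperbolic]])
    ultimately show "R \<le> gprod X x y" using \<delta>(2)[of x "p ! i" y] xy by linarith
  qed
qed

section \<open>Properness, 2-properness and Cannon-Thurston maps for trees of geodesics\<close>

context
  fixes \<omega> \<T> assumes ty: "typical \<omega>" and T: "geodesic_tree \<omega> \<T>"
begin

lemma geodesic_tree_tree: "is_tree \<T>" and geodesic_tree_verts: "fst \<T> = carrier G"
  using T by (auto simp: geodesic_tree_def)

lemma geodesic_tree_hyperbolic: "hyperbolic_space (simplicial_space \<T> \<one>)"
  using hyperbolic_space_tree[OF geodesic_tree_tree] geodesic_tree_verts by simp

lemma geodesic_tree_discrete: "mtop (simplicial_space \<T> \<one>) = discrete_topology (carrier G)"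
proof -
  note M = hyperbolic_space_imp_Metric_space[OF geodesic_tree_hyperbolic]
  have "x = y" if "x \<in> fst \<T>" "y \<in> fst \<T>" "simplicial_dist \<T> x y < 1" for x y
  proof -
    obtain n :: nat where "simplicial_dist \<T> x y = real n" by (simp add: simplicial_dist_def)
    then have "simplicial_dist \<T> x y = 0" using that(3) by simp
    then show ?thesis using Metric_space.zero[OF Metric_space_tree[OF geodesic_tree_tree] that(1,2)] by simp
  qed
  then show ?thesis using discrete_mtop[OF M] geodesic_tree_verts by simp
qed

lemma geodesic_tree_based_embedding: "based_embedding (simplicial_space \<T> \<one>) X (\<lambda>x. x)"
  using geodesic_tree_discrete mtop_cayley geodesic_tree_verts by (intro based_embedding_discrete) auto

lemma geodesic_tree_proper:
  shows "proper_embedding (simplicial_space \<T> \<one>) X (\<lambda>x. x)"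
    and "\<exists>n. \<forall>y\<in>carrier G. real n \<le> simplicial_dist \<T> \<one> y \<longrightarrow> R \<le> wlen y"
proof -
  have "finite {x \<in> pts (simplicial_space \<T> \<one>). dst X (bpt X) x < R}" for R
    using finite_wlen_less by (simp add: geodesic_tree_verts)
  note 1 = proper_embeddingI[OF geodesic_tree_based_embedding this]
  show "proper_embedding (simplicial_space \<T> \<one>) X (\<lambda>x. x)" by (rule 1) simp
  show "\<exists>n. \<forall>y\<in>carrier G. real n \<le> simplicial_dist \<T> \<one> y \<longrightarrow> R \<le> wlen y"
    using 1(2)[of R] by (simp add: geodesic_tree_verts)
qed

text \<open>Properness of the inclusion allows the distance from \<open>\<one>\<close> to be
  measured in the tree instead of the Cayley graph.\<close>

lemma geodesic_tree_far:
  obtains n :: nat where "\<And>x y r. walk_between \<T> x y r \<Longrightarrow> distinct r \<Longrightarrow>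
    (\<And>v. v \<in> set r \<Longrightarrow> real n \<le> simplicial_dist \<T> \<one> v) \<Longrightarrow> R \<le> gprod X x y"
proof -
  obtain N where N: "\<And>x y r. walk_between \<T> x y r \<Longrightarrow> distinct r \<Longrightarrow>
      (\<And>v. v \<in> set r \<Longrightarrow> N \<le> wlen v) \<Longrightarrow> R \<le> gprod X x y"
    using geodesic_tree_far_path[OF ty T] by metis
  obtain n :: nat where n: "\<forall>y\<in>carrier G. real n \<le> simplicial_dist \<T> \<one> y \<longrightarrow> N \<le> wlen y"
    using geodesic_tree_proper(2) by blast
  show thesis
  proof (rule that)
    fix x y r assume r: "walk_between \<T> x y r" "distinct r" "\<And>v. v \<in> set r \<Longrightarrow> real n \<le> simplicial_dist \<T> \<one> v"
    show "R \<le> gprod X x y"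
      using N[OF r(1,2)] r(3) n walk_between_ends(8)[OF r(1)] geodesic_tree_verts by blast
  qed
qed

lemma geodesic_tree_two_proper: "two_proper_embedding (simplicial_space \<T> \<one>) X (\<lambda>x. x)"
proof -
  let ?Y = "simplicial_space \<T> \<one>"
  let ?P = "\<lambda>n k. \<forall>x\<in>pts ?Y. \<forall>y\<in>pts ?Y. \<forall>p q. geodesic_between ?Y x y p \<longrightarrow> geodesic_between X x y q \<longrightarrow>
    real n \<le> dist_to_set ?Y (bpt ?Y) (set p) \<longrightarrow> real k \<le> dist_to_set X (bpt X) (set q)"
  note M = hyperbolic_space_imp_Metric_space[OF hyperbolic] hyperbolic_space_imp_bpt[OF hyperbolic]
  have zero: "?P n 0" for n by (auto simp: geodesic_between_def le_dist_to_set_iff)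
  have "\<exists>n0. \<forall>n\<ge>n0. ?P n k" for k
  proof -
    obtain n0 :: nat where n0: "\<And>x y r. walk_between \<T> x y r \<Longrightarrow> distinct r \<Longrightarrow>
        (\<And>v. v \<in> set r \<Longrightarrow> real n0 \<le> simplicial_dist \<T> \<one> v) \<Longrightarrow> real k \<le> gprod X x y"
      using geodesic_tree_far by metis
    have "real k \<le> dist_to_set X (bpt X) (set q)"
      if n: "n0 \<le> n" and p: "geodesic_between ?Y x y p" and q: "geodesic_between X x y q"
        and d: "real n \<le> dist_to_set ?Y (bpt ?Y) (set p)" for n x y p q
    proof -
      note w = geodesic_between_tree[OF geodesic_tree_tree p]
      have ne: "p \<noteq> []" "q \<noteq> []" using p q by (auto simp: geodesic_between_def)
      have "real n0 \<le> simplicial_dist \<T> \<one> v" if "v \<in> set p" for v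
        using d that n by (fastforce simp: le_dist_to_set_iff[OF ne(1)])
      then have "real k \<le> gprod X x y" using n0[OF w] by blast
      then show ?thesis
        using geodesic_between_gprod_le[OF M q] by (auto simp: le_dist_to_set_iff[OF ne(2)] intro: order_trans)
    qed
    then show ?thesis by blast
  qed
  then have "\<exists>M. proper_fun M \<and> (\<forall>n. ?P n (M n))" using proper_funI[of ?P, OF zero] by blast
  then show ?thesis
    unfolding two_proper_embedding_def
    using geodesic_tree_hyperbolic hyperbolic geodesic_tree_based_embedding by simp
qed

lemma geodesic_tree_cannon_thurston:
  shows "admits_cannon_thurston (simplicial_space \<T> \<one>) X (\<lambda>x. x)"
    and "gromov_seqs (simplicial_space \<T> \<one>) \<subseteq> gromov_seqs X"
proof -
  let ?Y = "simplicial_space \<T> \<one>"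
  have gp: "\<exists>R'. \<forall>x\<in>pts ?Y. \<forall>y\<in>pts ?Y. R' \<le> gprod ?Y x y \<longrightarrow> R \<le> gprod X x y" for R
  proof -
    obtain n :: nat where n: "\<And>x y r. walk_between \<T> x y r \<Longrightarrow> distinct r \<Longrightarrow>
        (\<And>v. v \<in> set r \<Longrightarrow> real n \<le> simplicial_dist \<T> \<one> v) \<Longrightarrow> R \<le> gprod X x y"
      using geodesic_tree_far by metis
    have "R \<le> gprod X x y" if xy: "x \<in> fst \<T>" "y \<in> fst \<T>" and g: "real n \<le> gprod ?Y x y" for x y
    proof -
      obtain r where r: "walk_between \<T> x y r" "distinct r" using is_tree_ex_path[OF geodesic_tree_tree xy] .
      \<comment> \<open>A large Gromov product in the tree keeps the whole tree path away from
        \<open>\<one>\<close>, as \<open>geodesic_tree_far\<close> requires.\<close>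
      have "gprod ?Y x y \<le> simplicial_dist \<T> \<one> v" if v: "v \<in> set r" for v
      proof -
        have "v \<in> fst \<T>" using v walk_between_ends(8)[OF r(1)] by blast
        then show ?thesis
          using gromov_product_le_between[OF Metric_space_tree[OF geodesic_tree_tree] _ xy, of \<one> v]
            is_tree_between[OF geodesic_tree_tree r v] by (simp add: geodesic_tree_verts)
      qed
      then show ?thesis using n[OF r] g by fastforce
    qed
    then show ?thesis by (intro exI[of _ "real n"]) auto
  qed
  have "pts ?Y \<subseteq> pts X" "mtop ?Y = discrete_topology (pts ?Y)"
    using geodesic_tree_verts geodesic_tree_discrete by auto
  note 1 = admits_cannon_thurstonI[OF geodesic_tree_hyperbolic hyperbolic geodesic_tree_proper(1) this gp]
  show "admits_cannon_thurston ?Y X (\<lambda>x. x)" "gromov_seqs ?Y \<subseteq> gromov_seqs X" using 1 by blast+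
qed

lemma geodesic_tree_surj:
  assumes "\<And>\<zeta>. \<zeta> \<in> gromov_boundary X \<Longrightarrow> \<exists>s\<in>gromov_seqs (simplicial_space \<T> \<one>). s \<in> \<zeta>"
  shows "cannon_thurston_boundary_surj (simplicial_space \<T> \<one>) X (\<lambda>x. x)"
  using mtop_cayley geodesic_tree_cannon_thurston assms
  by (intro cannon_thurston_boundary_surjI geodesic_tree_hyperbolic hyperbolic) auto

end

end

section \<open>The forward and the backward tree\<close>

context hyperbolic_cayley
begin

context
  fixes \<omega> assumes ty: "typical \<omega>"
begin

section \<open>The forward tree\<close>

definition geo :: "'a \<Rightarrow> 'a list" where
  "geo g = (THE p. fpp_geodesic G S \<omega> \<one> g p)"

lemma geo_eq: "fpp_geodesic G S \<omega> \<one> g p \<Longrightarrow> geo g = p"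
  unfolding geo_def using typical_geodesic_unique[OF ty] by blast

lemma geo: "g \<in> carrier G \<Longrightarrow> fpp_geodesic G S \<omega> \<one> g (geo g)"
  using typical_geodesic_exists[OF ty one_closed] geo_eq by metis

lemma geo_take:
  assumes "fpp_geodesic G S \<omega> \<one> g p" "i < length p" shows "geo (p ! i) = take (Suc i) p"
  using geo_eq[OF fpp_geodesic_take[OF typical_nonneg[OF ty] assms]] .

lemma forward_tree_verts: "fst (forward_tree G S \<omega>) = carrier G"
proof
  show "fst (forward_tree G S \<omega>) \<subseteq> carrier G"
    using walk_between_ends(8)[OF fpp_geodesic_walk] by (fastforce simp: forward_tree_def)
  show "carrier G \<subseteq> fst (forward_tree G S \<omega>)"
  proof
    fix g assume g: "g \<in> carrier G"
    then have "g \<in> set (geo g)" using walk_between_ends(5)[OF fpp_geodesic_walk[OF geo]] by blast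
    then show "g \<in> fst (forward_tree G S \<omega>)" using geo[OF g] g unfolding forward_tree_def by auto
  qed
qed

lemma forward_tree_walk:
  assumes "fpp_geodesic G S \<omega> \<one> g p" shows "walk_between (forward_tree G S \<omega>) \<one> g p"
proof -
  note w = fpp_geodesic_walk[OF assms]
  have "g \<in> carrier G" using walk_between_ends(7)[OF w] by simp
  then have "set (path_edges p) \<subseteq> snd (forward_tree G S \<omega>)"
    using assms unfolding forward_tree_def by auto
  then show ?thesis using w by (simp add: walk_between_def forward_tree_verts)
qed

definition parent :: "'a \<Rightarrow> 'a" where "parent v = geo v ! (length (geo v) - 2)"

lemma geo_step:
  assumes "fpp_geodesic G S \<omega> \<one> g p" "Suc i < length p"
  shows "parent (p ! Suc i) = p ! i" "length (geo (p ! Suc i)) = Suc (length (geo (p ! i)))"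
  using geo_take[OF assms] geo_take[OF assms(1), of i] assms(2) by (auto simp: parent_def)

text \<open>These are the conditions of \<open>is_tree_parent\<close>, with the length of the
  geodesic from \<open>\<one>\<close> as height. They hold because, by uniqueness, the geodesic from
  \<open>\<one>\<close> to a vertex of another one is a prefix of it.\<close>

lemma forward_tree_edge:
  assumes "{a, b} \<in> snd (forward_tree G S \<omega>)"
  shows "(parent b = a \<and> length (geo a) < length (geo b)) \<or> (parent a = b \<and> length (geo b) < length (geo a))"
proof -
  obtain g p where p: "fpp_geodesic G S \<omega> \<one> g p" "{a, b} \<in> set (path_edges p)"
    using assms by (auto simp: forward_tree_def)
  then obtain i where i: "Suc i < length p" "{a, b} = {p ! i, p ! Suc i}" by (auto simp: set_path_edges)
  then have "(a = p ! i \<and> b = p ! Suc i) \<or> (b = p ! i \<and> a = p ! Suc i)" by (auto simp: doubleton_eq_iff)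
  then show ?thesis using geo_step[OF p(1) i(1)] by auto
qed

lemma geodesic_tree_forward: "geodesic_tree \<omega> (forward_tree G S \<omega>)"
proof -
  let ?F = "forward_tree G S \<omega>"
  have "is_tree ?F"
  proof (rule is_tree_parent[OF _ _ forward_tree_edge])
    show "fst ?F \<noteq> {}" using forward_tree_verts one_closed by auto
    show "\<exists>p. walk_between ?F x y p" if "x \<in> fst ?F" "y \<in> fst ?F" for x y
      using that forward_tree_walk[OF geo] walk_between_rev walk_between_join unfolding forward_tree_verts by metis
  qed
  \<comment> \<open>Geodesics to \<open>\<one>\<close> serve as \<open>p\<close> and
    \<open>q\<close>, with \<open>\<one>\<close> as the common vertex.\<close>
  moreover have "\<exists>m p q. fpp_geodesic G S \<omega> x m p \<and> walk_between ?F x m p \<and>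
      fpp_geodesic G S \<omega> y m q \<and> walk_between ?F y m q" if "x \<in> carrier G" "y \<in> carrier G" for x y
    using fpp_geodesic_rev[OF typical_nonneg[OF ty] geo] walk_between_rev[OF forward_tree_walk[OF geo]] that by blast
  ultimately show ?thesis by (simp add: geodesic_tree_def forward_tree_verts)
qed

text \<open>Koenig's lemma applied to the geodesics from \<open>\<one>\<close> to a sequence that converges to \<open>\<zeta>\<close>.\<close>

lemma forward_tree_limit_ray:
  assumes t: "t \<in> gromov_seqs X"
  obtains r where "\<And>n. r n \<in> carrier G" "\<And>n. {r n, r (Suc n)} \<in> snd (forward_tree G S \<omega>)"
    "\<And>n. length (geo (r n)) = Suc n" "\<And>n. infinite {k. r n \<in> set (geo (t k))}"
proof -
  have tc: "t n \<in> carrier G" for n using t by (auto simp: gromov_seqs_iff)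
  define P where "P = (\<lambda>n v. infinite {k. v \<in> set (geo (t k))} \<and> length (geo v) = Suc n)"
  \<comment> \<open>A value taken infinitely often would bound Gromov products by its distance from
    \<open>\<one>\<close>. Hence all but finitely many of the geodesics through \<open>v\<close>
    continue beyond \<open>v\<close>.\<close>
  have fin: "finite {k. t k = v}" for v
  proof (rule ccontr)
    assume inf: "infinite {k. t k = v}"
    obtain N where N: "\<forall>i\<ge>N. \<forall>j\<ge>N. wlen v + 1 \<le> gprod X (t i) (t j)"
      using t unfolding gromov_seqs_iff by blast
    obtain k where "k \<ge> N" "t k = v" using inf by (auto simp: infinite_nat_iff_unbounded_le)
    then have "wlen v + 1 \<le> gprod X v v" "v \<in> carrier G" using N tc by auto
    then show False by (simp add: gromov_product_def)
  qed
  have "\<exists>r. \<forall>n. P n (r n) \<and> {r n, r (Suc n)} \<in> snd (forward_tree G S \<omega>)"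
  proof (rule dependent_nat_choice)
    \<comment> \<open>By uniqueness the geodesic from \<open>\<one>\<close> to itself equals its
      one-vertex prefix.\<close>
    have "fpp_geodesic G S \<omega> \<one> \<one> (take (Suc 0) (geo \<one>))"
      using fpp_geodesic_take[OF typical_nonneg[OF ty] geo[OF one_closed], of 0]
        walk_between_ends[OF fpp_geodesic_walk[OF geo[OF one_closed]]] by simp
    then have "length (geo \<one>) = Suc 0"
      using geo_eq walk_between_ends(1)[OF fpp_geodesic_walk] by (metis length_take min_def
          length_greater_0_conv Suc_leI le_antisym)
    moreover have "\<one> \<in> set (geo (t k))" for k
      using walk_between_ends(4)[OF fpp_geodesic_walk[OF geo[OF tc]]] .
    ultimately have "P 0 \<one>" by (simp add: P_def)
    then show "\<exists>v. P 0 v" by blast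
  next
    fix v n assume v: "P n v"
    define A where "A = {k. v \<in> set (geo (t k))} - {k. t k = v}"
    have A: "infinite A" unfolding A_def using v fin by (simp add: P_def Diff_infinite_finite)
    have "\<exists>w\<in>(\<lambda>s. v \<otimes> s) ` S. w \<in> set (geo (t k)) \<and> {v, w} \<in> snd (forward_tree G S \<omega>) \<and> length (geo w) = Suc (Suc n)"
      if "k \<in> A" for k
    proof -
      note g = geo[OF tc, of k] and w = fpp_geodesic_walk[OF geo[OF tc, of k]]
      have k: "v \<in> set (geo (t k))" "t k \<noteq> v" using that by (auto simp: A_def)
      obtain i where i: "i < length (geo (t k))" "geo (t k) ! i = v" using k(1) by (metis in_set_conv_nth)
      have "i \<noteq> length (geo (t k)) - 1" using walk_between_ends(10)[OF w] i(2) k(2) by metis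
      then have si: "Suc i < length (geo (t k))" using i(1) by simp
      define u where "u = geo (t k) ! Suc i"
      have e: "{v, u} \<in> set (path_edges (geo (t k)))" using si i(2) by (auto simp: u_def set_path_edges)
      then have "{v, u} \<in> cayley_edges G S" using w by (auto simp: walk_between_def)
      then have "u \<in> (\<lambda>s. v \<otimes> s) ` S" by (elim cayley_edgeE) blast
      moreover have "{v, u} \<in> snd (forward_tree G S \<omega>)"
        using e forward_tree_walk[OF g] by (auto simp: walk_between_def)
      moreover have "length (geo u) = Suc (Suc n)" using geo_step(2)[OF g si] i(2) v by (simp add: P_def u_def)
      moreover have "u \<in> set (geo (t k))" using si by (simp add: u_def)
      ultimately show ?thesis by blast
    qed
    then obtain f where f: "\<And>k. k \<in> A \<Longrightarrow> f k \<in> (\<lambda>s. v \<otimes> s) ` S \<and> f k \<in> set (geo (t k)) \<and>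
        {v, f k} \<in> snd (forward_tree G S \<omega>) \<and> length (geo (f k)) = Suc (Suc n)" by metis
    \<comment> \<open>The next vertices lie among the finitely many \<open>v \<otimes> s\<close>, so
      one of them is passed infinitely often.\<close>
    have "finite (f ` A)" using f finite_S by (meson finite_imageI finite_subset image_subsetI)
    then obtain k0 where k0: "k0 \<in> A" "infinite {k \<in> A. f k = f k0}" using pigeonhole_infinite[OF A] by blast
    have "{k \<in> A. f k = f k0} \<subseteq> {k. f k0 \<in> set (geo (t k))}" 
    proof
      fix k assume "k \<in> {k \<in> A. f k = f k0}"
      then have "k \<in> A" "f k = f k0" by auto
      then show "k \<in> {k. f k0 \<in> set (geo (t k))}" using f[of k] by simp
    qed
    then have "infinite {k. f k0 \<in> set (geo (t k))}" using k0(2) infinite_super by blast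
    then show "\<exists>w. P (Suc n) w \<and> {v, w} \<in> snd (forward_tree G S \<omega>)"
      using f[OF k0(1)] unfolding P_def by blast
  qed
  then obtain r where r: "\<And>n. P n (r n)" "\<And>n. {r n, r (Suc n)} \<in> snd (forward_tree G S \<omega>)" by blast
  have "r n \<in> carrier G" for n
  proof -
    obtain k where "r n \<in> set (geo (t k))" using r(1)[of n] unfolding P_def using not_finite_existsD by blast
    then show ?thesis using walk_between_ends(8)[OF fpp_geodesic_walk[OF geo[OF tc]]] by fastforce
  qed
  then show thesis using that[of r] r by (simp add: P_def)
qed

text \<open>Each vertex \<open>r k\<close> of the limit ray lies on geodesics to \<open>t n\<close>
  for arbitrarily large \<open>n\<close>. The part of such a geodesic beyond \<open>r k\<close> has
  tree distance at least \<open>k\<close> from \<open>\<one>\<close>, so its ends have a large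
  Gromov product; this makes \<open>r\<close> equivalent to \<open>t\<close>.\<close>

lemma forward_tree_surj:
  assumes \<zeta>: "\<zeta> \<in> gromov_boundary X"
  shows "\<exists>s\<in>gromov_seqs (forward_space G S \<omega>). s \<in> \<zeta>"
proof -
  let ?F = "forward_tree G S \<omega>"
  note T = geodesic_tree_forward
  note tree = geodesic_tree_tree[OF ty T]
  obtain t where t: "t \<in> gromov_seqs X" "\<zeta> = endpoint X t" using boundary_cases[OF hyperbolic \<zeta>] by blast
  have tc: "t n \<in> carrier G" for n using t by (auto simp: gromov_seqs_iff)
  obtain r where r: "\<And>n. r n \<in> carrier G" "\<And>n. {r n, r (Suc n)} \<in> snd ?F"
    "\<And>n. length (geo (r n)) = Suc n" "\<And>n. infinite {k. r n \<in> set (geo (t k))}"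
    using forward_tree_limit_ray[OF t(1)] by blast
  have "inj r" by (rule injI) (metis r(3) Suc_inject)
  then have rY: "r \<in> gromov_seqs (forward_space G S \<omega>)"
    unfolding forward_space_def using r forward_tree_verts by (intro tree_ray_gromov_seq tree) auto
  then have rX: "r \<in> gromov_seqs X" using geodesic_tree_cannon_thurston(2)[OF ty T] by (auto simp: forward_space_def)
  have close: "\<exists>K. \<forall>k\<ge>K. \<forall>n. r k \<in> set (geo (t n)) \<longrightarrow> R \<le> gprod X (r k) (t n)" for R
  proof -
    obtain K :: nat where K: "\<And>x y p. walk_between ?F x y p \<Longrightarrow> distinct p \<Longrightarrow>
        (\<And>v. v \<in> set p \<Longrightarrow> real K \<le> simplicial_dist ?F \<one> v) \<Longrightarrow> R \<le> gprod X x y"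
      using geodesic_tree_far[OF ty T] by metis
    have "R \<le> gprod X (r k) (t n)" if "K \<le> k" and n: "r k \<in> set (geo (t n))" for k n
    proof -
      define p where "p = geo (t n)"
      have p: "fpp_geodesic G S \<omega> \<one> (t n) p" unfolding p_def by (rule geo[OF tc])
      have pd: "distinct p" by (rule fpp_geodesic_distinct[OF typical_pos[OF ty] p])
      note w = forward_tree_walk[OF p]
      obtain i where i: "i < length p" "p ! i = r k" using n unfolding p_def by (metis in_set_conv_nth)
      \<comment> \<open>Prefixes are geodesics, so the height of \<open>r k\<close> fixes its
        position on \<open>p\<close>.\<close>
      have ik: "i = k" using geo_take[OF p i(1)] r(3)[of k] i by simp
      have "real K \<le> simplicial_dist ?F \<one> v" if v: "v \<in> set (drop i p)" for v
      proof -
        obtain j where j: "j < length (drop i p)" "drop i p ! j = v" using v by (metis in_set_conv_nth)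
        then have ij: "i + j < length p" "p ! (i + j) = v" by auto
        have "simplicial_dist ?F \<one> v = real (i + j)"
          using is_tree_simplicial_dist[OF tree walk_between_take[OF w ij(1)]] pd ij by simp
        then show ?thesis using \<open>K \<le> k\<close> ik by simp
      qed
      moreover have "walk_between ?F (r k) (t n) (drop i p)" using walk_between_drop[OF w i(1)] i(2) by simp
      ultimately show ?thesis using K[of "r k" "t n" "drop i p"] pd by simp
    qed
    then show ?thesis by blast
  qed
  obtain \<delta> where \<delta>: "0 < \<delta>" "\<And>x y z. x \<in> carrier G \<Longrightarrow> y \<in> carrier G \<Longrightarrow> z \<in> carrier G \<Longrightarrow>
    min (gprod X x y) (gprod X y z) - \<delta> \<le> gprod X x z"
    using hyperbolic_space_gprod[OF hyperbolic] by (metis cayley_space_simps(1))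
  have "\<exists>N. \<forall>i\<ge>N. \<forall>j\<ge>N. R \<le> gprod X (t i) (r j)" for R
  proof -
    obtain K where K: "\<forall>k\<ge>K. \<forall>n. r k \<in> set (geo (t n)) \<longrightarrow> R + \<delta> \<le> gprod X (r k) (t n)" using close by blast
    obtain N where N: "\<forall>i\<ge>N. \<forall>j\<ge>N. R + \<delta> \<le> gprod X (t i) (t j)" using t(1) unfolding gromov_seqs_iff by blast
    have "R \<le> gprod X (t i) (r j)" if ij: "i \<ge> max K N" "j \<ge> max K N" for i j
    proof -
      obtain n where n: "N \<le> n" "r j \<in> set (geo (t n))"
        using r(4)[of j] by (auto simp: infinite_nat_iff_unbounded_le)
      have "R + \<delta> \<le> gprod X (t i) (t n)" "R + \<delta> \<le> gprod X (r j) (t n)" using N K n ij by auto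
      moreover have "gprod X (r j) (t n) = gprod X (t n) (r j)"
        by (rule gromov_product_commute[OF hyperbolic_space_imp_Metric_space[OF hyperbolic]])
      ultimately show ?thesis using \<delta>(2)[of "t i" "t n" "r j"] tc r(1) by auto
    qed
    then show ?thesis by blast
  qed
  then have "(t, r) \<in> gromov_equiv X" using t(1) rX by (simp add: gromov_equiv_iff)
  then show ?thesis using rY t(2) by blast
qed

section \<open>The backward tree\<close>

lemma geodesic_sequence_inj:
  assumes "\<And>m n. m \<le> n \<Longrightarrow> \<exists>p. fpp_geodesic G S \<omega> (r m) (r n) p \<and> length p = Suc (n - m)"
  shows "inj (r :: nat \<Rightarrow> 'a)"
proof (rule linorder_injI)
  fix m n :: nat assume mn: "m < n"
  obtain p where p: "fpp_geodesic G S \<omega> (r m) (r n) p" "length p = Suc (n - m)" using assms[of m n] mn by auto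
  have "distinct p" by (rule fpp_geodesic_distinct[OF typical_pos[OF ty] p(1)])
  then have "p ! 0 \<noteq> p ! (length p - 1)" using p(2) mn by (subst nth_eq_iff_index_eq) auto
  then show "r m \<noteq> r n" using walk_between_ends(9,10)[OF fpp_geodesic_walk[OF p(1)]] by simp
qed

context
  fixes \<xi>
  assumes rays: "\<And>g. g \<in> carrier G \<Longrightarrow> \<exists>!r. fpp_ray_from_to G S \<omega> g \<xi> r"
    and backward_is_tree: "is_tree (backward_tree G S \<xi> \<omega>)"
begin

definition ray :: "'a \<Rightarrow> nat \<Rightarrow> 'a" where "ray g = (THE r. fpp_ray_from_to G S \<omega> g \<xi> r)"

lemma ray: "g \<in> carrier G \<Longrightarrow> fpp_ray_from_to G S \<omega> g \<xi> (ray g)"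
  unfolding ray_def using theI'[OF rays] .

lemma ray_eq: "g \<in> carrier G \<Longrightarrow> fpp_ray_from_to G S \<omega> g \<xi> r \<Longrightarrow> r = ray g"
  using ray rays by blast

lemma ray_geodesic: "fpp_ray_from_to G S \<omega> g \<xi> r \<Longrightarrow> m \<le> n \<Longrightarrow> fpp_geodesic G S \<omega> (r m) (r n) (map r [m..<Suc n])"
  unfolding fpp_ray_from_to_def fpp_ray_def by blast

lemma ray_in_carrier: "fpp_ray_from_to G S \<omega> g \<xi> r \<Longrightarrow> r n \<in> carrier G"
  using walk_between_ends(6)[OF fpp_geodesic_walk[OF ray_geodesic[of g r n n]]] by simp

lemma ray_0: "fpp_ray_from_to G S \<omega> g \<xi> r \<Longrightarrow> r 0 = g"
  by (simp add: fpp_ray_from_to_def)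

text \<open>Dropping finitely many terms does not change accumulation points. With uniqueness of
  rays this gives \<open>ray_ray\<close>: following rays is a semiflow towards \<xi>.\<close>

lemma ray_shift:
  assumes "fpp_ray_from_to G S \<omega> g \<xi> r" shows "fpp_ray_from_to G S \<omega> (r n) \<xi> (\<lambda>k. r (n + k))"
proof -
  have map: "map (\<lambda>k. r (n + k)) [i..<Suc j] = map r [n + i..<Suc (n + j)]" for i j
    by (rule nth_equalityI) (auto simp del: upt_Suc simp: add.assoc)
  have "fpp_ray G S \<omega> (\<lambda>k. r (n + k))"
    unfolding fpp_ray_def map using assms by (auto simp: fpp_ray_from_to_def fpp_ray_def simp del: upt_Suc)
  moreover have shift: "infinite {k. P (r (n + k))} \<longleftrightarrow> infinite {k. P (r k)}" for P
  proof -
    have "infinite {k. P (r (n + k))} \<longleftrightarrow> (\<forall>m. \<exists>k\<ge>m. P (r (n + k)))"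
      by (simp add: infinite_nat_iff_unbounded_le)
    also have "\<dots> \<longleftrightarrow> (\<forall>m. \<exists>k\<ge>m. P (r k))"
    proof (intro iffI allI)
      fix m assume "\<forall>m. \<exists>k\<ge>m. P (r (n + k))"
      then obtain k where "m \<le> k" "P (r (n + k))" by blast
      then show "\<exists>k\<ge>m. P (r k)" by (intro exI[of _ "n + k"]) auto
    next
      fix m assume "\<forall>m. \<exists>k\<ge>m. P (r k)"
      then obtain k where "n + m \<le> k" "P (r k)" by blast
      then show "\<exists>k\<ge>m. P (r (n + k))" by (intro exI[of _ "k - n"]) auto
    qed
    also have "\<dots> \<longleftrightarrow> infinite {k. P (r k)}" by (simp add: infinite_nat_iff_unbounded_le)
    finally show ?thesis .
  qed
  moreover have "has_direction G S (\<lambda>k. r (n + k)) \<xi>"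
    using assms unfolding fpp_ray_from_to_def has_direction_def shift[of "\<lambda>a. Inl a \<in> U" for U] by blast
  ultimately show ?thesis by (simp add: fpp_ray_from_to_def)
qed

lemma ray_ray: "g \<in> carrier G \<Longrightarrow> ray (ray g n) k = ray g (n + k)"
  using ray_eq[OF ray_in_carrier[OF ray] ray_shift[OF ray], of g n] by (simp add: fun_eq_iff)

lemma backward_tree_verts: "fst (backward_tree G S \<xi> \<omega>) = carrier G"
proof
  show "fst (backward_tree G S \<xi> \<omega>) \<subseteq> carrier G"
    using ray_in_carrier by (fastforce simp: backward_tree_def)
  show "carrier G \<subseteq> fst (backward_tree G S \<xi> \<omega>)"
  proof
    fix g assume g: "g \<in> carrier G"
    then have "g \<in> range (ray g)" using ray_0[OF ray[OF g]] by (metis rangeI)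
    then show "g \<in> fst (backward_tree G S \<xi> \<omega>)" using ray[OF g] g unfolding backward_tree_def by auto
  qed
qed

lemma backward_tree_edges:
  assumes "g \<in> carrier G" shows "{ray g n, ray g (Suc n)} \<in> snd (backward_tree G S \<xi> \<omega>)"
  using ray[OF assms] assms unfolding backward_tree_def by auto

lemma backward_tree_edgeE:
  assumes "e \<in> snd (backward_tree G S \<xi> \<omega>)"
  obtains g n where "g \<in> carrier G" "e = {ray g n, ray g (Suc n)}"
proof -
  obtain g r n where gr: "g \<in> carrier G" "fpp_ray_from_to G S \<omega> g \<xi> r" "e = {r n, r (Suc n)}"
    using assms unfolding backward_tree_def by auto
  then show thesis using that[OF gr(1), of n] ray_eq[OF gr(1,2)] by simp
qed

text \<open>For an edge of the tree, the ray from one end passes through the other end, so the two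
  rays share a tail; induction along the walk carries this over to its ends.\<close>

lemma rays_merge:
  assumes "walk_between (backward_tree G S \<xi> \<omega>) x y p" shows "\<exists>i j. ray x i = ray y j"
  using assms
proof (induction p arbitrary: x)
  case (Cons a p)
  note we = walk_between_ends[OF Cons.prems]
  show ?case
  proof (cases "p = []")
    case True
    then have "x = y" using we by auto
    then show ?thesis by blast
  next
    case False
    define z where "z = hd p"
    have ax: "a = x" and w: "walk_between (backward_tree G S \<xi> \<omega>) z y p" and e: "{x, z} \<in> snd (backward_tree G S \<xi> \<omega>)"
      using Cons.prems False by (auto simp: z_def walk_between_def path_edges_Cons)
    have xz: "x \<in> carrier G" "z \<in> carrier G" "y \<in> carrier G"
      using walk_between_ends(6,7)[OF w] we(6) backward_tree_verts by auto
    obtain g n where g: "g \<in> carrier G" "{x, z} = {ray g n, ray g (Suc n)}" using backward_tree_edgeE[OF e] .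
    have "ray (ray g n) 1 = ray (ray g (Suc n)) 0" using ray_ray[OF g(1)] by simp
    moreover have "(x = ray g n \<and> z = ray g (Suc n)) \<or> (z = ray g n \<and> x = ray g (Suc n))"
      using g(2) by (auto simp: doubleton_eq_iff)
    ultimately obtain i j where ij: "ray x i = ray z j" by metis
    obtain i' j' where ij': "ray z i' = ray y j'" using Cons.IH[OF w] by blast
    \<comment> \<open>By \<open>ray_ray\<close>, rays that coincide once still do after both indices
      are advanced by the same amount.\<close>
    have "ray x (i + i') = ray z (j + i')" using ij ray_ray[OF xz(1), of i i'] ray_ray[OF xz(2), of j i'] by simp
    also have "\<dots> = ray y (j' + j)"
      using ij' ray_ray[OF xz(2), of i' j] ray_ray[OF xz(3), of j' j] by (simp add: add.commute)
    finally show ?thesis by blast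
  qed
qed (simp add: walk_between_def)

lemma geodesic_tree_backward: "geodesic_tree \<omega> (backward_tree G S \<xi> \<omega>)"
proof -
  let ?T = "backward_tree G S \<xi> \<omega>"
  have init: "fpp_geodesic G S \<omega> x (ray x i) (map (ray x) [0..<Suc i]) \<and> walk_between ?T x (ray x i) (map (ray x) [0..<Suc i])"
    if "x \<in> carrier G" for x i
    using ray_geodesic[OF ray[OF that], of 0 i] ray_0[OF ray[OF that]] backward_tree_edges[OF that]
      walk_between_map_upt[of "ray x" ?T 0 i] ray_in_carrier[OF ray[OF that]] backward_tree_verts by simp
  have "\<exists>m p q. fpp_geodesic G S \<omega> x m p \<and> walk_between ?T x m p \<and> fpp_geodesic G S \<omega> y m q \<and> walk_between ?T y m q"
    if xy: "x \<in> carrier G" "y \<in> carrier G" for x y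
  proof -
    obtain p where "walk_between ?T x y p"
      using is_tree_ex_path[OF backward_is_tree] xy backward_tree_verts by metis
    \<comment> \<open>Both rays are cut at this common vertex, which serves as
      \<open>m\<close>.\<close>
    then obtain i j where "ray x i = ray y j" using rays_merge by blast
    then show ?thesis using init[OF xy(1), of i] init[OF xy(2), of j] by metis
  qed
  then show ?thesis using backward_is_tree backward_tree_verts by (simp add: geodesic_tree_def)
qed

text \<open>For \<xi> itself the ray from \<open>\<one>\<close> serves, for any other \<zeta> the
  negative half of a line. Both are Gromov sequences in the tree, hence in the Cayley graph, and
  therefore belong to the boundary point that is their direction.\<close>

lemma backward_tree_surj:
  assumes lines: "\<And>\<xi>'. \<xi>' \<in> gromov_boundary X \<Longrightarrow> \<xi>' \<noteq> \<xi> \<Longrightarrow>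
      \<exists>l. fpp_line G S \<omega> l \<and> range l \<subseteq> fst (backward_tree G S \<xi> \<omega>) \<and>
        (\<forall>k. {l k, l (k + 1)} \<in> snd (backward_tree G S \<xi> \<omega>)) \<and> has_direction G S (\<lambda>n. l (- int n)) \<xi>'"
    and \<zeta>: "\<zeta> \<in> gromov_boundary X"
  shows "\<exists>s\<in>gromov_seqs (backward_space G S \<xi> \<omega>). s \<in> \<zeta>"
proof -
  let ?T = "backward_tree G S \<xi> \<omega>"
  note T = geodesic_tree_backward
  have conv: "\<exists>s\<in>gromov_seqs (backward_space G S \<xi> \<omega>). s \<in> \<zeta>"
    if "\<And>n. s n \<in> carrier G" "\<And>n. {s n, s (Suc n)} \<in> snd ?T" "inj s" "has_direction G S s \<zeta>" for s
  proof -
    have s: "s \<in> gromov_seqs (simplicial_space ?T \<one>)"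
      using that backward_tree_verts by (intro tree_ray_gromov_seq backward_is_tree) auto
    then have "s \<in> \<zeta>" using direction_endpoint[OF that(4)] geodesic_tree_cannon_thurston(2)[OF ty T] by blast
    then show ?thesis using s by (auto simp: backward_space_def)
  qed
  show ?thesis
  proof (cases "\<zeta> = \<xi>")
    case True
    note r = ray[OF one_closed]
    have "inj (ray \<one>)" using ray_geodesic[OF r] by (intro geodesic_sequence_inj) (auto simp del: upt_Suc intro!: exI)
    moreover have "has_direction G S (ray \<one>) \<zeta>" using r True by (simp add: fpp_ray_from_to_def)
    ultimately show ?thesis
      using ray_in_carrier[OF r] backward_tree_edges[OF one_closed] by (intro conv[of "ray \<one>"]) auto
  next
    case False
    obtain l where l: "fpp_line G S \<omega> l" "range l \<subseteq> carrier G" "\<And>k. {l k, l (k + 1)} \<in> snd ?T"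
      "has_direction G S (\<lambda>n. l (- int n)) \<zeta>"
      using lines[OF \<zeta> False] backward_tree_verts by auto
    define s where "s = (\<lambda>n. l (- int n))"
    have "\<exists>p. fpp_geodesic G S \<omega> (s m) (s n) p \<and> length p = Suc (n - m)" if "m \<le> n" for m n
    proof -
      have "fpp_geodesic G S \<omega> (l (- int n)) (l (- int m)) (map l [- int n..- int m])"
        using l(1) that unfolding fpp_line_def by simp
      \<comment> \<open>\<open>s\<close> runs against the orientation of the line, so its segments
        are reversed.\<close>
      then have "fpp_geodesic G S \<omega> (s m) (s n) (rev (map l [- int n..- int m]))"
        unfolding s_def by (rule fpp_geodesic_rev[OF typical_nonneg[OF ty]])
      moreover have "length (rev (map l [- int n..- int m])) = Suc (n - m)" using that by simp
      ultimately show ?thesis by blast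
    qed
    then have "inj s" by (rule geodesic_sequence_inj)
    moreover have "{s n, s (Suc n)} \<in> snd ?T" for n
      using l(3)[of "- int (Suc n)"] by (simp add: s_def insert_commute)
    moreover have "s n \<in> carrier G" for n using l(2) by (auto simp: s_def)
    ultimately show ?thesis using l(4) by (intro conv[of s]) (simp_all add: s_def)
  qed
qed

end

end

end

theorem theorem3p11:
  fixes G :: "('a, 'b) monoid_scheme" and S :: "'a set" and \<rho> :: "real measure"
  assumes "group G"
    and "finite S" and "S \<subseteq> carrier G" and "\<forall>s\<in>S. inv\<^bsub>G\<^esub> s \<in> S" and "generate G S = carrier G"
    and "hyperbolic_space (cayley_space G S)" and "\<not> virtually_cyclic G"
    and "prob_space \<rho>" and "sets \<rho> = sets (restrict_space borel {0..})"
    and "\<forall>x\<ge>0. emeasure \<rho> {x} = 0"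
    and "\<exists>a>0. (\<integral>\<^sup>+ x. ennreal (exp (a * x)) \<partial>\<rho>) < \<infinity>"
  shows "\<exists>\<Omega>\<^sub>0. full_measure (fpp_measure G S \<rho>) \<Omega>\<^sub>0 \<and>
    (\<forall>\<omega>\<in>\<Omega>\<^sub>0.
       proper_embedding (forward_space G S \<omega>) (cayley_space G S) (\<lambda>x. x) \<and>
       two_proper_embedding (forward_space G S \<omega>) (cayley_space G S) (\<lambda>x. x) \<and>
       admits_cannon_thurston (forward_space G S \<omega>) (cayley_space G S) (\<lambda>x. x)) \<and>
    (\<forall>\<xi>\<in>gromov_boundary (cayley_space G S). \<forall>\<Omega>\<^sub>\<xi>. backward_admissible G S \<rho> \<xi> \<Omega>\<^sub>\<xi> \<longrightarrow>
       (\<forall>\<omega>\<in>\<Omega>\<^sub>0 \<inter> \<Omega>\<^sub>\<xi>.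
          proper_embedding (backward_space G S \<xi> \<omega>) (cayley_space G S) (\<lambda>x. x) \<and>
          two_proper_embedding (backward_space G S \<xi> \<omega>) (cayley_space G S) (\<lambda>x. x) \<and>
          admits_cannon_thurston (backward_space G S \<xi> \<omega>) (cayley_space G S) (\<lambda>x. x))) \<and>
    (\<exists>\<Omega>\<^sub>1\<subseteq>\<Omega>\<^sub>0. full_measure (fpp_measure G S \<rho>) \<Omega>\<^sub>1 \<and>
       (\<forall>\<omega>\<in>\<Omega>\<^sub>1.
          cannon_thurston_boundary_surj (forward_space G S \<omega>) (cayley_space G S) (\<lambda>x. x)) \<and>
       (\<forall>\<xi>\<in>gromov_boundary (cayley_space G S). \<forall>\<Omega>\<^sub>\<xi>. backward_admissible G S \<rho> \<xi> \<Omega>\<^sub>\<xi> \<longrightarrow>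
          (\<forall>\<omega>\<in>\<Omega>\<^sub>1 \<inter> \<Omega>\<^sub>\<xi>.
             cannon_thurston_boundary_surj (backward_space G S \<xi> \<omega>) (cayley_space G S) (\<lambda>x. x))))"
proof -
  have "hyperbolic_cayley G S"
    using assms(1-6) by (auto intro!: hyperbolic_cayley.intro hyperbolic_cayley_axioms.intro)
  moreover have "iid_weights \<rho>"
    using assms(8-10) by (auto intro!: iid_weights.intro iid_weights_axioms.intro)
  ultimately interpret fpp_environment G S \<rho>
    using assms(11) by (intro fpp_environment.intro fpp_environment_axioms.intro)
  \<comment> \<open>Typicality does not refer to \<xi>, so one set serves all boundary points and
    all choices of \<open>\<Omega>\<^sub>\<xi>\<close>.\<close>
  define \<Omega> where "\<Omega> = {\<omega> \<in> space (fpp_measure G S \<rho>). typical \<omega>}"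
  have full: "full_measure (fpp_measure G S \<rho>) \<Omega>"
    using AE_typical AE_space unfolding full_measure_def fpp_measure_def \<Omega>_def by (auto elim!: eventually_elim2)
  have ty: "typical \<omega>" if "\<omega> \<in> \<Omega>" for \<omega> using that by (simp add: \<Omega>_def)
  have forward: "proper_embedding (forward_space G S \<omega>) X (\<lambda>x. x) \<and>
      two_proper_embedding (forward_space G S \<omega>) X (\<lambda>x. x) \<and>
      admits_cannon_thurston (forward_space G S \<omega>) X (\<lambda>x. x) \<and>
      cannon_thurston_boundary_surj (forward_space G S \<omega>) X (\<lambda>x. x)" if "\<omega> \<in> \<Omega>" for \<omega>
  proof -
    note t = ty[OF that]
    note g = t geodesic_tree_forward[OF t]
    show ?thesis
      unfolding forward_space_def
      using geodesic_tree_proper(1)[OF g] geodesic_tree_two_proper[OF g] geodesic_tree_cannon_thurston(1)[OF g]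
        geodesic_tree_surj[OF g forward_tree_surj[OF t, unfolded forward_space_def]] by blast
  qed
  have backward: "proper_embedding (backward_space G S \<xi> \<omega>) X (\<lambda>x. x) \<and>
      two_proper_embedding (backward_space G S \<xi> \<omega>) X (\<lambda>x. x) \<and>
      admits_cannon_thurston (backward_space G S \<xi> \<omega>) X (\<lambda>x. x) \<and>
      cannon_thurston_boundary_surj (backward_space G S \<xi> \<omega>) X (\<lambda>x. x)"
    if "\<omega> \<in> \<Omega>" "\<omega> \<in> \<Omega>\<^sub>\<xi>" and adm: "backward_admissible G S \<rho> \<xi> \<Omega>\<^sub>\<xi>" for \<omega> \<xi> \<Omega>\<^sub>\<xi>
  proof -
    note t = ty[OF that(1)]
    note A = adm[unfolded backward_admissible_def, THEN conjunct2, THEN bspec, OF that(2)]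
    have rays: "\<And>g. g \<in> carrier G \<Longrightarrow> \<exists>!r. fpp_ray_from_to G S \<omega> g \<xi> r"
      by (rule A[THEN conjunct1, THEN bspec])
    have tree: "is_tree (backward_tree G S \<xi> \<omega>)" by (rule A[THEN conjunct2, THEN conjunct1])
    have lines: "\<exists>l. fpp_line G S \<omega> l \<and> range l \<subseteq> fst (backward_tree G S \<xi> \<omega>) \<and>
        (\<forall>k. {l k, l (k + 1)} \<in> snd (backward_tree G S \<xi> \<omega>)) \<and> has_direction G S (\<lambda>n. l (- int n)) \<xi>'"
      if "\<xi>' \<in> gromov_boundary X" "\<xi>' \<noteq> \<xi>" for \<xi>'
      using A[THEN conjunct2, THEN conjunct2, THEN bspec, OF that(1), THEN mp, OF that(2)]
      by (rule ex_forward) simp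
    note g = t geodesic_tree_backward[OF t rays tree]
    show ?thesis
      unfolding backward_space_def
      using geodesic_tree_proper(1)[OF g] geodesic_tree_two_proper[OF g] geodesic_tree_cannon_thurston(1)[OF g]
        geodesic_tree_surj[OF g backward_tree_surj[OF t rays tree lines, unfolded backward_space_def]] by blast
  qed
  \<comment> \<open>\<Omega> is both the first set and the further one on which surjectivity
    holds.\<close>
  show ?thesis
    using full forward backward by (intro exI[of _ \<Omega>]) blast
qed

end
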